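(* Let $A=\bigoplus_{i\in\mathbb{Z}}A_i$ be a $\mathbb{Z}$-graded ring, $R$ a subring of $A_0$, and $I\subseteq A_1$ and $J\subseteq A_{-1}$ additive subgroups such that: (1) $RI\subseteq I$, $IR\subseteq I$, $RJ\subseteq J$, $JR\subseteq J$ and $JI\subseteq R$; (2) for any finite subset $\{i_1,\dots,i_n\}\subseteq I$ there is an element $a\in IJ$ such that $a i_l=i_l$ for each $1\le l\le n$, and for any finite subset $\{j_1,\dots,j_m\}\subseteq J$ there is an element $b\in IJ$ such that $j_l b=j_l$ for each $1\le l\le m$; (3) for $r\in\operatorname{ann}_R(I)^\perp$ and $a\in IJ$, if $r-a\in\operatorname{ann}_{A_0}(I)$, then $a\in R$; (4) $\operatorname{ann}_R(I)\cap\operatorname{ann}_R(I)^\perp=\{0\}$. Then there exists an $R$-bimodule homomorphism $\psi:J\otimes_R I\to R$ such that $\psi(j\otimes_R i)=ji$ for each $j\in J$, $i\in I$, and $(J,I,\psi)$ is an $R$-system. Furthermore, there is a graded isomorphism from the Cuntz--Pimsner ring $\mathcal{O}_{(J,I,\psi)}$ of the $R$-system $(J,I,\psi)$ to the subring of $A$ generated by $R$, $I$, $J$.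
   Context: Rings are associative and need not be unital. A ring $A$ is $\mathbb{Z}$-graded if $A=\bigoplus_{n\in\mathbb{Z}}A_n$ with each $A_n$ an additive subgroup and $A_nA_m\subseteq A_{n+m}$; a ring homomorphism between graded rings is graded if it maps the degree-$n$ component into the degree-$n$ component for all $n$. For additive subgroups $X,Y$ of a ring, $XY$ denotes the additive subgroup generated by all products $xy$ with $x\in X$, $y\in Y$. The subring $S$ generated by $R\cup I\cup J$ is graded by $S_n=S\cap A_n$. Annihilators: for a ring $R$ and a subset $I$ of a left $R$-module, $\operatorname{ann}_R(I)=\{r\in R: rx=0\text{ for all }x\in I\}$. For a two-sided ideal $L$ of $R$, $L^\perp=\{r\in R: ry=yr=0\text{ for all }y\in L\}$. Thus $\operatorname{ann}_R(I)^\perp$ is formed inside $R$, and $\operatorname{ann}_{A_0}(I)=\{x\in A_0: xi=0\text{ for all }i\in I\}$. Cuntz--Pimsner rings (Carlsen--Ortega). Let $R$ be a ring. An $R$-system is a triple $(P,Q,\psi)$ with $P,Q$ $R$-bimodules and $\psi:P\otimes_R Q\to R$ an $R$-bimodule homomorphism ($\otimes_R$ is the $R$-balanced tensor product). A covariant representation $(S,T,\sigma,B)$ of $(P,Q,\psi)$ consists of a ring $B$, additive maps $S:P\to B$, $T:Q\to B$, and a ring homomorphism $\sigma:R\to B$ such that $S(pr)=S(p)\sigma(r)$, $S(rp)=\sigma(r)S(p)$, $T(qr)=T(q)\sigma(r)$, $T(rq)=\sigma(r)T(q)$ and $\sigma(\psi(p\otimes_R q))=S(p)T(q)$ for all $r\in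 R,p\in P,q\in Q$. The Toeplitz ring $\mathcal{T}_{(P,Q,\psi)}$, with maps $\iota_P,\iota_Q,\iota_R$, is the universal covariant representation: it is generated as a ring by $\iota_R(R)\cup\iota_Q(Q)\cup\iota_P(P)$, and every covariant representation $(S,T,\sigma,B)$ factors uniquely through a ring homomorphism $\mathcal{T}_{(P,Q,\psi)}\to B$. It is $\mathbb{Z}$-graded with $\iota_R(R)$ in degree $0$, $\iota_Q(Q)$ in degree $1$ and $\iota_P(P)$ in degree $-1$. For $p\in P,q\in Q$ let $\theta_{q,p}:Q\to Q$, $\theta_{q,p}(x)=q\,\psi(p\otimes_R x)$, and $\theta_{p,q}:P\to P$, $\theta_{p,q}(y)=\psi(y\otimes_R q)\,p$. Let $\mathcal{F}_P(Q)$ be the additive span of the maps $\theta_{q,p}$ and $\mathcal{F}_Q(P)$ the additive span of the maps $\theta_{p,q}$. The system satisfies condition (FS) if for all finite sets $\{q_1,\dots,q_n\}\subseteq Q$ and $\{p_1,\dots,p_m\}\subseteq P$ there are $\Theta\in\mathcal{F}_P(Q)$ and $\Phi\in\mathcal{F}_Q(P)$ with $\Theta(q_i)=q_i$ and $\Phi(p_j)=p_j$ for all $i,j$. Let $\Delta:R\to\operatorname{End}_R(Q_R)$ be $\Delta(r)(q)=rq$. Under (FS), for each covariant representation $(S,T,\sigma,B)$ there is a unique ring homomorphism $\pi_{T,S}:\mathcal{F}_P(Q)\to B$ with $\pi_{T,S}(\theta_{q,p})=T(q)S(p)$ (a known fact). A two-sided ideal $L$ of $R$ is $\psi$-compatible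 if $L\subseteq\Delta^{-1}(\mathcal{F}_P(Q))$, and a $\psi$-compatible $L$ is faithful if $L\cap\ker\Delta=\{0\}$. A faithful $\psi$-compatible two-sided ideal $L$ is uniquely maximal if it contains every faithful $\psi$-compatible two-sided ideal of $R$. If the system satisfies (FS) and a uniquely maximal faithful $\psi$-compatible two-sided ideal $L$ exists, the Cuntz--Pimsner ring is $\mathcal{O}_{(P,Q,\psi)}=\mathcal{T}_{(P,Q,\psi)}/\mathcal{T}(L)$, where $\mathcal{T}(L)$ is the two-sided ideal generated by $\{\iota_R(x)-\pi_{\iota_Q,\iota_P}(\Delta(x)):x\in L\}$; it inherits the $\mathbb{Z}$-grading of $\mathcal{T}_{(P,Q,\psi)}$. An assertion about the Cuntz--Pimsner ring of a system is understood to include that it is defined (i.e. (FS) holds and such an $L$ exists). *)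

theory Defs
  imports "HOL-Algebra.QuotRing" "HOL-Algebra.Generated_Groups" "HOL-Algebra.Free_Abelian_Groups"
begin

section \<open>Rings without unit\<close>

text \<open>Rings are carried by the records of HOL-Algebra; their field \<open>one\<close> is never referred to, and
  is filled with an arbitrary value where a record has to be written down.\<close>

locale rng = abelian_group R for R (structure) +
  assumes m_closed [intro, simp]: "\<lbrakk>x \<in> carrier R; y \<in> carrier R\<rbrakk> \<Longrightarrow> x \<otimes> y \<in> carrier R"
    and m_assoc: "\<lbrakk>x \<in> carrier R; y \<in> carrier R; z \<in> carrier R\<rbrakk> \<Longrightarrow> (x \<otimes> y) \<otimes> z = x \<otimes> (y \<otimes> z)"
    and l_distr: "\<lbrakk>x \<in> carrier R; y \<in> carrier R; z \<in> carrier R\<rbrakk> \<Longrightarrow> (x \<oplus> y) \<otimes> z = x \<otimes> z \<oplus> y \<otimes> z"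
    and r_distr: "\<lbrakk>x \<in> carrier R; y \<in> carrier R; z \<in> carrier R\<rbrakk> \<Longrightarrow> z \<otimes> (x \<oplus> y) = z \<otimes> x \<oplus> z \<otimes> y"

locale subrng = additive_subgroup H R for H and R (structure) +
  assumes sub_m_closed: "\<lbrakk>x \<in> H; y \<in> H\<rbrakk> \<Longrightarrow> x \<otimes> y \<in> H"

locale rng_ideal = additive_subgroup K R for K and R (structure) +
  assumes l_ideal: "\<lbrakk>x \<in> K; r \<in> carrier R\<rbrakk> \<Longrightarrow> r \<otimes> x \<in> K"
    and r_ideal: "\<lbrakk>x \<in> K; r \<in> carrier R\<rbrakk> \<Longrightarrow> x \<otimes> r \<in> K"

definition gen_subrng :: "('a, 'm) ring_scheme \<Rightarrow> 'a set \<Rightarrow> 'a set"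
  where "gen_subrng A X = \<Inter> {S. subrng S A \<and> X \<subseteq> S}"

definition gen_rng_ideal :: "('a, 'm) ring_scheme \<Rightarrow> 'a set \<Rightarrow> 'a set"
  where "gen_rng_ideal A X = \<Inter> {K. rng_ideal K A \<and> X \<subseteq> K}"

definition rng_hom :: "('a, 'm) ring_scheme \<Rightarrow> ('b, 'n) ring_scheme \<Rightarrow> ('a \<Rightarrow> 'b) set"
  where "rng_hom A B = {h \<in> hom (add_monoid A) (add_monoid B).
     \<forall>x\<in>carrier A. \<forall>y\<in>carrier A. h (x \<otimes>\<^bsub>A\<^esub> y) = h x \<otimes>\<^bsub>B\<^esub> h y}"

definition subgroup_prod :: "('a, 'm) ring_scheme \<Rightarrow> 'a set \<Rightarrow> 'a set \<Rightarrow> 'a set"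
  where "subgroup_prod A X Y = generate (add_monoid A) {x \<otimes>\<^bsub>A\<^esub> y |x y. x \<in> X \<and> y \<in> Y}"

definition annih :: "('a, 'm) ring_scheme \<Rightarrow> 'a set \<Rightarrow> 'a set \<Rightarrow> 'a set"
  where "annih A R X = {r \<in> R. \<forall>x\<in>X. r \<otimes>\<^bsub>A\<^esub> x = \<zero>\<^bsub>A\<^esub>}"

definition perp :: "('a, 'm) ring_scheme \<Rightarrow> 'a set \<Rightarrow> 'a set"
  where "perp R L = {r \<in> carrier R. \<forall>y\<in>L. r \<otimes>\<^bsub>R\<^esub> y = \<zero>\<^bsub>R\<^esub> \<and> y \<otimes>\<^bsub>R\<^esub> r = \<zero>\<^bsub>R\<^esub>}"

locale graded_rng = rng A for A (structure) +
  fixes G :: "int \<Rightarrow> 'a set"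
  assumes homogeneous_subgroup: "additive_subgroup (G n) A"
    and homogeneous_mult: "\<lbrakk>x \<in> G n; y \<in> G m\<rbrakk> \<Longrightarrow> x \<otimes> y \<in> G (n + m)"
    and direct_sum: "x \<in> carrier A \<Longrightarrow>
      \<exists>!f. (\<forall>n. f n \<in> G n) \<and> finite {n. f n \<noteq> \<zero>} \<and> x = (\<Oplus>n\<in>{n. f n \<noteq> \<zero>}. f n)"

locale graded_rng_iso = A: graded_rng A G + B: graded_rng B H
  for A (structure) and G and B (structure) and H +
  fixes h
  assumes is_rng_hom: "h \<in> rng_hom A B"
    and degree_preserving: "h ` G n \<subseteq> H n"
    and bijective: "bij_betw h (carrier A) (carrier B)"


section \<open>Bimodules and the balanced tensor product\<close>

record ('r, 'm) bimodule = "'m ring" +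
  lact :: "'r \<Rightarrow> 'm \<Rightarrow> 'm"
  ract :: "'m \<Rightarrow> 'r \<Rightarrow> 'm"

locale bimodule = R: rng R + M: abelian_group M for R (structure) and M (structure) +
  assumes lact_closed: "\<lbrakk>r \<in> carrier R; x \<in> carrier M\<rbrakk> \<Longrightarrow> lact M r x \<in> carrier M"
    and ract_closed: "\<lbrakk>r \<in> carrier R; x \<in> carrier M\<rbrakk> \<Longrightarrow> ract M x r \<in> carrier M"
    and lact_add: "\<lbrakk>r \<in> carrier R; x \<in> carrier M; y \<in> carrier M\<rbrakk> \<Longrightarrow>
      lact M r (x \<oplus>\<^bsub>M\<^esub> y) = lact M r x \<oplus>\<^bsub>M\<^esub> lact M r y"
    and ract_add: "\<lbrakk>r \<in> carrier R; x \<in> carrier M; y \<in> carrier M\<rbrakk> \<Longrightarrow>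
      ract M (x \<oplus>\<^bsub>M\<^esub> y) r = ract M x r \<oplus>\<^bsub>M\<^esub> ract M y r"
    and add_lact: "\<lbrakk>r \<in> carrier R; s \<in> carrier R; x \<in> carrier M\<rbrakk> \<Longrightarrow>
      lact M (r \<oplus> s) x = lact M r x \<oplus>\<^bsub>M\<^esub> lact M s x"
    and add_ract: "\<lbrakk>r \<in> carrier R; s \<in> carrier R; x \<in> carrier M\<rbrakk> \<Longrightarrow>
      ract M x (r \<oplus> s) = ract M x r \<oplus>\<^bsub>M\<^esub> ract M x s"
    and mult_lact: "\<lbrakk>r \<in> carrier R; s \<in> carrier R; x \<in> carrier M\<rbrakk> \<Longrightarrow>
      lact M (r \<otimes> s) x = lact M r (lact M s x)"
    and mult_ract: "\<lbrakk>r \<in> carrier R; s \<in> carrier R; x \<in> carrier M\<rbrakk> \<Longrightarrow>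
      ract M x (r \<otimes> s) = ract M (ract M x r) s"
    and lact_ract: "\<lbrakk>r \<in> carrier R; s \<in> carrier R; x \<in> carrier M\<rbrakk> \<Longrightarrow>
      ract M (lact M r x) s = lact M r (ract M x s)"

definition bimodule_hom ::
    "('r, 'k) ring_scheme \<Rightarrow> ('r, 'm, 'c) bimodule_scheme \<Rightarrow> ('r, 'n, 'd) bimodule_scheme
      \<Rightarrow> ('m \<Rightarrow> 'n) set"
  where "bimodule_hom R M N = {h \<in> hom (add_monoid M) (add_monoid N).
     \<forall>r\<in>carrier R. \<forall>x\<in>carrier M. h (lact M r x) = lact N r (h x) \<and> h (ract M x r) = ract N (h x) r}"

text \<open>An additive subgroup \<open>X\<close> of a ring \<open>A\<close>, viewed as a bimodule via the multiplication of \<open>A\<close>.\<close>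

definition ring_bimodule :: "('a, 'm) ring_scheme \<Rightarrow> 'a set \<Rightarrow> ('a, 'a) bimodule"
  where "ring_bimodule A X = \<lparr>carrier = X, monoid.mult = monoid.mult A, one = one A,
     ring.zero = ring.zero A, ring.add = add A, lact = monoid.mult A, ract = monoid.mult A\<rparr>"

text \<open>\<open>P \<otimes>\<^sub>R Q\<close> is the free abelian group on \<open>P \<times> Q\<close> modulo the subgroup of balancing relations;
  its elements are cosets, on which the two actions are defined by the union of the cosets of the
  results on representatives. The fields \<open>mult\<close> and \<open>one\<close> carry no meaning.\<close>

definition tensor_rels ::
    "('r, 'k) ring_scheme \<Rightarrow> ('r, 'p, 'c) bimodule_scheme \<Rightarrow> ('r, 'q, 'd) bimodule_scheme
      \<Rightarrow> ('p \<times> 'q \<Rightarrow>\<^sub>0 int) set"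
  where "tensor_rels R P Q =
     {frag_of (p \<oplus>\<^bsub>P\<^esub> p', q) - frag_of (p, q) - frag_of (p', q) |p p' q.
        p \<in> carrier P \<and> p' \<in> carrier P \<and> q \<in> carrier Q}
   \<union> {frag_of (p, q \<oplus>\<^bsub>Q\<^esub> q') - frag_of (p, q) - frag_of (p, q') |p q q'.
        p \<in> carrier P \<and> q \<in> carrier Q \<and> q' \<in> carrier Q}
   \<union> {frag_of (ract P p r, q) - frag_of (p, lact Q r q) |p r q.
        p \<in> carrier P \<and> r \<in> carrier R \<and> q \<in> carrier Q}"

definition tensor_sub ::
    "('r, 'k) ring_scheme \<Rightarrow> ('r, 'p, 'c) bimodule_scheme \<Rightarrow> ('r, 'q, 'd) bimodule_scheme
      \<Rightarrow> ('p \<times> 'q \<Rightarrow>\<^sub>0 int) set"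
  where "tensor_sub R P Q =
     generate (free_Abelian_group (carrier P \<times> carrier Q)) (tensor_rels R P Q)"

definition tensor_coset ::
    "('r, 'k) ring_scheme \<Rightarrow> ('r, 'p, 'c) bimodule_scheme \<Rightarrow> ('r, 'q, 'd) bimodule_scheme
      \<Rightarrow> ('p \<times> 'q \<Rightarrow>\<^sub>0 int) \<Rightarrow> ('p \<times> 'q \<Rightarrow>\<^sub>0 int) set"
  where "tensor_coset R P Q x =
     tensor_sub R P Q #>\<^bsub>free_Abelian_group (carrier P \<times> carrier Q)\<^esub> x"

definition tensor ::
    "('r, 'k) ring_scheme \<Rightarrow> ('r, 'p, 'c) bimodule_scheme \<Rightarrow> ('r, 'q, 'd) bimodule_scheme
      \<Rightarrow> ('r, ('p \<times> 'q \<Rightarrow>\<^sub>0 int) set) bimodule"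
  where "tensor R P Q = (let F = free_Abelian_group (carrier P \<times> carrier Q); N = tensor_sub R P Q in
     \<lparr>carrier = carrier (F Mod N), monoid.mult = (\<lambda>_ _. N), one = N,
      ring.zero = N, ring.add = monoid.mult (F Mod N),
      lact = (\<lambda>r X. \<Union>x\<in>X. tensor_coset R P Q (frag_extend (\<lambda>(p, q). frag_of (lact P r p, q)) x)),
      ract = (\<lambda>X r. \<Union>x\<in>X. tensor_coset R P Q (frag_extend (\<lambda>(p, q). frag_of (p, ract Q q r)) x))\<rparr>)"

definition tens ::
    "('r, 'k) ring_scheme \<Rightarrow> ('r, 'p, 'c) bimodule_scheme \<Rightarrow> ('r, 'q, 'd) bimodule_scheme
      \<Rightarrow> 'p \<Rightarrow> 'q \<Rightarrow> ('p \<times> 'q \<Rightarrow>\<^sub>0 int) set"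
  where "tens R P Q p q = tensor_coset R P Q (frag_of (p, q))"


section \<open>Systems and covariant representations\<close>

locale R_system = P: bimodule R P + Q: bimodule R Q
  for R (structure) and P (structure) and Q (structure) and \<psi> +
  assumes psi_hom: "\<psi> \<in> bimodule_hom R (tensor R P Q) (ring_bimodule R (carrier R))"

locale covariant_rep = R_system R P Q \<psi> + B: rng B
  for R (structure) and P (structure) and Q (structure) and \<psi> and S T \<sigma> and B (structure) +
  assumes S_add: "S \<in> hom (add_monoid P) (add_monoid B)"
    and T_add: "T \<in> hom (add_monoid Q) (add_monoid B)"
    and sigma_hom: "\<sigma> \<in> rng_hom R B"
    and S_ract: "\<lbrakk>r \<in> carrier R; p \<in> carrier P\<rbrakk> \<Longrightarrow> S (ract P p r) = S p \<otimes>\<^bsub>B\<^esub> \<sigma> r"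
    and S_lact: "\<lbrakk>r \<in> carrier R; p \<in> carrier P\<rbrakk> \<Longrightarrow> S (lact P r p) = \<sigma> r \<otimes>\<^bsub>B\<^esub> S p"
    and T_ract: "\<lbrakk>r \<in> carrier R; q \<in> carrier Q\<rbrakk> \<Longrightarrow> T (ract Q q r) = T q \<otimes>\<^bsub>B\<^esub> \<sigma> r"
    and T_lact: "\<lbrakk>r \<in> carrier R; q \<in> carrier Q\<rbrakk> \<Longrightarrow> T (lact Q r q) = \<sigma> r \<otimes>\<^bsub>B\<^esub> T q"
    and sigma_psi: "\<lbrakk>p \<in> carrier P; q \<in> carrier Q\<rbrakk> \<Longrightarrow> \<sigma> (\<psi> (tens R P Q p q)) = S p \<otimes>\<^bsub>B\<^esub> T q"


section \<open>The Toeplitz ring\<close>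

text \<open>The free non-unital ring on \<open>X\<close>: integer combinations of nonempty words over \<open>X\<close>.\<close>

definition word_mult :: "('x list \<Rightarrow>\<^sub>0 int) \<Rightarrow> ('x list \<Rightarrow>\<^sub>0 int) \<Rightarrow> ('x list \<Rightarrow>\<^sub>0 int)"
  where "word_mult x y = frag_extend (\<lambda>u. frag_extend (\<lambda>v. frag_of (u @ v)) y) x"

definition free_rng :: "'x set \<Rightarrow> ('x list \<Rightarrow>\<^sub>0 int) ring"
  where "free_rng X = \<lparr>carrier = {c. Poly_Mapping.keys c \<subseteq> lists X - {[]}}, monoid.mult = word_mult,
     one = 0, ring.zero = 0, ring.add = (+)\<rparr>"

datatype ('r, 'p, 'q) gen = GR 'r | GP 'p | GQ 'q

definition toeplitz_gens ::
    "('r, 'k) ring_scheme \<Rightarrow> ('r, 'p, 'c) bimodule_scheme \<Rightarrow> ('r, 'q, 'd) bimodule_scheme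
      \<Rightarrow> ('r, 'p, 'q) gen set"
  where "toeplitz_gens R P Q = GR ` carrier R \<union> GP ` carrier P \<union> GQ ` carrier Q"

definition toeplitz_rels ::
    "('r, 'k) ring_scheme \<Rightarrow> ('r, 'p, 'c) bimodule_scheme \<Rightarrow> ('r, 'q, 'd) bimodule_scheme
      \<Rightarrow> (('p \<times> 'q \<Rightarrow>\<^sub>0 int) set \<Rightarrow> 'r) \<Rightarrow> (('r, 'p, 'q) gen list \<Rightarrow>\<^sub>0 int) set"
  where "toeplitz_rels R P Q \<psi> =
     {frag_of [GR (r \<oplus>\<^bsub>R\<^esub> s)] - frag_of [GR r] - frag_of [GR s] |r s. r \<in> carrier R \<and> s \<in> carrier R}
   \<union> {frag_of [GP (p \<oplus>\<^bsub>P\<^esub> p')] - frag_of [GP p] - frag_of [GP p'] |p p'. p \<in> carrier P \<and> p' \<in> carrier P}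
   \<union> {frag_of [GQ (q \<oplus>\<^bsub>Q\<^esub> q')] - frag_of [GQ q] - frag_of [GQ q'] |q q'. q \<in> carrier Q \<and> q' \<in> carrier Q}
   \<union> {frag_of [GR (r \<otimes>\<^bsub>R\<^esub> s)] - frag_of [GR r, GR s] |r s. r \<in> carrier R \<and> s \<in> carrier R}
   \<union> {frag_of [GP (ract P p r)] - frag_of [GP p, GR r] |p r. p \<in> carrier P \<and> r \<in> carrier R}
   \<union> {frag_of [GP (lact P r p)] - frag_of [GR r, GP p] |p r. p \<in> carrier P \<and> r \<in> carrier R}
   \<union> {frag_of [GQ (ract Q q r)] - frag_of [GQ q, GR r] |q r. q \<in> carrier Q \<and> r \<in> carrier R}
   \<union> {frag_of [GQ (lact Q r q)] - frag_of [GR r, GQ q] |q r. q \<in> carrier Q \<and> r \<in> carrier R}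
   \<union> {frag_of [GR (\<psi> (tens R P Q p q))] - frag_of [GP p, GQ q] |p q. p \<in> carrier P \<and> q \<in> carrier Q}"

definition toeplitz_coset ::
    "('r, 'k) ring_scheme \<Rightarrow> ('r, 'p, 'c) bimodule_scheme \<Rightarrow> ('r, 'q, 'd) bimodule_scheme
      \<Rightarrow> (('p \<times> 'q \<Rightarrow>\<^sub>0 int) set \<Rightarrow> 'r) \<Rightarrow> (('r, 'p, 'q) gen list \<Rightarrow>\<^sub>0 int)
      \<Rightarrow> (('r, 'p, 'q) gen list \<Rightarrow>\<^sub>0 int) set"
  where "toeplitz_coset R P Q \<psi> x = (let F = free_rng (toeplitz_gens R P Q) in
     gen_rng_ideal F (toeplitz_rels R P Q \<psi>) +>\<^bsub>F\<^esub> x)"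

text \<open>The universal covariant representation, constructed by generators and relations; its
  universal property is established in \<open>toeplitz_covariant\<close>, \<open>toeplitz_universal\<close> and
  \<open>toeplitz_hom_unique\<close> below.\<close>

definition toeplitz ::
    "('r, 'k) ring_scheme \<Rightarrow> ('r, 'p, 'c) bimodule_scheme \<Rightarrow> ('r, 'q, 'd) bimodule_scheme
      \<Rightarrow> (('p \<times> 'q \<Rightarrow>\<^sub>0 int) set \<Rightarrow> 'r) \<Rightarrow> (('r, 'p, 'q) gen list \<Rightarrow>\<^sub>0 int) set ring"
  where "toeplitz R P Q \<psi> = (let F = free_rng (toeplitz_gens R P Q) in
     F Quot gen_rng_ideal F (toeplitz_rels R P Q \<psi>))"

definition iota_R where "iota_R R P Q \<psi> r = toeplitz_coset R P Q \<psi> (frag_of [GR r])"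
definition iota_P where "iota_P R P Q \<psi> p = toeplitz_coset R P Q \<psi> (frag_of [GP p])"
definition iota_Q where "iota_Q R P Q \<psi> q = toeplitz_coset R P Q \<psi> (frag_of [GQ q])"

fun gen_degree :: "('r, 'p, 'q) gen \<Rightarrow> int"
  where "gen_degree (GR r) = 0"
  | "gen_degree (GP p) = - 1"
  | "gen_degree (GQ q) = 1"

definition toeplitz_grading ::
    "('r, 'k) ring_scheme \<Rightarrow> ('r, 'p, 'c) bimodule_scheme \<Rightarrow> ('r, 'q, 'd) bimodule_scheme
      \<Rightarrow> (('p \<times> 'q \<Rightarrow>\<^sub>0 int) set \<Rightarrow> 'r) \<Rightarrow> int \<Rightarrow> (('r, 'p, 'q) gen list \<Rightarrow>\<^sub>0 int) set set"
  where "toeplitz_grading R P Q \<psi> n = toeplitz_coset R P Q \<psi> `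
     {x \<in> carrier (free_rng (toeplitz_gens R P Q)).
        \<forall>w\<in>Poly_Mapping.keys x. sum_list (map gen_degree w) = n}"


section \<open>The Cuntz-Pimsner ring\<close>

text \<open>Endomorphisms are represented by functions that are \<open>undefined\<close> outside the carrier.\<close>

definition right_End ::
    "('r, 'k) ring_scheme \<Rightarrow> ('r, 'm, 'c) bimodule_scheme \<Rightarrow> ('m \<Rightarrow> 'm) ring"
  where "right_End R M =
     \<lparr>carrier = {f \<in> hom (add_monoid M) (add_monoid M) \<inter> extensional (carrier M).
        \<forall>x\<in>carrier M. \<forall>r\<in>carrier R. f (ract M x r) = ract M (f x) r},
      monoid.mult = compose (carrier M), one = restrict id (carrier M),
      ring.zero = (\<lambda>x\<in>carrier M. \<zero>\<^bsub>M\<^esub>), ring.add = (\<lambda>f g. \<lambda>x\<in>carrier M. f x \<oplus>\<^bsub>M\<^esub> g x)\<rparr>"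

definition left_End ::
    "('r, 'k) ring_scheme \<Rightarrow> ('r, 'm, 'c) bimodule_scheme \<Rightarrow> ('m \<Rightarrow> 'm) ring"
  where "left_End R M = (right_End R M)\<lparr>carrier :=
     {f \<in> hom (add_monoid M) (add_monoid M) \<inter> extensional (carrier M).
        \<forall>x\<in>carrier M. \<forall>r\<in>carrier R. f (lact M r x) = lact M r (f x)}\<rparr>"

text \<open>\<open>theta_Q q p\<close> is \<open>\<theta>\<^bsub>q,p\<^esub>\<close> on \<open>Q\<close>, and \<open>theta_P p q\<close> is \<open>\<theta>\<^bsub>p,q\<^esub>\<close> on \<open>P\<close>.\<close>

definition theta_Q where
  "theta_Q R P Q \<psi> q p = (\<lambda>x\<in>carrier Q. ract Q q (\<psi> (tens R P Q p x)))"

definition theta_P where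
  "theta_P R P Q \<psi> p q = (\<lambda>y\<in>carrier P. lact P (\<psi> (tens R P Q y q)) p)"

definition finite_rank_Q where
  "finite_rank_Q R P Q \<psi> = generate (add_monoid (right_End R Q))
     {theta_Q R P Q \<psi> q p |q p. q \<in> carrier Q \<and> p \<in> carrier P}"

definition finite_rank_P where
  "finite_rank_P R P Q \<psi> = generate (add_monoid (left_End R P))
     {theta_P R P Q \<psi> p q |p q. p \<in> carrier P \<and> q \<in> carrier Q}"

definition condition_FS where
  "condition_FS R P Q \<psi> \<longleftrightarrow>
     (\<forall>X Y. finite X \<and> X \<subseteq> carrier Q \<and> finite Y \<and> Y \<subseteq> carrier P \<longrightarrow>
        (\<exists>\<Theta>\<in>finite_rank_Q R P Q \<psi>. \<exists>\<Phi>\<in>finite_rank_P R P Q \<psi>.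
           (\<forall>q\<in>X. \<Theta> q = q) \<and> (\<forall>p\<in>Y. \<Phi> p = p)))"

definition Delta where
  "Delta Q r = (\<lambda>q\<in>carrier Q. lact Q r q)"

definition rep_pi where
  "rep_pi R P Q \<psi> S T B = (THE \<pi>.
     \<pi> \<in> rng_hom ((right_End R Q)\<lparr>carrier := finite_rank_Q R P Q \<psi>\<rparr>) B
     \<and> \<pi> \<in> extensional (finite_rank_Q R P Q \<psi>)
     \<and> (\<forall>q\<in>carrier Q. \<forall>p\<in>carrier P. \<pi> (theta_Q R P Q \<psi> q p) = T q \<otimes>\<^bsub>B\<^esub> S p))"

definition psi_compatible where
  "psi_compatible R P Q \<psi> L \<longleftrightarrow> rng_ideal L R \<and> Delta Q ` L \<subseteq> finite_rank_Q R P Q \<psi>"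

definition faithful_compatible where
  "faithful_compatible R P Q \<psi> L \<longleftrightarrow> psi_compatible R P Q \<psi> L
     \<and> L \<inter> a_kernel R (right_End R Q) (Delta Q) = {\<zero>\<^bsub>R\<^esub>}"

definition uniquely_maximal where
  "uniquely_maximal R P Q \<psi> L \<longleftrightarrow> faithful_compatible R P Q \<psi> L
     \<and> (\<forall>L'. faithful_compatible R P Q \<psi> L' \<longrightarrow> L' \<subseteq> L)"

definition cuntz_pimsner_defined where
  "cuntz_pimsner_defined R P Q \<psi> \<longleftrightarrow> condition_FS R P Q \<psi> \<and> (\<exists>L. uniquely_maximal R P Q \<psi> L)"

definition toeplitz_ideal ::
    "('r, 'k) ring_scheme \<Rightarrow> ('r, 'p, 'c) bimodule_scheme \<Rightarrow> ('r, 'q, 'd) bimodule_scheme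
      \<Rightarrow> (('p \<times> 'q \<Rightarrow>\<^sub>0 int) set \<Rightarrow> 'r) \<Rightarrow> 'r set \<Rightarrow> (('r, 'p, 'q) gen list \<Rightarrow>\<^sub>0 int) set set"
  where "toeplitz_ideal R P Q \<psi> L = gen_rng_ideal (toeplitz R P Q \<psi>)
     {iota_R R P Q \<psi> x \<ominus>\<^bsub>toeplitz R P Q \<psi>\<^esub>
        rep_pi R P Q \<psi> (iota_P R P Q \<psi>) (iota_Q R P Q \<psi>) (toeplitz R P Q \<psi>) (Delta Q x) |x. x \<in> L}"

text \<open>The following two definitions are meaningful under \<open>cuntz_pimsner_defined\<close>; there is then only
  one uniquely maximal ideal.\<close>

definition cuntz_pimsner ::
    "('r, 'k) ring_scheme \<Rightarrow> ('r, 'p, 'c) bimodule_scheme \<Rightarrow> ('r, 'q, 'd) bimodule_scheme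
      \<Rightarrow> (('p \<times> 'q \<Rightarrow>\<^sub>0 int) set \<Rightarrow> 'r) \<Rightarrow> (('r, 'p, 'q) gen list \<Rightarrow>\<^sub>0 int) set set ring"
  where "cuntz_pimsner R P Q \<psi> = toeplitz R P Q \<psi> Quot
     toeplitz_ideal R P Q \<psi> (THE L. uniquely_maximal R P Q \<psi> L)"

definition cuntz_pimsner_grading ::
    "('r, 'k) ring_scheme \<Rightarrow> ('r, 'p, 'c) bimodule_scheme \<Rightarrow> ('r, 'q, 'd) bimodule_scheme
      \<Rightarrow> (('p \<times> 'q \<Rightarrow>\<^sub>0 int) set \<Rightarrow> 'r) \<Rightarrow> int \<Rightarrow> (('r, 'p, 'q) gen list \<Rightarrow>\<^sub>0 int) set set set"
  where "cuntz_pimsner_grading R P Q \<psi> n =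
     (\<lambda>t. toeplitz_ideal R P Q \<psi> (THE L. uniquely_maximal R P Q \<psi> L) +>\<^bsub>toeplitz R P Q \<psi>\<^esub> t)
       ` toeplitz_grading R P Q \<psi> n"


section \<open>The universal property of the Toeplitz ring\<close>

lemma gen_rng_ideal_ideal:
  assumes "rng A" "X \<subseteq> carrier A"
  shows "rng_ideal (gen_rng_ideal A X) A" and "X \<subseteq> gen_rng_ideal A X"
proof -
  interpret rng A by fact
  let ?C = "{K. rng_ideal K A \<and> X \<subseteq> K}"
  have carr: "carrier A \<in> ?C"
    using assms(2)
    by (auto intro!: rng_ideal.intro additive_subgroupI rng_ideal_axioms.intro
        simp: add.subgroup_self)
  have "additive_subgroup (\<Inter> ?C) A"
    by (rule additive_subgroupI, rule add.subgroups_Inter)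
       (use carr in \<open>auto simp: rng_ideal_def additive_subgroup_def\<close>)
  moreover have "rng_ideal_axioms (\<Inter> ?C) A"
    by (rule rng_ideal_axioms.intro) (auto simp: rng_ideal_def rng_ideal_axioms_def)
  ultimately show "rng_ideal (gen_rng_ideal A X) A"
    by (simp add: gen_rng_ideal_def rng_ideal_def)
  show "X \<subseteq> gen_rng_ideal A X"
    by (auto simp: gen_rng_ideal_def)
qed

lemma gen_rng_ideal_least: "rng_ideal K A \<Longrightarrow> X \<subseteq> K \<Longrightarrow> gen_rng_ideal A X \<subseteq> K"
  by (auto simp: gen_rng_ideal_def)

lemma rng_quotient:
  assumes "rng A" "rng_ideal K A"
  shows rng_Quot: "rng (A Quot K)"
    and coset_hom: "(+>\<^bsub>A\<^esub>) K \<in> rng_hom A (A Quot K)"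
proof -
  interpret rng A by fact
  interpret K: rng_ideal K A by fact
  interpret abelian_subgroup K A
    by (rule abelian_subgroupI3) (rule K.additive_subgroup_axioms, rule abelian_group_axioms)
  have mult: "rcoset_mult A K (K +>\<^bsub>A\<^esub> x) (K +>\<^bsub>A\<^esub> y) = K +>\<^bsub>A\<^esub> (x \<otimes>\<^bsub>A\<^esub> y)"
    if xy: "x \<in> carrier A" "y \<in> carrier A" for x y
  proof -
    have indep: "K +>\<^bsub>A\<^esub> (x' \<otimes>\<^bsub>A\<^esub> y') = K +>\<^bsub>A\<^esub> (x \<otimes>\<^bsub>A\<^esub> y)"
      if xy': "x' \<in> K +>\<^bsub>A\<^esub> x" "y' \<in> K +>\<^bsub>A\<^esub> y" for x' y'
    proof -
      obtain h k where h: "h \<in> K" "x' = h \<oplus>\<^bsub>A\<^esub> x" and k: "k \<in> K" "y' = k \<oplus>\<^bsub>A\<^esub> y"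
        using xy' unfolding a_r_coset_def' by blast
      have carr: "h \<in> carrier A" "k \<in> carrier A" using h k by auto
      have "x' \<otimes>\<^bsub>A\<^esub> y' = (h \<otimes>\<^bsub>A\<^esub> (k \<oplus>\<^bsub>A\<^esub> y) \<oplus>\<^bsub>A\<^esub> x \<otimes>\<^bsub>A\<^esub> k) \<oplus>\<^bsub>A\<^esub> x \<otimes>\<^bsub>A\<^esub> y"
        using h(2) k(2) carr xy by (simp add: l_distr r_distr a_ac)
      moreover have "h \<otimes>\<^bsub>A\<^esub> (k \<oplus>\<^bsub>A\<^esub> y) \<oplus>\<^bsub>A\<^esub> x \<otimes>\<^bsub>A\<^esub> k \<in> K"
        using h k carr xy by (intro K.a_closed K.r_ideal K.l_ideal) auto
      ultimately have "x' \<otimes>\<^bsub>A\<^esub> y' \<in> K +>\<^bsub>A\<^esub> (x \<otimes>\<^bsub>A\<^esub> y)"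
        unfolding a_r_coset_def' by blast
      then show ?thesis
        using a_repr_independence[OF _ m_closed[OF xy] K.a_subgroup] by simp
    qed
    have "rcoset_mult A K (K +>\<^bsub>A\<^esub> x) (K +>\<^bsub>A\<^esub> y)
        = (\<Union>a\<in>K +>\<^bsub>A\<^esub> x. \<Union>b\<in>K +>\<^bsub>A\<^esub> y. K +>\<^bsub>A\<^esub> (x \<otimes>\<^bsub>A\<^esub> y))"
      unfolding rcoset_mult_def by (intro SUP_cong refl indep)
    also have "\<dots> = K +>\<^bsub>A\<^esub> (x \<otimes>\<^bsub>A\<^esub> y)"
      using a_rcos_self[OF xy(1)] a_rcos_self[OF xy(2)] by (simp only: UN_constant) auto
    finally show ?thesis .
  qed
  have "abelian_group (A Quot K)"
    by (rule comm_group_abelian_groupI)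
       (simp add: FactRing_def a_factorgroup_is_comm_group[unfolded A_FactGroup_def'])
  moreover have "rng_axioms (A Quot K)"
    by (rule rng_axioms.intro)
       (auto simp: FactRing_simps mult a_rcos_sum m_assoc l_distr r_distr)
  ultimately show "rng (A Quot K)" by (rule rng.intro)
  show "(+>\<^bsub>A\<^esub>) K \<in> rng_hom A (A Quot K)"
    by (auto simp: rng_hom_def hom_def FactRing_simps mult a_rcos_sum)
qed

lemma word_mult_diff_left: "word_mult (x - y) z = word_mult x z - word_mult y z"
  by (simp add: word_mult_def frag_extend_diff)

lemma word_mult_diff_right: "word_mult x (y - z) = word_mult x y - word_mult x z"
proof -
  have "Poly_Mapping.keys x \<subseteq> UNIV" by simp
  then show ?thesis
    by (induction x rule: frag_induction)
      (simp_all add: word_mult_def frag_extend_diff)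
qed

lemma word_mult_of [simp]: "word_mult (frag_of u) (frag_of v) = frag_of (u @ v)"
  by (simp add: word_mult_def)

lemma word_mult_0 [simp]: "word_mult 0 x = 0" "word_mult x 0 = 0"
  using word_mult_diff_left[of x x] word_mult_diff_left[of 0 0 x] word_mult_diff_right[of x 0 0] by auto

lemma word_mult_add_left: "word_mult (x + y) z = word_mult x z + word_mult y z"
  using word_mult_diff_left[of x "0 - y" z] word_mult_diff_left[of 0 y z] by simp

lemma word_mult_add_right: "word_mult x (y + z) = word_mult x y + word_mult x z"
  using word_mult_diff_right[of x y "0 - z"] word_mult_diff_right[of x 0 z] by simp

lemma word_mult_assoc: "word_mult (word_mult x y) z = word_mult x (word_mult y z)"
proof -
  have U: "Poly_Mapping.keys w \<subseteq> UNIV" for w :: "'a list \<Rightarrow>\<^sub>0 int" by simp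
  have 1: "word_mult (word_mult (frag_of u) (frag_of v)) z = word_mult (frag_of u) (word_mult (frag_of v) z)" for u v
    using U[of z] by (induction z rule: frag_induction) (simp_all add: word_mult_diff_right)
  have 2: "word_mult (word_mult (frag_of u) y) z = word_mult (frag_of u) (word_mult y z)" for u
    using U[of y] by (induction y rule: frag_induction)
      (simp_all add: word_mult_diff_right word_mult_diff_left 1 del: word_mult_of)
  show ?thesis
    using U[of x] by (induction x rule: frag_induction) (simp_all add: word_mult_diff_left 2)
qed

lemma keys_word_mult:
  "Poly_Mapping.keys (word_mult x y)
     \<subseteq> (\<lambda>(u, v). u @ v) ` (Poly_Mapping.keys x \<times> Poly_Mapping.keys y)"
proof
  fix w assume "w \<in> Poly_Mapping.keys (word_mult x y)"
  then obtain u where u: "u \<in> Poly_Mapping.keys x"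
    "w \<in> Poly_Mapping.keys (frag_extend (\<lambda>v. frag_of (u @ v)) y)"
    unfolding word_mult_def using keys_frag_extend by fast
  then obtain v where "v \<in> Poly_Mapping.keys y" "w \<in> Poly_Mapping.keys (frag_of (u @ v))"
    using keys_frag_extend[of "\<lambda>v. frag_of (u @ v)" y] by blast
  with u show "w \<in> (\<lambda>(u, v). u @ v) ` (Poly_Mapping.keys x \<times> Poly_Mapping.keys y)"
    by force
qed

lemma add_monoid_free_rng: "carrier (free_rng X) = carrier (free_Abelian_group (lists X - {[]}))"
  by (simp add: free_rng_def free_Abelian_group_def)

lemma rng_free_rng: "rng (free_rng X)"
proof -
  have "abelian_group (free_rng X)"
  proof (rule abelian_groupI)
    fix x assume "x \<in> carrier (free_rng X)"
    then show "\<exists>y\<in>carrier (free_rng X). y \<oplus>\<^bsub>free_rng X\<^esub> x = \<zero>\<^bsub>free_rng X\<^esub>"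
      by (intro bexI[of _ "-x"]) (auto simp: free_rng_def)
  qed (use keys_add in \<open>force simp: free_rng_def\<close>)+
  moreover have "rng_axioms (free_rng X)"
  proof (rule rng_axioms.intro)
    fix x y assume "x \<in> carrier (free_rng X)" "y \<in> carrier (free_rng X)"
    then show "x \<otimes>\<^bsub>free_rng X\<^esub> y \<in> carrier (free_rng X)"
      using keys_word_mult[of x y] by (fastforce simp: free_rng_def)
  qed (simp_all add: free_rng_def word_mult_add_left word_mult_add_right word_mult_assoc)
  ultimately show ?thesis by (rule rng.intro)
qed

lemma hom_zero_minus:
  assumes "abelian_group A" "abelian_group B" "h \<in> hom (add_monoid A) (add_monoid B)"
  shows "h \<zero>\<^bsub>A\<^esub> = \<zero>\<^bsub>B\<^esub>"
    and "x \<in> carrier A \<Longrightarrow> h (\<ominus>\<^bsub>A\<^esub> x) = \<ominus>\<^bsub>B\<^esub> h x"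
    and "x \<in> carrier A \<Longrightarrow> h x \<in> carrier B"
    and "x \<in> carrier A \<Longrightarrow> y \<in> carrier A \<Longrightarrow> h (x \<oplus>\<^bsub>A\<^esub> y) = h x \<oplus>\<^bsub>B\<^esub> h y"
proof -
  interpret abelian_group_hom A B h
    using assms
    by (intro abelian_group_hom.intro abelian_group_hom_axioms.intro group_hom.intro
        group_hom_axioms.intro abelian_group.a_group)
  show "h \<zero>\<^bsub>A\<^esub> = \<zero>\<^bsub>B\<^esub>"
    and "x \<in> carrier A \<Longrightarrow> h (\<ominus>\<^bsub>A\<^esub> x) = \<ominus>\<^bsub>B\<^esub> h x"
    and "x \<in> carrier A \<Longrightarrow> h x \<in> carrier B"
    and "x \<in> carrier A \<Longrightarrow> y \<in> carrier A \<Longrightarrow> h (x \<oplus>\<^bsub>A\<^esub> y) = h x \<oplus>\<^bsub>B\<^esub> h y" by auto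
qed

lemma minus_free_rng:
  assumes "x \<in> carrier (free_rng X)" shows "\<ominus>\<^bsub>free_rng X\<^esub> x = - x"
proof -
  interpret rng "free_rng X" by (rule rng_free_rng)
  show ?thesis
    by (rule minus_equality) (use assms in \<open>auto simp: free_rng_def\<close>)
qed

lemma free_rng_ops:
  "x \<oplus>\<^bsub>free_rng X\<^esub> y = x + y" "x \<otimes>\<^bsub>free_rng X\<^esub> y = word_mult x y" "\<zero>\<^bsub>free_rng X\<^esub> = 0"
  by (simp_all add: free_rng_def)

lemma free_rng_hom_diff:
  assumes "rng B" "h \<in> hom (add_monoid (free_rng X)) (add_monoid B)"
    "x \<in> carrier (free_rng X)" "y \<in> carrier (free_rng X)"
  shows "h (x - y) = h x \<ominus>\<^bsub>B\<^esub> h y" "x - y \<in> carrier (free_rng X)"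
proof -
  interpret F: rng "free_rng X" by (rule rng_free_rng)
  interpret B: rng B by fact
  note H = hom_zero_minus[OF F.abelian_group_axioms B.abelian_group_axioms assms(2)]
  have "x - y = x \<oplus>\<^bsub>free_rng X\<^esub> (\<ominus>\<^bsub>free_rng X\<^esub> y)"
    using assms by (simp add: minus_free_rng free_rng_ops)
  then show "h (x - y) = h x \<ominus>\<^bsub>B\<^esub> h y" "x - y \<in> carrier (free_rng X)"
    using H assms by (simp_all add: B.minus_eq)
qed

lemma free_rng_induct [consumes 1, case_names zero gen mult diff]:
  assumes "x \<in> carrier (free_rng X)"
    and zero: "P 0"
    and gen: "\<And>g. g \<in> X \<Longrightarrow> P (frag_of [g])"
    and mult: "\<And>x y. \<lbrakk>x \<in> carrier (free_rng X); y \<in> carrier (free_rng X); P x; P y\<rbrakk> \<Longrightarrow> P (word_mult x y)"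
    and diff: "\<And>x y. \<lbrakk>x \<in> carrier (free_rng X); y \<in> carrier (free_rng X); P x; P y\<rbrakk> \<Longrightarrow> P (x - y)"
  shows "P x"
proof -
  have word: "P (frag_of w)" if "w \<in> lists X - {[]}" for w
    using that
  proof (induction w)
    case (Cons g w)
    show ?case
    proof (cases "w = []")
      case False
      have "P (word_mult (frag_of [g]) (frag_of w))"
        using Cons False by (intro mult gen) (auto simp: free_rng_def)
      then show ?thesis by simp
    qed (use Cons gen in auto)
  qed simp
  show ?thesis
    by (rule free_Abelian_group_induct[of x "lists X - {[]}"])
      (use assms(1) word diff zero in \<open>auto simp: free_rng_def\<close>)
qed

lemma free_rng_word_induct [consumes 1, case_names zero word diff]:
  assumes "x \<in> carrier (free_rng X)"
    and zero: "P 0"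
    and word: "\<And>w. w \<in> lists X - {[]} \<Longrightarrow> P (frag_of w)"
    and diff: "\<And>x y. \<lbrakk>x \<in> carrier (free_rng X); y \<in> carrier (free_rng X); P x; P y\<rbrakk> \<Longrightarrow> P (x - y)"
  shows "P x"
  by (rule free_Abelian_group_induct[of x "lists X - {[]}"])
    (use assms(1) word diff zero in \<open>auto simp: free_rng_def\<close>)

lemma rng_mult_zero:
  assumes "rng B" "x \<in> carrier B"
  shows "\<zero>\<^bsub>B\<^esub> \<otimes>\<^bsub>B\<^esub> x = \<zero>\<^bsub>B\<^esub>" "x \<otimes>\<^bsub>B\<^esub> \<zero>\<^bsub>B\<^esub> = \<zero>\<^bsub>B\<^esub>"
proof -
  interpret rng B by fact
  have "\<zero>\<^bsub>B\<^esub> \<otimes>\<^bsub>B\<^esub> x \<oplus>\<^bsub>B\<^esub> \<zero>\<^bsub>B\<^esub> \<otimes>\<^bsub>B\<^esub> x = \<zero>\<^bsub>B\<^esub> \<otimes>\<^bsub>B\<^esub> x \<oplus>\<^bsub>B\<^esub> \<zero>\<^bsub>B\<^esub>"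
    using l_distr[of "\<zero>\<^bsub>B\<^esub>" "\<zero>\<^bsub>B\<^esub>" x] assms by simp
  then show "\<zero>\<^bsub>B\<^esub> \<otimes>\<^bsub>B\<^esub> x = \<zero>\<^bsub>B\<^esub>" using assms by (simp add: assms)
  have "x \<otimes>\<^bsub>B\<^esub> \<zero>\<^bsub>B\<^esub> \<oplus>\<^bsub>B\<^esub> x \<otimes>\<^bsub>B\<^esub> \<zero>\<^bsub>B\<^esub> = x \<otimes>\<^bsub>B\<^esub> \<zero>\<^bsub>B\<^esub> \<oplus>\<^bsub>B\<^esub> \<zero>\<^bsub>B\<^esub>"
    using r_distr[of "\<zero>\<^bsub>B\<^esub>" "\<zero>\<^bsub>B\<^esub>" x] assms by simp
  then show "x \<otimes>\<^bsub>B\<^esub> \<zero>\<^bsub>B\<^esub> = \<zero>\<^bsub>B\<^esub>" using assms by (simp add: assms)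
qed

lemma rng_minus_distr:
  assumes "rng B" "a \<in> carrier B" "b \<in> carrier B" "c \<in> carrier B"
  shows "(a \<ominus>\<^bsub>B\<^esub> b) \<otimes>\<^bsub>B\<^esub> c = a \<otimes>\<^bsub>B\<^esub> c \<ominus>\<^bsub>B\<^esub> b \<otimes>\<^bsub>B\<^esub> c"
    and "c \<otimes>\<^bsub>B\<^esub> (a \<ominus>\<^bsub>B\<^esub> b) = c \<otimes>\<^bsub>B\<^esub> a \<ominus>\<^bsub>B\<^esub> c \<otimes>\<^bsub>B\<^esub> b"
proof -
  interpret rng B by fact
  have "(\<ominus>\<^bsub>B\<^esub> b) \<otimes>\<^bsub>B\<^esub> c \<oplus>\<^bsub>B\<^esub> b \<otimes>\<^bsub>B\<^esub> c = \<zero>\<^bsub>B\<^esub>"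
    using assms rng_mult_zero by (simp add: l_neg flip: l_distr)
  then have 1: "\<ominus>\<^bsub>B\<^esub> (b \<otimes>\<^bsub>B\<^esub> c) = (\<ominus>\<^bsub>B\<^esub> b) \<otimes>\<^bsub>B\<^esub> c"
    using assms by (intro minus_equality) auto
  have "c \<otimes>\<^bsub>B\<^esub> (\<ominus>\<^bsub>B\<^esub> b) \<oplus>\<^bsub>B\<^esub> c \<otimes>\<^bsub>B\<^esub> b = \<zero>\<^bsub>B\<^esub>"
    using assms rng_mult_zero by (simp add: l_neg flip: r_distr)
  then have 2: "\<ominus>\<^bsub>B\<^esub> (c \<otimes>\<^bsub>B\<^esub> b) = c \<otimes>\<^bsub>B\<^esub> (\<ominus>\<^bsub>B\<^esub> b)"
    using assms by (intro minus_equality) auto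
  show "(a \<ominus>\<^bsub>B\<^esub> b) \<otimes>\<^bsub>B\<^esub> c = a \<otimes>\<^bsub>B\<^esub> c \<ominus>\<^bsub>B\<^esub> b \<otimes>\<^bsub>B\<^esub> c"
    using assms by (simp add: minus_eq l_distr 1)
  show "c \<otimes>\<^bsub>B\<^esub> (a \<ominus>\<^bsub>B\<^esub> b) = c \<otimes>\<^bsub>B\<^esub> a \<ominus>\<^bsub>B\<^esub> c \<otimes>\<^bsub>B\<^esub> b"
    using assms by (simp add: minus_eq r_distr 2)
qed

fun word_eval :: "('a, 'm) ring_scheme \<Rightarrow> ('x \<Rightarrow> 'a) \<Rightarrow> 'x list \<Rightarrow> 'a"
  where "word_eval B g [] = \<zero>\<^bsub>B\<^esub>"
  | "word_eval B g [x] = g x"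
  | "word_eval B g (x # y # w) = g x \<otimes>\<^bsub>B\<^esub> word_eval B g (y # w)"

lemma free_rng_lift:
  assumes "rng B" and g: "\<And>x. x \<in> X \<Longrightarrow> g x \<in> carrier B"
  obtains h where "h \<in> rng_hom (free_rng X) B" and "\<And>x. x \<in> X \<Longrightarrow> h (frag_of [x]) = g x"
proof -
  interpret B: rng B by fact
  interpret F: rng "free_rng X" by (rule rng_free_rng)
  let ?W = "lists X - {[]}"
  have ev: "word_eval B g w \<in> carrier B" if "set w \<subseteq> X" for w
    using that
  proof (induction w)
    case (Cons x w)
    then show ?case by (cases w) (auto intro: g)
  qed simp
  have app: "word_eval B g (u @ v) = word_eval B g u \<otimes>\<^bsub>B\<^esub> word_eval B g v"
    if "set u \<subseteq> X" "set v \<subseteq> X" "u \<noteq> []" "v \<noteq> []" for u v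
    using that
  proof (induction u)
    case (Cons a u)
    show ?case
    proof (cases u)
      case Nil
      then show ?thesis using Cons by (cases v) auto
    next
      case (Cons b u')
      then have "word_eval B g (u @ v) = word_eval B g u \<otimes>\<^bsub>B\<^esub> word_eval B g v"
        using Cons.IH Cons.prems by auto
      then show ?thesis
        using Cons Cons.prems ev g by (auto simp: B.m_assoc)
    qed
  qed simp
  have img: "word_eval B g ` ?W \<subseteq> carrier (add_monoid B)" using ev by fastforce
  obtain h where h: "h \<in> hom (free_Abelian_group ?W) (add_monoid B)"
    and hw: "\<And>w. w \<in> ?W \<Longrightarrow> h (frag_of w) = word_eval B g w"
    by (rule comm_group.free_Abelian_group_universal[OF B.a_comm_group img]) blast
  have ha: "h \<in> hom (add_monoid (free_rng X)) (add_monoid B)"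
    using h by (auto simp: hom_def free_rng_def)
  note H = hom_zero_minus[OF F.abelian_group_axioms B.abelian_group_axioms ha]
  note D = free_rng_hom_diff[OF assms(1) ha]
  have closed: "word_mult x y \<in> carrier (free_rng X)"
    if "x \<in> carrier (free_rng X)" "y \<in> carrier (free_rng X)" for x y
    using F.m_closed[OF that] by (simp add: free_rng_ops)
  have word_carr: "frag_of w \<in> carrier (free_rng X)" if "w \<in> ?W" for w
    using that by (auto simp: free_rng_def)
  have minus_l: "(a \<ominus>\<^bsub>B\<^esub> b) \<otimes>\<^bsub>B\<^esub> c = a \<otimes>\<^bsub>B\<^esub> c \<ominus>\<^bsub>B\<^esub> b \<otimes>\<^bsub>B\<^esub> c"
    and minus_r: "c \<otimes>\<^bsub>B\<^esub> (a \<ominus>\<^bsub>B\<^esub> b) = c \<otimes>\<^bsub>B\<^esub> a \<ominus>\<^bsub>B\<^esub> c \<otimes>\<^bsub>B\<^esub> b"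
    if "a \<in> carrier B" "b \<in> carrier B" "c \<in> carrier B" for a b c
    using rng_minus_distr[OF assms(1)] that by auto
  have 1: "h (word_mult (frag_of u) y) = h (frag_of u) \<otimes>\<^bsub>B\<^esub> h y"
    if "y \<in> carrier (free_rng X)" and u: "u \<in> ?W" for u y
    using that(1)
  proof (induction y rule: free_rng_word_induct)
    case zero
    then show ?case
      using H(1) H(3)[OF word_carr[OF u]] rng_mult_zero[OF assms(1)] by (simp add: free_rng_ops)
  next
    case (word w)
    moreover have "u @ w \<in> ?W" using u word by auto
    ultimately show ?case using u hw app by (auto simp: in_lists_conv_set subset_iff)
  next
    case (diff x y)
    then show ?case
      using H(3) word_carr[OF u] closed D by (simp add: word_mult_diff_right minus_r)
  qed
  have 2: "h (word_mult x y) = h x \<otimes>\<^bsub>B\<^esub> h y"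
    if "x \<in> carrier (free_rng X)" and y: "y \<in> carrier (free_rng X)" for x y
    using that(1)
  proof (induction x rule: free_rng_word_induct)
    case zero
    then show ?case
      using H(1) H(3)[OF y] rng_mult_zero[OF assms(1)] by (simp add: free_rng_ops)
  next
    case (diff x x')
    then show ?case
      using H(3) y closed D by (simp add: word_mult_diff_left minus_l)
  qed (use 1 y in auto)
  show ?thesis
  proof
    show "h \<in> rng_hom (free_rng X) B"
      using ha 2 by (simp add: rng_hom_def free_rng_ops)
  qed (use hw in auto)
qed


lemma (in R_system) psi_closed:
  assumes "p \<in> carrier P" "q \<in> carrier Q"
  shows "\<psi> (tens R P Q p q) \<in> carrier R"
proof -
  have "tens R P Q p q \<in> carrier (tensor R P Q)"
    using assms by (force simp: tens_def tensor_def tensor_coset_def Let_def FactGroup_def RCOSETS_def)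
  then show ?thesis
    using psi_hom by (auto simp: bimodule_hom_def hom_def ring_bimodule_def)
qed

lemma rng_hom_kernel_ideal:
  assumes "rng A" "rng B" "h \<in> rng_hom A B"
  shows "rng_ideal (a_kernel A B h) A"
proof -
  have ab: "abelian_group A" "abelian_group B" using assms by (simp_all add: rng_def)
  have "abelian_group_hom A B h"
    using ab assms(3)
    by (intro abelian_group_hom.intro abelian_group_hom_axioms.intro group_hom.intro
        group_hom_axioms.intro abelian_group.a_group) (simp_all add: rng_hom_def)
  then have sub: "additive_subgroup (a_kernel A B h) A"
    by (rule abelian_group_hom.additive_subgroup_a_kernel)
  have hc: "h x \<in> carrier B" if "x \<in> carrier A" for x
    using hom_zero_minus(3)[OF ab _ that] assms(3) by (simp add: rng_hom_def)
  have "rng_ideal_axioms (a_kernel A B h) A"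
  proof (rule rng_ideal_axioms.intro)
    fix x r assume "x \<in> a_kernel A B h" and r: "r \<in> carrier A"
    then have x: "x \<in> carrier A" "h x = \<zero>\<^bsub>B\<^esub>" by (simp_all add: a_kernel_def')
    have "h (r \<otimes>\<^bsub>A\<^esub> x) = h r \<otimes>\<^bsub>B\<^esub> h x" "h (x \<otimes>\<^bsub>A\<^esub> r) = h x \<otimes>\<^bsub>B\<^esub> h r"
      using assms(3) r x(1) by (simp_all add: rng_hom_def)
    then show "r \<otimes>\<^bsub>A\<^esub> x \<in> a_kernel A B h" "x \<otimes>\<^bsub>A\<^esub> r \<in> a_kernel A B h"
      using r x hc rng_mult_zero[OF assms(2)] rng.m_closed[OF assms(1)]
      by (simp_all add: a_kernel_def')
  qed
  with sub show ?thesis by (rule rng_ideal.intro)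
qed

context R_system
begin

abbreviation "free_gens \<equiv> free_rng (toeplitz_gens R P Q)"
abbreviation "rel_ideal \<equiv> gen_rng_ideal free_gens (toeplitz_rels R P Q \<psi>)"
abbreviation "toep \<equiv> toeplitz R P Q \<psi>"

lemma gens_carrier:
  "r \<in> carrier R \<Longrightarrow> GR r \<in> toeplitz_gens R P Q"
  "p \<in> carrier P \<Longrightarrow> GP p \<in> toeplitz_gens R P Q"
  "q \<in> carrier Q \<Longrightarrow> GQ q \<in> toeplitz_gens R P Q"
  by (auto simp: toeplitz_gens_def)

lemma word_in_F: "frag_of w \<in> carrier free_gens \<longleftrightarrow> set w \<subseteq> toeplitz_gens R P Q \<and> w \<noteq> []"
  by (auto simp: free_rng_def)

lemma diff_in_F: "x \<in> carrier free_gens \<Longrightarrow> y \<in> carrier free_gens \<Longrightarrow> x - y \<in> carrier free_gens"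
  using keys_diff[of x y] by (auto simp: free_rng_def)

lemma rels_carrier: "toeplitz_rels R P Q \<psi> \<subseteq> carrier free_gens"
  unfolding toeplitz_rels_def
  by (auto intro!: diff_in_F simp: word_in_F gens_carrier psi_closed
      P.lact_closed P.ract_closed Q.lact_closed Q.ract_closed)

lemma rng_ideal_K: "rng_ideal rel_ideal free_gens"
  by (rule gen_rng_ideal_ideal[OF rng_free_rng rels_carrier])

lemma toeplitz_Quot: "toep = free_gens Quot rel_ideal"
  by (simp add: toeplitz_def Let_def)

lemma toeplitz_coset_eq: "toeplitz_coset R P Q \<psi> x = rel_ideal +>\<^bsub>free_gens\<^esub> x"
  by (simp add: toeplitz_coset_def Let_def)

lemma rng_toeplitz: "rng toep"
  unfolding toeplitz_Quot by (rule rng_quotient[OF rng_free_rng rng_ideal_K])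

lemma coset_hom: "toeplitz_coset R P Q \<psi> \<in> rng_hom free_gens toep"
  using rng_quotient(2)[OF rng_free_rng rng_ideal_K]
  by (simp add: toeplitz_Quot toeplitz_coset_eq[abs_def] eta_contract_eq)

lemma coset_eq:
  assumes "x \<in> carrier free_gens" "y \<in> carrier free_gens" "x - y \<in> rel_ideal"
  shows "toeplitz_coset R P Q \<psi> x = toeplitz_coset R P Q \<psi> y"
proof -
  interpret F: rng free_gens by (rule rng_free_rng)
  interpret K: rng_ideal rel_ideal free_gens by (rule rng_ideal_K)
  have "x = (x - y) \<oplus>\<^bsub>free_gens\<^esub> y" by (simp add: free_rng_ops)
  then have "x \<in> rel_ideal +>\<^bsub>free_gens\<^esub> y" using assms(3) unfolding a_r_coset_def' by blast
  then show ?thesis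
    using F.a_repr_independence[OF _ assms(2) K.a_subgroup] by (simp add: toeplitz_coset_eq)
qed

lemma coset_rel:
  "x - y \<in> toeplitz_rels R P Q \<psi> \<Longrightarrow> x \<in> carrier free_gens \<Longrightarrow> y \<in> carrier free_gens \<Longrightarrow>
    toeplitz_coset R P Q \<psi> x = toeplitz_coset R P Q \<psi> y"
  using coset_eq gen_rng_ideal_ideal(2)[OF rng_free_rng rels_carrier] by blast

lemma coset_add: "x \<in> carrier free_gens \<Longrightarrow> y \<in> carrier free_gens \<Longrightarrow>
   toeplitz_coset R P Q \<psi> (x + y) = toeplitz_coset R P Q \<psi> x \<oplus>\<^bsub>toep\<^esub> toeplitz_coset R P Q \<psi> y"
  using coset_hom by (auto simp: rng_hom_def hom_def free_rng_ops)

lemma coset_mult: "x \<in> carrier free_gens \<Longrightarrow> y \<in> carrier free_gens \<Longrightarrow>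
   toeplitz_coset R P Q \<psi> (word_mult x y) = toeplitz_coset R P Q \<psi> x \<otimes>\<^bsub>toep\<^esub> toeplitz_coset R P Q \<psi> y"
  using coset_hom by (auto simp: rng_hom_def hom_def free_rng_ops)

lemma coset_closed: "x \<in> carrier free_gens \<Longrightarrow> toeplitz_coset R P Q \<psi> x \<in> carrier toep"
  using coset_hom by (auto simp: rng_hom_def hom_def)

lemma carrier_toeplitz: "carrier toep = toeplitz_coset R P Q \<psi> ` carrier free_gens"
  by (auto simp: toeplitz_Quot toeplitz_coset_eq FactRing_def A_RCOSETS_def')

lemma add_in_F: "x \<in> carrier free_gens \<Longrightarrow> y \<in> carrier free_gens \<Longrightarrow> x + y \<in> carrier free_gens"
  using keys_add[of x y] by (auto simp: free_rng_def)

lemma iota_add: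
  assumes "frag_of [c] - frag_of [a] - frag_of [b] \<in> toeplitz_rels R P Q \<psi>"
    and "a \<in> toeplitz_gens R P Q" "b \<in> toeplitz_gens R P Q" "c \<in> toeplitz_gens R P Q"
  shows "toeplitz_coset R P Q \<psi> (frag_of [c])
     = toeplitz_coset R P Q \<psi> (frag_of [a]) \<oplus>\<^bsub>toep\<^esub> toeplitz_coset R P Q \<psi> (frag_of [b])"
proof -
  have "toeplitz_coset R P Q \<psi> (frag_of [c]) = toeplitz_coset R P Q \<psi> (frag_of [a] + frag_of [b])"
    by (rule coset_rel) (use assms in \<open>simp_all add: add_in_F word_in_F diff_diff_eq\<close>)
  with assms show ?thesis by (simp add: coset_add word_in_F)
qed

lemma iota_mult:
  assumes "frag_of [c] - frag_of [a, b] \<in> toeplitz_rels R P Q \<psi>"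
    and "a \<in> toeplitz_gens R P Q" "b \<in> toeplitz_gens R P Q" "c \<in> toeplitz_gens R P Q"
  shows "toeplitz_coset R P Q \<psi> (frag_of [c])
     = toeplitz_coset R P Q \<psi> (frag_of [a]) \<otimes>\<^bsub>toep\<^esub> toeplitz_coset R P Q \<psi> (frag_of [b])"
proof -
  have "toeplitz_coset R P Q \<psi> (frag_of [c]) = toeplitz_coset R P Q \<psi> (word_mult (frag_of [a]) (frag_of [b]))"
    by (rule coset_rel) (use assms in \<open>simp_all add: word_in_F\<close>)
  with assms show ?thesis by (simp add: coset_mult word_in_F del: word_mult_of)
qed

theorem toeplitz_covariant:
  "covariant_rep R P Q \<psi> (iota_P R P Q \<psi>) (iota_Q R P Q \<psi>) (iota_R R P Q \<psi>) toep"
proof -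
  have "covariant_rep_axioms R P Q \<psi> (iota_P R P Q \<psi>) (iota_Q R P Q \<psi>) (iota_R R P Q \<psi>) toep"
  proof (rule covariant_rep_axioms.intro)
    show "iota_P R P Q \<psi> \<in> hom (add_monoid P) (add_monoid toep)"
    proof (rule homI)
      fix p p' assume "p \<in> carrier (add_monoid P)" "p' \<in> carrier (add_monoid P)"
      then show "iota_P R P Q \<psi> (p \<otimes>\<^bsub>add_monoid P\<^esub> p') = iota_P R P Q \<psi> p \<otimes>\<^bsub>add_monoid toep\<^esub> iota_P R P Q \<psi> p'"
        unfolding iota_P_def monoid.simps
        by (intro iota_add) (simp_all add: gens_carrier, unfold toeplitz_rels_def, blast)
    qed (simp add: iota_P_def coset_closed word_in_F gens_carrier)
    show "iota_Q R P Q \<psi> \<in> hom (add_monoid Q) (add_monoid toep)"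
    proof (rule homI)
      fix p p' assume "p \<in> carrier (add_monoid Q)" "p' \<in> carrier (add_monoid Q)"
      then show "iota_Q R P Q \<psi> (p \<otimes>\<^bsub>add_monoid Q\<^esub> p') = iota_Q R P Q \<psi> p \<otimes>\<^bsub>add_monoid toep\<^esub> iota_Q R P Q \<psi> p'"
        unfolding iota_Q_def monoid.simps
        by (intro iota_add) (simp_all add: gens_carrier, unfold toeplitz_rels_def, blast)
    qed (simp add: iota_Q_def coset_closed word_in_F gens_carrier)
    have "iota_R R P Q \<psi> \<in> hom (add_monoid R) (add_monoid toep)"
    proof (rule homI)
      fix p p' assume "p \<in> carrier (add_monoid R)" "p' \<in> carrier (add_monoid R)"
      then show "iota_R R P Q \<psi> (p \<otimes>\<^bsub>add_monoid R\<^esub> p') = iota_R R P Q \<psi> p \<otimes>\<^bsub>add_monoid toep\<^esub> iota_R R P Q \<psi> p'"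
        unfolding iota_R_def monoid.simps
        by (intro iota_add) (simp_all add: gens_carrier, unfold toeplitz_rels_def, blast)
    qed (simp add: iota_R_def coset_closed word_in_F gens_carrier)
    moreover have "iota_R R P Q \<psi> (r \<otimes>\<^bsub>R\<^esub> s) = iota_R R P Q \<psi> r \<otimes>\<^bsub>toep\<^esub> iota_R R P Q \<psi> s"
      if "r \<in> carrier R" "s \<in> carrier R" for r s
      unfolding iota_R_def using that
      by (intro iota_mult) (simp_all add: gens_carrier, unfold toeplitz_rels_def, blast)
    ultimately show "iota_R R P Q \<psi> \<in> rng_hom R toep" by (simp add: rng_hom_def)
    show "iota_P R P Q \<psi> (ract P p r) = iota_P R P Q \<psi> p \<otimes>\<^bsub>toep\<^esub> iota_R R P Q \<psi> r" if "r \<in> carrier R" "p \<in> carrier P" for r p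
      unfolding iota_P_def iota_Q_def iota_R_def using that
      by (intro iota_mult) (simp_all add: gens_carrier psi_closed P.lact_closed P.ract_closed
          Q.lact_closed Q.ract_closed, unfold toeplitz_rels_def, blast)
    show "iota_P R P Q \<psi> (lact P r p) = iota_R R P Q \<psi> r \<otimes>\<^bsub>toep\<^esub> iota_P R P Q \<psi> p" if "r \<in> carrier R" "p \<in> carrier P" for r p
      unfolding iota_P_def iota_Q_def iota_R_def using that
      by (intro iota_mult) (simp_all add: gens_carrier psi_closed P.lact_closed P.ract_closed
          Q.lact_closed Q.ract_closed, unfold toeplitz_rels_def, blast)
    show "iota_Q R P Q \<psi> (ract Q q r) = iota_Q R P Q \<psi> q \<otimes>\<^bsub>toep\<^esub> iota_R R P Q \<psi> r" if "r \<in> carrier R" "q \<in> carrier Q" for r q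
      unfolding iota_P_def iota_Q_def iota_R_def using that
      by (intro iota_mult) (simp_all add: gens_carrier psi_closed P.lact_closed P.ract_closed
          Q.lact_closed Q.ract_closed, unfold toeplitz_rels_def, blast)
    show "iota_Q R P Q \<psi> (lact Q r q) = iota_R R P Q \<psi> r \<otimes>\<^bsub>toep\<^esub> iota_Q R P Q \<psi> q" if "r \<in> carrier R" "q \<in> carrier Q" for r q
      unfolding iota_P_def iota_Q_def iota_R_def using that
      by (intro iota_mult) (simp_all add: gens_carrier psi_closed P.lact_closed P.ract_closed
          Q.lact_closed Q.ract_closed, unfold toeplitz_rels_def, blast)
    show "iota_R R P Q \<psi> (\<psi> (tens R P Q p q)) = iota_P R P Q \<psi> p \<otimes>\<^bsub>toep\<^esub> iota_Q R P Q \<psi> q" if "p \<in> carrier P" "q \<in> carrier Q" for p q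
      unfolding iota_P_def iota_Q_def iota_R_def using that
      by (intro iota_mult) (simp_all add: gens_carrier psi_closed P.lact_closed P.ract_closed
          Q.lact_closed Q.ract_closed, unfold toeplitz_rels_def, blast)
  qed
  then show ?thesis
    by (intro covariant_rep.intro R_system_axioms rng_toeplitz)
qed

theorem toeplitz_universal:
  assumes "covariant_rep R P Q \<psi> S U \<sigma> B"
  obtains h where "h \<in> rng_hom toep B"
    and "\<And>r. r \<in> carrier R \<Longrightarrow> h (iota_R R P Q \<psi> r) = \<sigma> r"
    and "\<And>p. p \<in> carrier P \<Longrightarrow> h (iota_P R P Q \<psi> p) = S p"
    and "\<And>q. q \<in> carrier Q \<Longrightarrow> h (iota_Q R P Q \<psi> q) = U q"
proof -
  interpret B: covariant_rep R P Q \<psi> S U \<sigma> B by fact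
  have rB: "rng B" by (rule B.B.rng_axioms)
  interpret F: rng free_gens by (rule rng_free_rng)
  interpret K: rng_ideal rel_ideal free_gens by (rule rng_ideal_K)
  interpret KA: abelian_subgroup rel_ideal free_gens
    by (rule abelian_subgroupI3) (rule K.additive_subgroup_axioms, rule F.abelian_group_axioms)
  define g where "g = case_gen \<sigma> S U"
  have carr: "\<And>r. r \<in> carrier R \<Longrightarrow> \<sigma> r \<in> carrier B" "\<And>p. p \<in> carrier P \<Longrightarrow> S p \<in> carrier B"
    "\<And>q. q \<in> carrier Q \<Longrightarrow> U q \<in> carrier B"
    using B.S_add B.T_add B.sigma_hom by (auto simp: hom_def rng_hom_def)
  obtain h where h: "h \<in> rng_hom free_gens B" and hg: "\<And>x. x \<in> toeplitz_gens R P Q \<Longrightarrow> h (frag_of [x]) = g x"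
    by (rule free_rng_lift[OF rB, of "toeplitz_gens R P Q" g])
      (auto simp: toeplitz_gens_def g_def carr)
  have ha: "h \<in> hom (add_monoid free_gens) (add_monoid B)" using h by (simp add: rng_hom_def)
  note H = hom_zero_minus[OF F.abelian_group_axioms B.B.abelian_group_axioms ha]
  note D = free_rng_hom_diff(1)[OF rB ha]
  have gen: "frag_of [x] \<in> carrier free_gens" if "x \<in> toeplitz_gens R P Q" for x
    using that by (simp add: word_in_F)
  have hm: "h (frag_of [x, y]) = g x \<otimes>\<^bsub>B\<^esub> g y"
    if "x \<in> toeplitz_gens R P Q" "y \<in> toeplitz_gens R P Q" for x y
  proof -
    have "h (word_mult (frag_of [x]) (frag_of [y])) = h (frag_of [x]) \<otimes>\<^bsub>B\<^esub> h (frag_of [y])"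
      using h gen[OF that(1)] gen[OF that(2)] by (simp add: rng_hom_def free_rng_ops del: word_mult_of)
    then show ?thesis using hg that by simp
  qed
  have gc: "g x \<in> carrier B" if "x \<in> toeplitz_gens R P Q" for x
    using that by (auto simp: toeplitz_gens_def g_def carr)
  have rel_add: "frag_of [c] - frag_of [a] - frag_of [b] \<in> a_kernel free_gens B h"
    if "a \<in> toeplitz_gens R P Q" "b \<in> toeplitz_gens R P Q" "c \<in> toeplitz_gens R P Q" "g c = g a \<oplus>\<^bsub>B\<^esub> g b"
    for a b c
  proof -
    have "h (frag_of [c] - frag_of [a] - frag_of [b]) = (g a \<oplus>\<^bsub>B\<^esub> g b) \<ominus>\<^bsub>B\<^esub> g a \<ominus>\<^bsub>B\<^esub> g b"
      using that gen diff_in_F by (simp add: D hg)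
    also have "\<dots> = \<zero>\<^bsub>B\<^esub>"
    proof -
      have "x \<oplus>\<^bsub>B\<^esub> y \<ominus>\<^bsub>B\<^esub> x \<ominus>\<^bsub>B\<^esub> y = \<zero>\<^bsub>B\<^esub>" if xy: "x \<in> carrier B" "y \<in> carrier B" for x y
      proof -
        have "x \<oplus>\<^bsub>B\<^esub> y \<oplus>\<^bsub>B\<^esub> (\<ominus>\<^bsub>B\<^esub> x) = y"
          using xy by (metis B.B.a_comm B.B.a_inv_closed B.B.add.inv_solve_right B.B.add.m_closed)
        then show ?thesis using xy by (simp add: B.B.minus_eq B.B.r_neg)
      qed
      then show ?thesis using gc that by blast
    qed
    finally show ?thesis using that gen diff_in_F by (simp add: a_kernel_def')
  qed
  have rel_mult: "frag_of [c] - frag_of [a, b] \<in> a_kernel free_gens B h"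
    if "a \<in> toeplitz_gens R P Q" "b \<in> toeplitz_gens R P Q" "c \<in> toeplitz_gens R P Q" "g c = g a \<otimes>\<^bsub>B\<^esub> g b"
    for a b c
  proof -
    have "frag_of [a, b] \<in> carrier free_gens" using that by (simp add: word_in_F)
    then show ?thesis
      using that gen gc diff_in_F by (simp add: a_kernel_def' D hg hm B.B.minus_eq B.B.r_neg)
  qed
  have "toeplitz_rels R P Q \<psi> \<subseteq> a_kernel free_gens B h"
    unfolding toeplitz_rels_def
    using B.S_add B.T_add B.sigma_hom
    by (auto intro!: rel_add rel_mult simp: gens_carrier psi_closed P.lact_closed P.ract_closed
        Q.lact_closed Q.ract_closed g_def B.S_lact B.S_ract B.T_lact B.T_ract B.sigma_psi
        rng_hom_def hom_def)
  then have ker: "rel_ideal \<subseteq> a_kernel free_gens B h"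
    by (intro gen_rng_ideal_least rng_hom_kernel_ideal[OF rng_free_rng rB h])
  define f where "f X = (THE b. h ` X = {b})" for X
  have f: "f (toeplitz_coset R P Q \<psi> x) = h x" if x: "x \<in> carrier free_gens" for x
  proof -
    have const: "h ` Z = {c}" if "z \<in> Z" "\<And>y. y \<in> Z \<Longrightarrow> h y = c" for Z z c
      using that by auto
    have "h y = h x" if yK: "y \<in> rel_ideal +>\<^bsub>free_gens\<^esub> x" for y
    proof -
      obtain k where k: "k \<in> rel_ideal" "y = k \<oplus>\<^bsub>free_gens\<^esub> x" using yK unfolding a_r_coset_def' by blast
      then have "k \<in> carrier free_gens" "h k = \<zero>\<^bsub>B\<^esub>" using ker by (auto simp: a_kernel_def')
      then show ?thesis
        unfolding k(2) using H(4)[of k x] H(3)[OF x] x by simp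
    qed
    then have "h ` toeplitz_coset R P Q \<psi> x = {h x}"
      unfolding toeplitz_coset_eq by (rule const[OF KA.a_rcos_self[OF x]])
    then show ?thesis by (simp add: f_def)
  qed
  show ?thesis
  proof
    show "f \<in> rng_hom toep B"
      unfolding rng_hom_def
    proof (intro CollectI conjI ballI homI)
      fix X assume "X \<in> carrier (add_monoid toep)"
      then show "f X \<in> carrier (add_monoid B)" using H(3) by (auto simp: carrier_toeplitz f)
    next
      fix X Y assume "X \<in> carrier (add_monoid toep)" "Y \<in> carrier (add_monoid toep)"
      then obtain x y where xy: "x \<in> carrier free_gens" "y \<in> carrier free_gens"
        "X = toeplitz_coset R P Q \<psi> x" "Y = toeplitz_coset R P Q \<psi> y"
        by (auto simp: carrier_toeplitz)
      then show "f (X \<otimes>\<^bsub>add_monoid toep\<^esub> Y) = f X \<otimes>\<^bsub>add_monoid B\<^esub> f Y"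
        using H(4)[OF xy(1,2)] by (simp add: f add_in_F free_rng_ops flip: coset_add)
    next
      fix X Y assume "X \<in> carrier toep" "Y \<in> carrier toep"
      then obtain x y where xy: "x \<in> carrier free_gens" "y \<in> carrier free_gens"
        "X = toeplitz_coset R P Q \<psi> x" "Y = toeplitz_coset R P Q \<psi> y"
        by (auto simp: carrier_toeplitz)
      then show "f (X \<otimes>\<^bsub>toep\<^esub> Y) = f X \<otimes>\<^bsub>B\<^esub> f Y"
        using h F.m_closed[OF xy(1,2)] by (simp add: f rng_hom_def free_rng_ops flip: coset_mult)
    qed
  qed (unfold iota_R_def iota_P_def iota_Q_def, simp_all add: f gen gens_carrier hg, simp_all add: g_def)
qed

theorem toeplitz_hom_unique:
  assumes "rng B" "h \<in> rng_hom toep B" "k \<in> rng_hom toep B"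
    and R: "\<And>r. r \<in> carrier R \<Longrightarrow> h (iota_R R P Q \<psi> r) = k (iota_R R P Q \<psi> r)"
    and P: "\<And>p. p \<in> carrier P \<Longrightarrow> h (iota_P R P Q \<psi> p) = k (iota_P R P Q \<psi> p)"
    and Q: "\<And>q. q \<in> carrier Q \<Longrightarrow> h (iota_Q R P Q \<psi> q) = k (iota_Q R P Q \<psi> q)"
    and x: "x \<in> carrier toep"
  shows "h x = k x"
proof -
  let ?c = "toeplitz_coset R P Q \<psi>"
  interpret F: rng free_gens by (rule rng_free_rng)
  interpret T: rng toep by (rule rng_toeplitz)
  interpret B: rng B by fact
  have comp: "f \<circ> ?c \<in> rng_hom free_gens B" if "f \<in> rng_hom toep B" for f
    using that coset_hom F.m_closed F.add.m_closed by (auto simp: rng_hom_def hom_def free_rng_ops Pi_iff)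
  have D: "f (?c (x - y)) = f (?c x) \<ominus>\<^bsub>B\<^esub> f (?c y)"
    if "f \<in> rng_hom toep B" "x \<in> carrier free_gens" "y \<in> carrier free_gens" for f x y
    using free_rng_hom_diff(1)[OF assms(1), of "f \<circ> ?c" "toeplitz_gens R P Q"] comp[OF that(1)] that by (simp add: rng_hom_def)
  have M: "f (?c (word_mult x y)) = f (?c x) \<otimes>\<^bsub>B\<^esub> f (?c y)"
    if "f \<in> rng_hom toep B" "x \<in> carrier free_gens" "y \<in> carrier free_gens" for f x y
    using comp[OF that(1)] that by (simp add: rng_hom_def free_rng_ops)
  have Z: "f (?c 0) = \<zero>\<^bsub>B\<^esub>" if "f \<in> rng_hom toep B" for f
    using hom_zero_minus(1)[OF F.abelian_group_axioms B.abelian_group_axioms, of "f \<circ> ?c"] comp[OF that]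
    by (simp add: rng_hom_def free_rng_ops)
  have "h (?c y) = k (?c y)" if "y \<in> carrier free_gens" for y
    using that
  proof (induction y rule: free_rng_induct)
    case (gen g)
    then show ?case using R P Q by (auto simp: toeplitz_gens_def iota_R_def iota_P_def iota_Q_def)
  qed (simp_all add: assms D M Z)
  then show ?thesis using x by (auto simp: carrier_toeplitz)
qed

end

end

theory Submission
  imports Defs
begin

text \<open>Write \<open>T\<close> for the Toeplitz ring and \<open>h: T \<rightarrow> A\<close> for the homomorphism extending the inclusions of
  \<open>R\<close>, \<open>I\<close> and \<open>J\<close>; its image is the generated subring. Local units identify \<open>IJ\<close> with the finite
  rank operators on \<open>I\<close> and with the span \<open>\<iota>(I)\<iota>(J)\<close> inside \<open>T\<close>, and conditions (3) and (4) make
  \<open>R \<inter> IJ\<close> the uniquely maximal faithful compatible ideal. So \<open>T(R \<inter> IJ)\<close> is generated by the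
  differences of the two copies in \<open>T\<close> of an element of \<open>R \<inter> IJ\<close>, and it lies in \<open>ker h\<close>.

  For the converse, \<open>h\<close> is graded, so it suffices to treat a homogeneous \<open>t\<close> with \<open>h t = 0\<close>.
  In degree \<open>0\<close> write \<open>t\<close> as \<open>r\<close> plus normally ordered words \<open>x\<^sub>1 \<dots> x\<^sub>m y\<^sub>1 \<dots> y\<^sub>m\<close> of bounded length.
  Each \<open>y t x\<close> involves shorter words only, so it lies in the ideal by induction, hence so does
  \<open>a t b\<close> for \<open>a, b \<in> \<iota>(I)\<iota>(J)\<close>; for local units \<open>a, b\<close> of the words, \<open>t - a t b = r - a r b\<close>
  is one of the generators. In positive degree \<open>t = a t\<close> for some such \<open>a\<close>, and each \<open>y t\<close> has
  smaller degree; negative degrees are symmetric.\<close>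

section \<open>Rings without unit\<close>

text \<open>Differences subsume the other group operations: \<open>\<ominus> a\<close> is
  \<open>\<zero> \<ominus> a\<close>, and \<open>a \<oplus> b\<close> is
  \<open>a \<ominus> (\<ominus> b)\<close>. Later inductions over a generated subgroup thus have a
  single closure case, matching \<open>subgroup_minus_closed\<close>.\<close>

lemma (in abelian_group) add_generate_induct [consumes 2, case_names zero incl diff]:
  assumes "S \<subseteq> carrier G" and "x \<in> generate (add_monoid G) S"
    and zero: "P \<zero>" and incl: "\<And>s. s \<in> S \<Longrightarrow> P s"
    and diff: "\<And>a b. \<lbrakk>a \<in> carrier G; b \<in> carrier G; P a; P b\<rbrakk> \<Longrightarrow> P (a \<ominus> b)"
  shows "P x"
proof -
  have neg: "P (\<ominus> a)" if "a \<in> carrier G" "P a" for a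
    using diff[OF zero_closed that(1) zero that(2)] that by (simp add: minus_eq)
  have "x \<in> carrier G \<and> P x"
    using assms(2)
  proof (induction rule: generate.induct)
    case (inv s)
    then have "s \<in> carrier G" using assms(1) by blast
    then show ?case using inv neg[of s] incl by (simp flip: a_inv_def)
  next
    case (eng a b)
    then have "P (a \<ominus> (\<ominus> b))" using neg diff by simp
    then show ?case using eng by (simp add: minus_eq)
  qed (use assms(1) zero incl in auto)
  then show ?thesis ..
qed

lemma (in abelian_group) additive_subgroup_generate:
  "S \<subseteq> carrier G \<Longrightarrow> additive_subgroup (generate (add_monoid G) S) G"
  using add.generate_is_subgroup by (simp add: additive_subgroup_def)

lemma (in abelian_group) subgroup_minus_closed:
  assumes "additive_subgroup H G" "x \<in> H" "y \<in> H"
  shows "x \<ominus> y \<in> H"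
proof -
  interpret additive_subgroup H G by fact
  have "\<ominus> y \<in> H" using assms(3) subgroup.m_inv_closed[OF a_subgroup] by (simp add: a_inv_def)
  then show ?thesis using assms by (simp add: minus_eq)
qed

lemma (in abelian_group) minus_zero_iff [simp]:
  assumes "x \<in> carrier G" "y \<in> carrier G"
  shows "x \<ominus> y = \<zero> \<longleftrightarrow> x = y"
proof
  assume "x \<ominus> y = \<zero>"
  then have "(x \<ominus> y) \<oplus> y = y" using assms by simp
  then show "x = y" using assms by (simp add: minus_eq a_assoc l_neg)
qed (use assms in \<open>simp add: minus_eq r_neg\<close>)

context rng
begin

lemma products_in_carrier:
  "X \<subseteq> carrier R \<Longrightarrow> Y \<subseteq> carrier R \<Longrightarrow> {x \<otimes> y |x y. x \<in> X \<and> y \<in> Y} \<subseteq> carrier R"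
  by auto

lemma subgroup_prod_additive:
  "X \<subseteq> carrier R \<Longrightarrow> Y \<subseteq> carrier R \<Longrightarrow> additive_subgroup (subgroup_prod R X Y) R"
  unfolding subgroup_prod_def by (intro additive_subgroup_generate products_in_carrier)

lemma subgroup_prod_incl: "x \<in> X \<Longrightarrow> y \<in> Y \<Longrightarrow> x \<otimes> y \<in> subgroup_prod R X Y"
  unfolding subgroup_prod_def by (rule generate.incl) blast

lemma subgroup_prod_induct [consumes 3, case_names zero prod diff]:
  assumes "X \<subseteq> carrier R" "Y \<subseteq> carrier R" "u \<in> subgroup_prod R X Y"
    and "P \<zero>" "\<And>x y. \<lbrakk>x \<in> X; y \<in> Y\<rbrakk> \<Longrightarrow> P (x \<otimes> y)"
    and "\<And>a b. \<lbrakk>a \<in> carrier R; b \<in> carrier R; P a; P b\<rbrakk> \<Longrightarrow> P (a \<ominus> b)"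
  shows "P u"
  by (rule add_generate_induct[OF products_in_carrier[OF assms(1,2)] assms(3)[unfolded subgroup_prod_def]])
    (use assms in auto)

lemmas zero_mult [simp] = rng_mult_zero[OF rng_axioms]
lemmas minus_distr = rng_minus_distr[OF rng_axioms]

end

locale rng_homomorphism = rng A + B: rng B for A (structure) and B (structure) and h +
  assumes hom: "h \<in> rng_hom A B"
begin

lemma add_hom: "h \<in> hom (add_monoid A) (add_monoid B)"
  using hom by (simp add: rng_hom_def)

lemmas hom_zero = hom_zero_minus(1)[OF abelian_group_axioms B.abelian_group_axioms add_hom]
lemmas hom_neg = hom_zero_minus(2)[OF abelian_group_axioms B.abelian_group_axioms add_hom]
lemmas hom_closed = hom_zero_minus(3)[OF abelian_group_axioms B.abelian_group_axioms add_hom]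
lemmas hom_add = hom_zero_minus(4)[OF abelian_group_axioms B.abelian_group_axioms add_hom]

lemma hom_mult: "x \<in> carrier A \<Longrightarrow> y \<in> carrier A \<Longrightarrow> h (x \<otimes> y) = h x \<otimes>\<^bsub>B\<^esub> h y"
  using hom by (simp add: rng_hom_def)

lemma hom_minus: "x \<in> carrier A \<Longrightarrow> y \<in> carrier A \<Longrightarrow> h (x \<ominus> y) = h x \<ominus>\<^bsub>B\<^esub> h y"
  by (simp add: minus_eq B.minus_eq hom_add hom_neg)

lemmas hom_simps = hom_zero hom_neg hom_closed hom_add hom_mult hom_minus

end

section \<open>Normal forms\<close>

text \<open>This setting is interpreted twice: in \<open>A\<close> itself with the identity for
  \<open>h\<close>, and in the Toeplitz ring with the evaluation map. \<open>X\<close>,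
  \<open>Y\<close> and \<open>Z\<close> stand for the copies of \<open>I\<close>, \<open>J\<close>
  and \<open>R\<close>, so the arguments from local units are given once for both rings.\<close>

locale covariant_image = rng_homomorphism T A h for T (structure) and A (structure) and h +
  fixes X Y Z
  assumes X: "additive_subgroup X T" and Y: "additive_subgroup Y T" and Z: "additive_subgroup Z T"
    and ZZ: "\<lbrakk>z \<in> Z; z' \<in> Z\<rbrakk> \<Longrightarrow> z \<otimes> z' \<in> Z"
    and ZX: "\<lbrakk>z \<in> Z; x \<in> X\<rbrakk> \<Longrightarrow> z \<otimes> x \<in> X"
    and XZ: "\<lbrakk>x \<in> X; z \<in> Z\<rbrakk> \<Longrightarrow> x \<otimes> z \<in> X"
    and ZY: "\<lbrakk>z \<in> Z; y \<in> Y\<rbrakk> \<Longrightarrow> z \<otimes> y \<in> Y"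
    and YZ: "\<lbrakk>y \<in> Y; z \<in> Z\<rbrakk> \<Longrightarrow> y \<otimes> z \<in> Y"
    and YX: "\<lbrakk>y \<in> Y; x \<in> X\<rbrakk> \<Longrightarrow> y \<otimes> x \<in> Z"
    and unit_left: "\<lbrakk>finite F; F \<subseteq> X\<rbrakk> \<Longrightarrow> \<exists>a\<in>subgroup_prod T X Y. \<forall>x\<in>F. a \<otimes> x = x"
    and unit_right: "\<lbrakk>finite F; F \<subseteq> Y\<rbrakk> \<Longrightarrow> \<exists>b\<in>subgroup_prod T X Y. \<forall>y\<in>F. y \<otimes> b = y"
    and inj_Z: "\<lbrakk>z \<in> Z; h z = \<zero>\<^bsub>A\<^esub>\<rbrakk> \<Longrightarrow> z = \<zero>"
begin

section \<open>The span of the products of \<open>X\<close> and \<open>Y\<close>\<close>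

abbreviation "XY \<equiv> subgroup_prod T X Y"

lemma carr [simp]: "x \<in> X \<Longrightarrow> x \<in> carrier T" "y \<in> Y \<Longrightarrow> y \<in> carrier T" "z \<in> Z \<Longrightarrow> z \<in> carrier T"
  using X Y Z by (auto simp: additive_subgroup.a_Hcarr)

lemma sub: "X \<subseteq> carrier T" "Y \<subseteq> carrier T" "Z \<subseteq> carrier T" by auto

lemmas XY_additive = subgroup_prod_additive[OF sub(1,2)]
lemmas XY_induct = subgroup_prod_induct[OF sub(1,2), consumes 1, case_names zero prod diff]

lemma XY_carr [simp]: "u \<in> XY \<Longrightarrow> u \<in> carrier T"
  using XY_additive by (auto simp: additive_subgroup.a_Hcarr)

lemma zero_mem: "\<zero> \<in> X" "\<zero> \<in> Y" "\<zero> \<in> Z" "\<zero> \<in> XY"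
  using X Y Z XY_additive by (auto intro: additive_subgroup.zero_closed)

lemma XY_X: "u \<in> XY \<Longrightarrow> x \<in> X \<Longrightarrow> u \<otimes> x \<in> X"
  by (induction u rule: XY_induct)
    (simp_all add: zero_mem m_assoc minus_distr XZ YX subgroup_minus_closed[OF X])

lemma XY_Z: "u \<in> XY \<Longrightarrow> z \<in> Z \<Longrightarrow> u \<otimes> z \<in> XY"
  by (induction u rule: XY_induct)
    (simp_all add: zero_mem m_assoc minus_distr YZ subgroup_prod_incl subgroup_minus_closed[OF XY_additive])

text \<open>In \<open>u \<otimes> (x \<otimes> y)\<close> the factor \<open>u\<close> is absorbed by
  \<open>x\<close>. Elements of \<open>Z\<close> and of \<open>XY\<close> both qualify as
  \<open>u\<close>.\<close>

lemma T_XY: "v \<in> XY \<Longrightarrow> (\<And>x. x \<in> X \<Longrightarrow> u \<otimes> x \<in> X) \<Longrightarrow> u \<in> carrier T \<Longrightarrow> u \<otimes> v \<in> XY"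
  by (induction v rule: XY_induct)
    (simp_all add: zero_mem minus_distr subgroup_prod_incl subgroup_minus_closed[OF XY_additive]
      flip: m_assoc)

lemma XY_unit_right:
  assumes "u \<in> XY" obtains b where "b \<in> XY" "u \<otimes> b = u"
proof -
  \<comment> \<open>Right units of two elements of \<open>XY\<close> cannot be merged directly, but
    the finite sets of elements of \<open>Y\<close> on which they have to act can: a difference
    takes the union.\<close>
  have "\<exists>F. finite F \<and> F \<subseteq> Y \<and> (\<forall>b\<in>carrier T. (\<forall>y\<in>F. y \<otimes> b = y) \<longrightarrow> u \<otimes> b = u)"
    using assms
  proof (induction u rule: XY_induct)
    case (prod x y)
    then show ?case by (intro exI[of _ "{y}"]) (simp add: m_assoc)
  next
    case (diff a b)
    then obtain F F' where "finite F" "F \<subseteq> Y" "\<forall>b\<in>carrier T. (\<forall>y\<in>F. y \<otimes> b = y) \<longrightarrow> a \<otimes> b = a"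
      "finite F'" "F' \<subseteq> Y" "\<forall>c\<in>carrier T. (\<forall>y\<in>F'. y \<otimes> c = y) \<longrightarrow> b \<otimes> c = b" by blast
    with diff show ?case by (intro exI[of _ "F \<union> F'"]) (simp add: minus_distr)
  qed auto
  then show thesis using unit_right that XY_carr by meson
qed

text \<open>Write \<open>u = u \<otimes> b\<close> with a right unit \<open>b\<close> in
  \<open>XY\<close>; expanding \<open>b\<close> into products \<open>x \<otimes> y\<close> makes
  each term start with \<open>u \<otimes> x = \<zero>\<close>. Thus \<open>XY\<close> acts
  faithfully on \<open>X\<close>.\<close>

lemma XY_annihilator:
  assumes "u \<in> XY" "\<And>x. x \<in> X \<Longrightarrow> u \<otimes> x = \<zero>"
  shows "u = \<zero>"
proof -
  obtain b where b: "b \<in> XY" "u \<otimes> b = u" using XY_unit_right assms(1) .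
  have "u \<otimes> b = \<zero>"
    using b(1) by (induction b rule: XY_induct)
      (use assms in \<open>simp_all add: minus_distr flip: m_assoc\<close>)
  with b show ?thesis by simp
qed

lemma XY_eqI:
  assumes "u \<in> XY" "v \<in> XY" "\<And>x. x \<in> X \<Longrightarrow> u \<otimes> x = v \<otimes> x"
  shows "u = v"
proof -
  have "u \<ominus> v = \<zero>"
  proof (rule XY_annihilator)
    show "u \<ominus> v \<in> XY" using assms(1,2) by (rule subgroup_minus_closed[OF XY_additive])
    show "(u \<ominus> v) \<otimes> x = \<zero>" if "x \<in> X" for x
      using assms that by (simp add: minus_distr)
  qed
  then show ?thesis using assms by simp
qed

text \<open>In \<open>nf N d\<close> the number \<open>d\<close> is the degree and \<open>N\<close> bounds the length of the shorter of the two
  ends of the normally ordered words \<open>x\<^sub>1 \<dots> x\<^sub>m z y\<^sub>1 \<dots> y\<^sub>n\<close>.\<close>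

inductive nf :: "nat \<Rightarrow> int \<Rightarrow> 'a \<Rightarrow> bool" where
  base: "z \<in> Z \<Longrightarrow> nf N 0 z"
| left: "\<lbrakk>nf N d t; d \<ge> 0; x \<in> X\<rbrakk> \<Longrightarrow> nf N (d + 1) (x \<otimes> t)"
| right: "\<lbrakk>nf N d t; d \<le> 0; y \<in> Y\<rbrakk> \<Longrightarrow> nf N (d - 1) (t \<otimes> y)"
| both: "\<lbrakk>nf N 0 t; x \<in> X; y \<in> Y\<rbrakk> \<Longrightarrow> nf (Suc N) 0 (x \<otimes> t \<otimes> y)"
| diff: "\<lbrakk>nf N d t; nf N d t'\<rbrakk> \<Longrightarrow> nf N d (t \<ominus> t')"

section \<open>Closure of normal forms under multiplication\<close>

lemma nf_carr [simp]: "nf N d t \<Longrightarrow> t \<in> carrier T"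
  by (induction rule: nf.induct) auto

text \<open>Outside degree \<open>0\<close> zero is built up as
  \<open>\<zero> \<otimes> \<zero>\<close>, one degree at a time in both directions.\<close>

lemma nf_zero: "nf N d \<zero>"
proof -
  have "nf N (int n) \<zero> \<and> nf N (- int n) \<zero>" for n
  proof (induction n)
    case (Suc n)
    have eq: "int (Suc n) = int n + 1" "- int (Suc n) = - int n - 1" by simp_all
    show ?case
      unfolding eq using Suc left[of N "int n" \<zero> \<zero>] right[of N "- int n" \<zero> \<zero>] zero_mem by simp
  qed (simp add: base zero_mem)
  then show ?thesis by (cases d rule: int_cases2) auto
qed

lemma nf_Suc: "nf N d t \<Longrightarrow> nf (Suc N) d t"
  by (induction rule: nf.induct) (auto intro: nf.intros)

lemma nf_mono: "N \<le> M \<Longrightarrow> nf N d t \<Longrightarrow> nf M d t"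
  by (induction M rule: dec_induct) (auto intro: nf_Suc)

text \<open>The leftmost letter of a word absorbs \<open>z\<close>, so neither the degree nor the
  bound changes.\<close>

lemma Z_nf: "nf N d t \<Longrightarrow> z \<in> Z \<Longrightarrow> nf N d (z \<otimes> t)"
proof (induction rule: nf.induct)
  case (left N d t x)
  then show ?case using nf.left[of N d t "z \<otimes> x"] by (simp add: m_assoc ZX)
next
  case (right N d t y)
  then show ?case using nf.right[of N d "z \<otimes> t" y] by (simp add: m_assoc)
next
  case (both N t x y)
  then show ?case using nf.both[of N t "z \<otimes> x" y] by (simp add: m_assoc ZX)
qed (auto simp: minus_distr intro: nf.base nf.diff ZZ)

lemma nf_Z: "nf N d t \<Longrightarrow> z \<in> Z \<Longrightarrow> nf N d (t \<otimes> z)"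
proof (induction rule: nf.induct)
  case (left N d t x)
  then show ?case using nf.left[of N d "t \<otimes> z" x] by (simp add: m_assoc)
next
  case (right N d t y)
  then show ?case using nf.right[of N d t "y \<otimes> z"] by (simp add: m_assoc YZ)
next
  case (both N t x y)
  then show ?case using nf.both[of N t x "y \<otimes> z"] by (simp add: m_assoc YZ)
qed (auto simp: minus_distr intro: nf.base nf.diff ZZ)

text \<open>As \<open>Z\<close> need not contain an identity to put behind \<open>x\<close>, a local
  unit takes its place: \<open>x = a \<otimes> x\<close> is a combination of terms
  \<open>x' \<otimes> (y \<otimes> x)\<close>, whose second factors lie in \<open>Z\<close>.\<close>

lemma nf_X_gen: assumes x: "x \<in> X" shows "nf N 1 x"
proof -
  obtain a where a: "a \<in> XY" "a \<otimes> x = x" using unit_left[of "{x}"] x by auto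
  have "nf N 1 (a \<otimes> x)"
    using a(1)
  proof (induction a rule: XY_induct)
    case (prod x' y)
    then show ?case using nf.left[OF nf.base[of "y \<otimes> x" N], of x'] x by (simp add: m_assoc YX)
  qed (use x in \<open>simp_all add: nf_zero minus_distr diff\<close>)
  with a show ?thesis by simp
qed

lemma nf_Y_gen: assumes y: "y \<in> Y" shows "nf N (- 1) y"
proof -
  obtain a where a: "a \<in> XY" "y \<otimes> a = y" using unit_right[of "{y}"] y by auto
  have "nf N (- 1) (y \<otimes> a)"
    using a(1)
  proof (induction a rule: XY_induct)
    case (prod x y')
    then show ?case using nf.right[OF nf.base[of "y \<otimes> x" N], of y'] y by (simp add: YX flip: m_assoc)
  qed (use y in \<open>simp_all add: nf_zero minus_distr diff\<close>)
  with a show ?thesis by simp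
qed

text \<open>The bound has to grow in negative degree: the surplus letters of \<open>Y\<close> are
  peeled off on the right until one is left over a factor of degree \<open>0\<close>, and
  \<open>x\<close> forms a new pair with it through the rule \<open>both\<close>.\<close>

lemma X_nf: "nf N d t \<Longrightarrow> x \<in> X \<Longrightarrow> nf (Suc N) (d + 1) (x \<otimes> t)"
proof (induction rule: nf.induct)
  case (base z N)
  then show ?case using nf.left[OF nf.base[of z "Suc N"], of x] by simp
next
  case (left N d t x')
  then show ?case using nf.left[OF nf_Suc[OF nf.left[of N d t x']], of x] by simp
next
  case (right N d t y)
  show ?case
  proof (cases "d = 0")
    case True
    then show ?thesis using nf.both[of N t x y] right by (simp add: m_assoc)
  next
    case False
    then show ?thesis using nf.right[OF right.IH, of y] right by (simp add: m_assoc)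
  qed
next
  case (both N t x' y)
  then show ?case using nf.left[OF nf_Suc[OF nf.both[of N t x' y]], of x] by simp
qed (auto simp: minus_distr intro: nf.diff)

text \<open>Instead of lengthening the left end, \<open>y\<close> cancels against a leading letter
  of \<open>X\<close> into an element of \<open>Z\<close>, or turns a leading element of
  \<open>Z\<close> into a letter of \<open>Y\<close>. Hence the bound is kept.\<close>

lemma Y_nf: "nf N d t \<Longrightarrow> y \<in> Y \<Longrightarrow> nf N (d - 1) (y \<otimes> t)"
proof (induction rule: nf.induct)
  case (left N d t x)
  then show ?case using Z_nf[of N d t "y \<otimes> x"] by (simp add: YX flip: m_assoc)
next
  case (right N d t y')
  then show ?case using nf.right[OF right.IH, of y'] by (simp add: m_assoc)
next
  case (both N t x y')
  then show ?case
    using nf.right[OF nf_Suc[OF Z_nf[of N 0 t "y \<otimes> x"]], of y'] by (simp add: YX flip: m_assoc)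
qed (auto simp: minus_distr intro: nf.diff nf_Y_gen YZ)

text \<open>In negative degree every word ends in a letter of \<open>Y\<close>, which together with
  \<open>x\<close> gives a factor in \<open>Z\<close>.\<close>

lemma nf_X: "nf N d t \<Longrightarrow> d < 0 \<Longrightarrow> x \<in> X \<Longrightarrow> nf N (d + 1) (t \<otimes> x)"
proof (induction rule: nf.induct)
  case (right N d t y)
  then show ?case using nf_Z[of N d t "y \<otimes> x"] by (simp add: YX m_assoc)
qed (auto simp: minus_distr intro: nf.diff)

text \<open>Both ends of a word lose a letter: \<open>y \<otimes> x'\<close> and
  \<open>y' \<otimes> x\<close> lie in \<open>Z\<close> and are absorbed by what remains. This drop
  of the bound drives the induction in degree \<open>0\<close>.\<close>

lemma Y_nf_X: "nf (Suc N) 0 t \<Longrightarrow> y \<in> Y \<Longrightarrow> x \<in> X \<Longrightarrow> nf N 0 (y \<otimes> t \<otimes> x)"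
proof (induction "Suc N" "0::int" t rule: nf.induct)
  case (base z)
  then show ?case by (simp add: nf.base YX YZ)
next
  case (both t x' y')
  then show ?case using nf_Z[OF Z_nf[of N 0 t "y \<otimes> x'"], of "y' \<otimes> x"] by (simp add: YX m_assoc)
qed (auto simp: minus_distr intro: nf.diff)

lemma nf_0: "nf 0 0 t \<Longrightarrow> t \<in> Z"
  by (induction "0::nat" "0::int" t rule: nf.induct) (auto simp: subgroup_minus_closed[OF Z])

section \<open>Local units for normal forms\<close>

lemma nf_pos_unit:
  assumes "nf N d t" "d > 0"
  obtains a where "a \<in> XY" "a \<otimes> t = t"
proof -
  \<comment> \<open>Every word of positive degree begins with a letter of \<open>X\<close>, and
    finitely many such letters control all of \<open>t\<close>.\<close>
  have "\<exists>F. finite F \<and> F \<subseteq> X \<and> (\<forall>a\<in>carrier T. (\<forall>x\<in>F. a \<otimes> x = x) \<longrightarrow> a \<otimes> t = t)"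
    using assms
  proof (induction rule: nf.induct)
    case (left N d t x)
    then show ?case by (intro exI[of _ "{x}"]) (simp flip: m_assoc)
  next
    case (diff N d t t')
    then obtain F F' where "finite F" "F \<subseteq> X" "\<forall>a\<in>carrier T. (\<forall>x\<in>F. a \<otimes> x = x) \<longrightarrow> a \<otimes> t = t"
      "finite F'" "F' \<subseteq> X" "\<forall>a\<in>carrier T. (\<forall>x\<in>F'. a \<otimes> x = x) \<longrightarrow> a \<otimes> t' = t'" by blast
    with diff show ?case by (intro exI[of _ "F \<union> F'"]) (simp add: minus_distr)
  qed linarith+
  then show thesis using unit_left that XY_carr by meson
qed

lemma nf_neg_unit:
  assumes "nf N d t" "d < 0"
  obtains b where "b \<in> XY" "t \<otimes> b = t"
proof -
  have "\<exists>F. finite F \<and> F \<subseteq> Y \<and> (\<forall>b\<in>carrier T. (\<forall>y\<in>F. y \<otimes> b = y) \<longrightarrow> t \<otimes> b = t)"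
    using assms
  proof (induction rule: nf.induct)
    case (right N d t y)
    then show ?case by (intro exI[of _ "{y}"]) (simp add: m_assoc)
  next
    case (diff N d t t')
    then obtain F F' where "finite F" "F \<subseteq> Y" "\<forall>b\<in>carrier T. (\<forall>y\<in>F. y \<otimes> b = y) \<longrightarrow> t \<otimes> b = t"
      "finite F'" "F' \<subseteq> Y" "\<forall>b\<in>carrier T. (\<forall>y\<in>F'. y \<otimes> b = y) \<longrightarrow> t' \<otimes> b = t'" by blast
    with diff show ?case by (intro exI[of _ "F \<union> F'"]) (simp add: minus_distr)
  qed linarith+
  then show thesis using unit_right that XY_carr by meson
qed

text \<open>Words made by \<open>both\<close> begin in \<open>X\<close> and end in \<open>Y\<close>,
  so suitable local units fix them from both sides. The elements of \<open>Z\<close> entering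
  through \<open>base\<close> need not be fixed, hence the separate summand
  \<open>z\<close>.\<close>

lemma nf_degree_0_unit:
  assumes "nf N 0 t"
  obtains z t' a b where "z \<in> Z" "t' \<in> carrier T" "t = z \<oplus> t'" "a \<in> XY" "b \<in> XY" "a \<otimes> t' \<otimes> b = t'"
proof -
  \<comment> \<open>Quantifying over all units of \<open>F\<close> and \<open>F'\<close> makes the
    property stable under enlarging these sets, as the difference of two elements requires.\<close>
  define fixed where "fixed F F' s \<longleftrightarrow> (\<forall>a\<in>carrier T. \<forall>b\<in>carrier T.
    (\<forall>x\<in>F. a \<otimes> x = x) \<longrightarrow> (\<forall>y\<in>F'. y \<otimes> b = y) \<longrightarrow> a \<otimes> s \<otimes> b = s)" for F F' s
  have "\<exists>z s F F'. z \<in> Z \<and> s \<in> carrier T \<and> t = z \<oplus> s \<and> finite F \<and> F \<subseteq> X \<and> finite F' \<and> F' \<subseteq> Y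
    \<and> fixed F F' s"
    using assms
  proof (induction N "0::int" t rule: nf.induct)
    case (base z N)
    moreover have "fixed {} {} \<zero>" by (simp add: fixed_def)
    moreover have "z = z \<oplus> \<zero>" using base by simp
    ultimately show ?case by blast
  next
    case (both N t x y)
    have "a \<otimes> (x \<otimes> t \<otimes> y) \<otimes> b = x \<otimes> t \<otimes> y"
      if "a \<in> carrier T" "b \<in> carrier T" "a \<otimes> x = x" "y \<otimes> b = y" for a b
    proof -
      have "a \<otimes> (x \<otimes> t \<otimes> y) \<otimes> b = (a \<otimes> x) \<otimes> t \<otimes> (y \<otimes> b)"
        using both that(1,2) by (simp add: m_assoc)
      then show ?thesis by (simp only: that)
    qed
    then have "fixed {x} {y} (x \<otimes> t \<otimes> y)" by (simp add: fixed_def)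
    moreover have "x \<otimes> t \<otimes> y = \<zero> \<oplus> x \<otimes> t \<otimes> y" "x \<otimes> t \<otimes> y \<in> carrier T" using both by simp_all
    moreover have "finite {x}" "finite {y}" "{x} \<subseteq> X" "{y} \<subseteq> Y" using both by simp_all
    ultimately show ?case using zero_mem(3) by blast
  next
    case (diff N t s)
    from diff(2) obtain z1 t1 F1 F1' where 1: "z1 \<in> Z" "t1 \<in> carrier T" "t = z1 \<oplus> t1"
      "finite F1" "F1 \<subseteq> X" "finite F1'" "F1' \<subseteq> Y" "fixed F1 F1' t1"
      by blast
    from diff(4) obtain z2 t2 F2 F2' where 2: "z2 \<in> Z" "t2 \<in> carrier T" "s = z2 \<oplus> t2"
      "finite F2" "F2 \<subseteq> X" "finite F2'" "F2' \<subseteq> Y" "fixed F2 F2' t2"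
      by blast
    have "t \<ominus> s = (z1 \<ominus> z2) \<oplus> (t1 \<ominus> t2)"
      using 1(1-3) 2(1-3) by (simp add: minus_eq minus_add a_ac)
    moreover have "z1 \<ominus> z2 \<in> Z" using 1(1) 2(1) by (rule subgroup_minus_closed[OF Z])
    moreover have "fixed (F1 \<union> F2) (F1' \<union> F2') (t1 \<ominus> t2)"
      using 1(2,8) 2(2,8) by (simp add: fixed_def minus_distr)
    moreover have "t1 \<ominus> t2 \<in> carrier T" using 1(2) 2(2) by simp
    moreover have "finite (F1 \<union> F2)" "finite (F1' \<union> F2')" "F1 \<union> F2 \<subseteq> X" "F1' \<union> F2' \<subseteq> Y"
      using 1 2 by simp_all
    ultimately show ?case by metis
  qed linarith+
  then obtain z s F F' where s: "z \<in> Z" "s \<in> carrier T" "t = z \<oplus> s" and F: "finite F" "F \<subseteq> X"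
    "finite F'" "F' \<subseteq> Y" and fixed: "fixed F F' s"
    by blast
  obtain a where "a \<in> XY" "\<forall>x\<in>F. a \<otimes> x = x" using unit_left F by blast
  moreover obtain b where "b \<in> XY" "\<forall>y\<in>F'. y \<otimes> b = y" using unit_right F by blast
  ultimately show thesis using that[OF s] fixed by (simp add: fixed_def)
qed

section \<open>Kernel elements in normal form\<close>

lemma ideal_XY_left:
  assumes "rng_ideal K T" "\<And>y. y \<in> Y \<Longrightarrow> y \<otimes> t \<in> K" "t \<in> carrier T" "a \<in> XY"
  shows "a \<otimes> t \<in> K"
proof -
  interpret K: rng_ideal K T by fact
  show ?thesis
    using assms(4)
    by (induction a rule: XY_induct)
      (simp_all add: assms m_assoc K.l_ideal minus_distr subgroup_minus_closed[OF K.additive_subgroup_axioms])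
qed

lemma ideal_XY_right:
  assumes "rng_ideal K T" "\<And>x. x \<in> X \<Longrightarrow> t \<otimes> x \<in> K" "t \<in> carrier T" "a \<in> XY"
  shows "t \<otimes> a \<in> K"
proof -
  interpret K: rng_ideal K T by fact
  show ?thesis
    using assms(4)
    by (induction a rule: XY_induct)
      (simp_all add: assms K.r_ideal minus_distr subgroup_minus_closed[OF K.additive_subgroup_axioms]
        flip: m_assoc)
qed

lemma nf_kernel:
  assumes K: "rng_ideal K T"
    and rel: "\<And>z u. \<lbrakk>z \<in> Z; u \<in> XY; h z = h u\<rbrakk> \<Longrightarrow> z \<ominus> u \<in> K"
    and "nf N d t" "h t = \<zero>\<^bsub>A\<^esub>"
  shows "t \<in> K"
proof -
  interpret K: rng_ideal K T by (rule K)
  have deg_0: "t \<in> K" if "nf N 0 t" "h t = \<zero>\<^bsub>A\<^esub>" for N t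
    using that
  proof (induction N arbitrary: t)
    case 0
    \<comment> \<open>With bound \<open>0\<close> in degree \<open>0\<close> only elements of
      \<open>Z\<close> occur, and there \<open>h\<close> is injective.\<close>
    then have "t = \<zero>" by (intro inj_Z nf_0)
    then show ?case by simp
  next
    case (Suc N)
    obtain z t' a b where t: "z \<in> Z" "t' \<in> carrier T" "t = z \<oplus> t'" and ab: "a \<in> XY" "b \<in> XY"
      and unit: "a \<otimes> t' \<otimes> b = t'"
      using nf_degree_0_unit[OF Suc.prems(1)] .
    have tc: "t \<in> carrier T" using Suc.prems by simp
    \<comment> \<open>The passage to \<open>a \<otimes> t \<otimes> b\<close> has two stages: first
      the letters \<open>y\<close> are combined into \<open>a\<close>, acting on
      \<open>t \<otimes> x\<close>, then the letters \<open>x\<close> into \<open>b\<close>, acting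
      on \<open>a \<otimes> t\<close>.\<close>
    have ytx: "y \<otimes> t \<otimes> x \<in> K" if "y \<in> Y" "x \<in> X" for x y
      using that Suc.prems tc by (intro Suc.IH Y_nf_X) (simp_all add: hom_simps)
    have atx: "a \<otimes> (t \<otimes> x) \<in> K" if "x \<in> X" for x
      by (rule ideal_XY_left[OF K]) (use that ab tc ytx in \<open>simp_all flip: m_assoc\<close>)
    have atb: "a \<otimes> t \<otimes> b \<in> K"
      by (rule ideal_XY_right[OF K, of "a \<otimes> t"]) (use atx ab tc in \<open>simp_all add: m_assoc\<close>)
    have "a \<otimes> z \<otimes> b \<in> XY" using ab t by (intro T_XY) (simp_all add: XY_X XY_Z)
    moreover have "a \<otimes> t \<otimes> b = a \<otimes> z \<otimes> b \<oplus> t'"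
      using t ab unit by (simp add: r_distr l_distr)
    \<comment> \<open>\<open>h\<close> kills both \<open>t = z \<oplus> t'\<close> and \<open>a
      \<otimes> t \<otimes> b = a \<otimes> z \<otimes> b \<oplus> t'\<close>; cancelling
      \<open>h t'\<close> supplies the hypothesis of \<open>rel\<close> for \<open>z\<close> and
      \<open>a \<otimes> z \<otimes> b\<close>.\<close>
    moreover have "h z = h (a \<otimes> z \<otimes> b)"
    proof -
      have "h t = \<zero>\<^bsub>A\<^esub>" "h (a \<otimes> t \<otimes> b) = \<zero>\<^bsub>A\<^esub>" using Suc.prems tc ab by (simp_all add: hom_simps)
      then have "h z \<oplus>\<^bsub>A\<^esub> h t' = \<zero>\<^bsub>A\<^esub>" "h (a \<otimes> z \<otimes> b) \<oplus>\<^bsub>A\<^esub> h t' = \<zero>\<^bsub>A\<^esub>"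
        using calculation(2) t ab by (simp_all add: hom_add)
      then show ?thesis
        using t ab B.add.right_cancel[of "h t'" "h z" "h (a \<otimes> z \<otimes> b)"] by (simp add: hom_closed)
    qed
    ultimately have "z \<ominus> a \<otimes> z \<otimes> b \<in> K" "a \<otimes> z \<otimes> b \<oplus> t' \<in> K"
      using rel t atb by auto
    then have "(z \<ominus> a \<otimes> z \<otimes> b) \<oplus> (a \<otimes> z \<otimes> b \<oplus> t') \<in> K" by (rule K.a_closed)
    moreover have "(z \<ominus> c) \<oplus> (c \<oplus> t') = t" if "c \<in> carrier T" for c
      using that t by (simp add: minus_eq a_assoc r_neg1)
    ultimately show ?case using ab t by simp
  qed
  \<comment> \<open>From here the induction is on the absolute value of the degree, starting at
    \<open>deg_0\<close>, while the bound \<open>N\<close> stays fixed.\<close>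
  have "nf N (int n) t \<longrightarrow> h t = \<zero>\<^bsub>A\<^esub> \<longrightarrow> t \<in> K" for n t
  proof (induction n arbitrary: t)
    case (Suc n)
    show ?case
    proof (intro impI)
      assume t: "nf N (int (Suc n)) t" and 0: "h t = \<zero>\<^bsub>A\<^esub>"
      obtain a where a: "a \<in> XY" "a \<otimes> t = t" by (rule nf_pos_unit[OF t]) simp
      have "y \<otimes> t \<in> K" if "y \<in> Y" for y
        using Suc[of "y \<otimes> t"] Y_nf[OF t that] that t 0 by (simp add: hom_simps)
      then show "t \<in> K" using ideal_XY_left[OF K, of t a] a t by simp
    qed
  qed (use deg_0 in simp)
  moreover have "nf N (- int n) t \<longrightarrow> h t = \<zero>\<^bsub>A\<^esub> \<longrightarrow> t \<in> K" for n t
  proof (induction n arbitrary: t)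
    case (Suc n)
    show ?case
    proof (intro impI)
      assume t: "nf N (- int (Suc n)) t" and 0: "h t = \<zero>\<^bsub>A\<^esub>"
      obtain a where a: "a \<in> XY" "t \<otimes> a = t" by (rule nf_neg_unit[OF t]) simp
      have "t \<otimes> x \<in> K" if "x \<in> X" for x
        using Suc[of "t \<otimes> x"] nf_X[OF t _ that] that t 0 by (simp add: hom_simps)
      then show "t \<in> K" using ideal_XY_right[OF K, of t a] a t by simp
    qed
  qed (use deg_0 in simp)
  ultimately show ?thesis using assms(3,4) by (cases d rule: int_cases2) auto
qed

end

section \<open>Quotients and gradings\<close>

lemma additive_subgroup_image:
  assumes "abelian_group M" "abelian_group B" "f \<in> hom (add_monoid M) (add_monoid B)"
  shows "additive_subgroup (f ` carrier M) B"
proof -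
  interpret group_hom "add_monoid M" "add_monoid B" f
    by (intro group_hom.intro group_hom_axioms.intro assms abelian_group.a_group)
  show ?thesis using img_is_subgroup by (simp add: additive_subgroup_def)
qed

context rng_homomorphism
begin

lemma kernel_ideal: "rng_ideal (a_kernel A B h) A"
  by (rule rng_hom_kernel_ideal[OF rng_axioms B.rng_axioms hom])

lemma hom_finsum:
  assumes "finite F" "\<And>n. n \<in> F \<Longrightarrow> f n \<in> carrier A"
  shows "h (finsum A f F) = finsum B (\<lambda>n. h (f n)) F"
  using assms
  by (induction F rule: finite_induct) (simp_all add: hom_simps Pi_iff)

lemma image_subgroup:
  assumes "additive_subgroup H A"
  shows "additive_subgroup (h ` H) B"
proof -
  interpret additive_subgroup H A by fact
  interpret group_hom "add_monoid A" "add_monoid B" h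
    by (intro group_hom.intro group_hom_axioms.intro add_hom a_group B.a_group)
  show ?thesis using subgroup_img_is_subgroup[OF a_subgroup] by (simp add: additive_subgroup_def)
qed

text \<open>First isomorphism theorem for rings without unit: \<open>h\<close> is constant on each
  coset of its kernel, and this single value defines the map. The value on cosets is exported
  because the grading of the quotient consists of cosets.\<close>

lemma quotient_kernel_iso:
  fixes K defines "K \<equiv> a_kernel A B h"
  assumes "h ` carrier A = carrier B"
  obtains \<phi> where "\<phi> \<in> rng_hom (A Quot K) B" "bij_betw \<phi> (carrier (A Quot K)) (carrier B)"
    "\<And>x. x \<in> carrier A \<Longrightarrow> \<phi> (K +> x) = h x"
proof -
  have K_iff: "k \<in> K \<longleftrightarrow> k \<in> carrier A \<and> h k = \<zero>\<^bsub>B\<^esub>" for k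
    by (simp add: K_def a_kernel_def')
  have coset_const: "h (k \<oplus> x) = h x" if "k \<in> K" "x \<in> carrier A" for k x
    using that by (simp add: K_iff hom_simps)
  have diff: "x \<ominus> y \<in> K" if "x \<in> carrier A" "y \<in> carrier A" "h x = h y" for x y
    using that by (simp add: K_iff hom_simps B.minus_eq B.r_neg)
  interpret K: rng_ideal K A unfolding K_def by (rule kernel_ideal)
  interpret KA: abelian_subgroup K A
    by (rule abelian_subgroupI3) (rule K.additive_subgroup_axioms, rule abelian_group_axioms)
  interpret c: rng_homomorphism A "A Quot K" "(+>) K"
    by (intro rng_homomorphism.intro rng_homomorphism_axioms.intro rng_axioms
        rng_quotient[OF rng_axioms K.rng_ideal_axioms])
  define \<phi> where "\<phi> C = the_elem (h ` C)" for C
  have carr: "carrier (A Quot K) = (+>) K ` carrier A"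
    by (auto simp: FactRing_def A_RCOSETS_def')
  have \<phi>: "\<phi> (K +> x) = h x" if x: "x \<in> carrier A" for x
  proof -
    have "h y = h x" if "y \<in> K +> x" for y
    proof -
      obtain k where "k \<in> K" "y = k \<oplus> x" using \<open>y \<in> K +> x\<close> unfolding a_r_coset_def' by blast
      then show ?thesis using coset_const x by simp
    qed
    moreover have "x \<in> K +> x" by (rule KA.a_rcos_self[OF x])
    ultimately have "h ` (K +> x) = {h x}" by blast
    then show ?thesis by (simp add: \<phi>_def)
  qed
  have inj: "K +> x = K +> y" if "x \<in> carrier A" "y \<in> carrier A" "h x = h y" for x y
  proof -
    have "x \<ominus> y \<in> K" using that by (rule diff)
    moreover have "x = (x \<ominus> y) \<oplus> y" using that by (simp add: minus_eq a_assoc l_neg)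
    ultimately have "x \<in> K +> y" unfolding a_r_coset_def' by blast
    then show ?thesis using a_repr_independence[OF _ that(2) K.a_subgroup] by simp
  qed
  show thesis
  proof
    have add: "\<phi> (C \<oplus>\<^bsub>A Quot K\<^esub> D) = \<phi> C \<oplus>\<^bsub>B\<^esub> \<phi> D" and mult: "\<phi> (C \<otimes>\<^bsub>A Quot K\<^esub> D) = \<phi> C \<otimes>\<^bsub>B\<^esub> \<phi> D"
      if CD: "C \<in> carrier (A Quot K)" "D \<in> carrier (A Quot K)" for C D
    proof -
      obtain x y where xy: "x \<in> carrier A" "y \<in> carrier A" "C = K +> x" "D = K +> y"
        using CD unfolding carr by blast
      have "C \<oplus>\<^bsub>A Quot K\<^esub> D = K +> (x \<oplus> y)" "C \<otimes>\<^bsub>A Quot K\<^esub> D = K +> (x \<otimes> y)"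
        by (simp_all only: xy(3,4) c.hom_add[OF xy(1,2)] c.hom_mult[OF xy(1,2)])
      then show "\<phi> (C \<oplus>\<^bsub>A Quot K\<^esub> D) = \<phi> C \<oplus>\<^bsub>B\<^esub> \<phi> D" "\<phi> (C \<otimes>\<^bsub>A Quot K\<^esub> D) = \<phi> C \<otimes>\<^bsub>B\<^esub> \<phi> D"
        using xy(1,2) by (simp_all only: xy(3,4) \<phi> hom_simps add.m_closed m_closed)
    qed
    have "\<phi> C \<in> carrier B" if "C \<in> carrier (A Quot K)" for C
      using that \<phi> hom_closed unfolding carr by force
    then show "\<phi> \<in> rng_hom (A Quot K) B"
      using add mult by (simp add: rng_hom_def hom_def)
    have "inj_on \<phi> (carrier (A Quot K))"
    proof (rule inj_onI)
      fix C D assume CD: "C \<in> carrier (A Quot K)" "D \<in> carrier (A Quot K)" "\<phi> C = \<phi> D"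
      obtain x y where xy: "x \<in> carrier A" "y \<in> carrier A" "C = K +> x" "D = K +> y"
        using CD(1,2) unfolding carr by blast
      have "h x = h y" using CD(3) by (simp only: xy \<phi>)
      then show "C = D" unfolding xy(3,4) by (rule inj[OF xy(1,2)])
    qed
    moreover have "\<phi> ` carrier (A Quot K) = carrier B"
      unfolding carr image_image assms(2)[symmetric] by (rule image_cong[OF refl \<phi>])
    ultimately show "bij_betw \<phi> (carrier (A Quot K)) (carrier B)" by (simp add: bij_betw_def)
  qed (rule \<phi>)
qed

end

section \<open>Decompositions into homogeneous components\<close>

lemma (in abelian_group) finsum_support:
  assumes "finite F" "\<And>n. f n \<in> carrier G" "\<And>n. n \<notin> F \<Longrightarrow> f n = \<zero>"
  shows "finsum G f F = (\<Oplus>n\<in>{n. f n \<noteq> \<zero>}. f n)"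
  by (rule add.finprod_mono_neutral_cong_right) (use assms in auto)

lemma (in abelian_group) a_inv_zero: "\<ominus> \<zero> = \<zero>"
  by (rule minus_equality) simp_all

lemma (in abelian_group) finsum_minus:
  assumes "finite F" "\<And>n. f n \<in> carrier G" "\<And>n. g n \<in> carrier G"
  shows "(\<Oplus>n\<in>F. f n \<ominus> g n) = finsum G f F \<ominus> finsum G g F"
  using assms(1)
proof (induction F rule: finite_induct)
  case (insert n F)
  have "finsum G f F \<in> carrier G" "finsum G g F \<in> carrier G" using assms by auto
  then show ?case using insert assms(2,3) by (simp add: minus_eq minus_add a_ac Pi_iff)
qed (simp add: minus_eq a_inv_zero)

lemma (in abelian_group) decomposition_minus:
  assumes "\<And>n. additive_subgroup (H n) G"
    and "\<exists>f F. finite F \<and> (\<forall>n. f n \<in> H n) \<and> (\<forall>n. n \<notin> F \<longrightarrow> f n = \<zero>) \<and> x = finsum G f F"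
    and "\<exists>f F. finite F \<and> (\<forall>n. f n \<in> H n) \<and> (\<forall>n. n \<notin> F \<longrightarrow> f n = \<zero>) \<and> y = finsum G f F"
  shows "\<exists>f F. finite F \<and> (\<forall>n. f n \<in> H n) \<and> (\<forall>n. n \<notin> F \<longrightarrow> f n = \<zero>) \<and> x \<ominus> y = finsum G f F"
proof -
  obtain f E where f: "finite E" "\<forall>n. f n \<in> H n" "\<forall>n. n \<notin> E \<longrightarrow> f n = \<zero>" "x = finsum G f E"
    using assms(2) by metis
  obtain g F where g: "finite F" "\<forall>n. g n \<in> H n" "\<forall>n. n \<notin> F \<longrightarrow> g n = \<zero>" "y = finsum G g F"
    using assms(3) by metis
  have c: "f n \<in> carrier G" "g n \<in> carrier G" for n
    using f(2) g(2) additive_subgroup.a_Hcarr[OF assms(1)] by blast+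
  have "x = finsum G f (E \<union> F)" "y = finsum G g (E \<union> F)"
    unfolding f(4) g(4) using finsum_support[of E f] finsum_support[of "E \<union> F" f]
      finsum_support[of F g] finsum_support[of "E \<union> F" g] f g c by auto
  then have "x \<ominus> y = (\<Oplus>n\<in>E \<union> F. f n \<ominus> g n)" using f(1) g(1) c by (simp add: finsum_minus)
  moreover have "\<forall>n. f n \<ominus> g n \<in> H n" using f(2) g(2) subgroup_minus_closed[OF assms(1)] by blast
  moreover have "\<forall>n. n \<notin> E \<union> F \<longrightarrow> f n \<ominus> g n = \<zero>" using f(3) g(3) by (simp add: minus_eq a_inv_zero)
  moreover have "finite (E \<union> F)" using f(1) g(1) by simp
  ultimately show ?thesis by (intro exI[of _ "\<lambda>n. f n \<ominus> g n"] exI[of _ "E \<union> F"] conjI)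
qed

text \<open>A grading without uniqueness of decompositions. This much passes from the free ring to
  its quotients along surjective homomorphisms; uniqueness is recovered at the end through injective
  maps into graded rings.\<close>

locale pregraded_rng = rng A for A (structure) +
  fixes H :: "int \<Rightarrow> 'a set"
  assumes subgroup: "additive_subgroup (H n) A"
    and mult: "\<lbrakk>x \<in> H n; y \<in> H m\<rbrakk> \<Longrightarrow> x \<otimes> y \<in> H (n + m)"
    and decomposition: "x \<in> carrier A \<Longrightarrow>
      \<exists>f F. finite F \<and> (\<forall>n. f n \<in> H n) \<and> (\<forall>n. n \<notin> F \<longrightarrow> f n = \<zero>) \<and> x = finsum A f F"
begin

lemma homogeneous_carr: "x \<in> H n \<Longrightarrow> x \<in> carrier A"
  using subgroup by (rule additive_subgroup.a_Hcarr)

lemma pregraded_image: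
  assumes "rng_homomorphism A B h" "h ` carrier A = carrier B"
  shows "pregraded_rng B (\<lambda>n. h ` H n)"
proof -
  interpret rng_homomorphism A B h by fact
  show ?thesis
  proof (rule pregraded_rng.intro[OF B.rng_axioms], rule pregraded_rng_axioms.intro)
    show "additive_subgroup (h ` H n) B" for n by (rule image_subgroup[OF subgroup])
    show "x \<otimes>\<^bsub>B\<^esub> y \<in> h ` H (n + m)" if "x \<in> h ` H n" "y \<in> h ` H m" for x y n m
      using that mult by (auto simp: homogeneous_carr simp flip: hom_mult intro!: imageI)
    fix y assume "y \<in> carrier B"
    then obtain x where x: "x \<in> carrier A" "y = h x" using assms(2) by auto
    obtain f F where f: "finite F" "\<forall>n. f n \<in> H n" "\<forall>n. n \<notin> F \<longrightarrow> f n = \<zero>" "x = finsum A f F"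
      using decomposition[OF x(1)] by blast
    then have "y = finsum B (\<lambda>n. h (f n)) F" using x hom_finsum homogeneous_carr by blast
    moreover have "\<forall>n. h (f n) \<in> h ` H n" "\<forall>n. n \<notin> F \<longrightarrow> h (f n) = \<zero>\<^bsub>B\<^esub>"
      using f hom_zero by auto
    ultimately show "\<exists>f F. finite F \<and> (\<forall>n. f n \<in> h ` H n) \<and> (\<forall>n. n \<notin> F \<longrightarrow> f n = \<zero>\<^bsub>B\<^esub>) \<and> y = finsum B f F"
      using f(1) by (intro exI[of _ "\<lambda>n. h (f n)"] exI[of _ F] conjI)
  qed
qed

end

context graded_rng
begin

lemma homogeneous_carr: "x \<in> G n \<Longrightarrow> x \<in> carrier A"
  using homogeneous_subgroup by (rule additive_subgroup.a_Hcarr)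

lemma decomposition_unique:
  assumes "finite F" "\<forall>n. f n \<in> G n" "\<forall>n. n \<notin> F \<longrightarrow> f n = \<zero>"
    and "finite F'" "\<forall>n. f' n \<in> G n" "\<forall>n. n \<notin> F' \<longrightarrow> f' n = \<zero>"
    and "finsum A f F = finsum A f' F'"
  shows "f = f'"
proof -
  have c: "f n \<in> carrier A" "f' n \<in> carrier A" for n using assms homogeneous_carr by blast+
  have fin: "finite {n. f n \<noteq> \<zero>}" "finite {n. f' n \<noteq> \<zero>}"
    using assms by (auto intro: finite_subset[of _ F] finite_subset[of _ F'])
  have "finsum A f F \<in> carrier A" using c by auto
  moreover have "finsum A f F = (\<Oplus>n\<in>{n. f n \<noteq> \<zero>}. f n)" "finsum A f F = (\<Oplus>n\<in>{n. f' n \<noteq> \<zero>}. f' n)"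
    using finsum_support[of F f] finsum_support[of F' f'] assms c by auto
  ultimately show ?thesis using direct_sum fin assms(2,5) by blast
qed

end

locale graded_rng_hom = rng_homomorphism T A h + T: pregraded_rng T H + A: graded_rng A G
  for T (structure) and H and A (structure) and G and h +
  assumes degree: "x \<in> H n \<Longrightarrow> h x \<in> G n"
begin

text \<open>After \<open>h\<close> is applied, both families are decompositions in \<open>A\<close>,
  where decompositions are unique. In the domain only their existence enters.\<close>

lemma hom_decomposition:
  assumes "finite F" "\<forall>n. f n \<in> H n" "\<forall>n. n \<notin> F \<longrightarrow> f n = \<zero>"
    and "finite F'" "\<forall>n. g n \<in> G n" "\<forall>n. n \<notin> F' \<longrightarrow> g n = \<zero>\<^bsub>A\<^esub>"
    and "h (finsum T f F) = finsum A g F'"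
  shows "h (f n) = g n"
proof -
  have "f n \<in> carrier T" for n using assms(2) T.homogeneous_carr by blast
  then have "h (finsum T f F) = finsum A (\<lambda>n. h (f n)) F" by (rule hom_finsum[OF assms(1)])
  moreover have "\<forall>n. h (f n) \<in> G n" "\<forall>n. n \<notin> F \<longrightarrow> h (f n) = \<zero>\<^bsub>A\<^esub>"
    using assms(2,3) degree hom_zero by auto
  ultimately have "(\<lambda>n. h (f n)) = g"
    using assms by (intro A.decomposition_unique[of F _ F']) simp_all
  then show ?thesis by metis
qed

lemma kernel_homogeneous:
  assumes "rng_ideal K T" "\<And>n t. \<lbrakk>t \<in> H n; h t = \<zero>\<^bsub>A\<^esub>\<rbrakk> \<Longrightarrow> t \<in> K"
    and t: "t \<in> carrier T" "h t = \<zero>\<^bsub>A\<^esub>"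
  shows "t \<in> K"
proof -
  interpret K: rng_ideal K T by fact
  obtain f F where f: "finite F" "\<forall>n. f n \<in> H n" "\<forall>n. n \<notin> F \<longrightarrow> f n = \<zero>" "t = finsum T f F"
    using T.decomposition[OF t(1)] by blast
  \<comment> \<open>The comparison is with the empty decomposition of \<open>h t\<close>, so every
    component of \<open>t\<close> lies in the kernel by itself.\<close>
  have "h (f n) = \<zero>\<^bsub>A\<^esub>" for n
    by (rule hom_decomposition[OF f(1-3), of "{}" "\<lambda>_. \<zero>\<^bsub>A\<^esub>"])
      (use f t A.homogeneous_subgroup in \<open>auto intro: additive_subgroup.zero_closed\<close>)
  then have fK: "f n \<in> K" for n using assms(2) f(2) by blast
  have "finsum T f F \<in> K"
    using f(1) by (induction F rule: finite_induct) (simp_all add: fK Pi_iff)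
  then show ?thesis using f(4) by simp
qed

lemma image_homogeneous: "h ` carrier T \<inter> G n = h ` H n"
proof
  show "h ` H n \<subseteq> h ` carrier T \<inter> G n" using degree T.homogeneous_carr by auto
  show "h ` carrier T \<inter> G n \<subseteq> h ` H n"
  proof
    fix a assume "a \<in> h ` carrier T \<inter> G n"
    then obtain t where t: "t \<in> carrier T" "a = h t" and a: "a \<in> G n" by auto
    obtain f F where f: "finite F" "\<forall>n. f n \<in> H n" "\<forall>n. n \<notin> F \<longrightarrow> f n = \<zero>" "t = finsum T f F"
      using T.decomposition[OF t(1)] by blast
    \<comment> \<open>The comparison family has \<open>a\<close> in degree \<open>n\<close> and zero
      elsewhere; \<open>if n = n\<close> is its value at \<open>n\<close>, written so as to match
      the rule.\<close>
    have "h (f n) = (if n = n then a else \<zero>\<^bsub>A\<^esub>)"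
      by (rule hom_decomposition[OF f(1-3), of "{n}" "\<lambda>m. if m = n then a else \<zero>\<^bsub>A\<^esub>"])
        (use f t a A.homogeneous_carr A.homogeneous_subgroup in
          \<open>auto intro: additive_subgroup.zero_closed simp: hom_closed\<close>)
    then show "a \<in> h ` H n" using f(2) by auto
  qed
qed

text \<open>The components of two decompositions of one element have equal images by uniqueness in
  \<open>A\<close>, and injectivity carries the equality back. This serves both the generated
  subring and the Cuntz-Pimsner ring.\<close>

lemma graded_if_inj:
  assumes "inj_on h (carrier T)"
  shows "graded_rng T H"
proof (rule graded_rng.intro[OF rng_axioms], rule graded_rng_axioms.intro)
  show "additive_subgroup (H n) T" for n by (rule T.subgroup)
  show "x \<otimes> y \<in> H (n + m)" if "x \<in> H n" "y \<in> H m" for x y n m using that by (rule T.mult)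
  fix x assume x: "x \<in> carrier T"
  obtain f F where f: "finite F" "\<forall>n. f n \<in> H n" "\<forall>n. n \<notin> F \<longrightarrow> f n = \<zero>" "x = finsum T f F"
    using T.decomposition[OF x] by blast
  show "\<exists>!f. (\<forall>n. f n \<in> H n) \<and> finite {n. f n \<noteq> \<zero>} \<and> x = (\<Oplus>n\<in>{n. f n \<noteq> \<zero>}. f n)"
  proof (intro ex1I[of _ f] conjI)
    show "\<forall>n. f n \<in> H n" by (rule f)
    show "finite {n. f n \<noteq> \<zero>}" using f by (auto intro: finite_subset[of _ F])
    show "x = (\<Oplus>n\<in>{n. f n \<noteq> \<zero>}. f n)"
      using finsum_support[of F f] f T.homogeneous_carr by auto
    fix g assume g: "(\<forall>n. g n \<in> H n) \<and> finite {n. g n \<noteq> \<zero>} \<and> x = (\<Oplus>n\<in>{n. g n \<noteq> \<zero>}. g n)"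
    have gc: "g n \<in> carrier T" for n using g T.homogeneous_carr by blast
    have "h x = h (finsum T g {n. g n \<noteq> \<zero>})" using g by metis
    also have "\<dots> = finsum A (\<lambda>n. h (g n)) {n. g n \<noteq> \<zero>}"
      using g gc by (intro hom_finsum) blast+
    finally have hx: "h (finsum T f F) = finsum A (\<lambda>n. h (g n)) {n. g n \<noteq> \<zero>}"
      by (simp only: f(4))
    have "h (f n) = h (g n)" for n
      by (rule hom_decomposition[OF f(1-3) _ _ _ hx]) (use g degree hom_zero in auto)
    then have "f n = g n" for n
      using assms f(2) gc T.homogeneous_carr by (meson inj_onD)
    then show "g = f" by (simp add: fun_eq_iff)
  qed
qed

end

section \<open>Degrees in the free ring and the Toeplitz ring\<close>

context R_system
begin

abbreviation "word_degree w \<equiv> sum_list (map gen_degree w)"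

lemma pregraded_free_gens:
  "pregraded_rng free_gens (\<lambda>n. {x \<in> carrier free_gens. \<forall>w\<in>Poly_Mapping.keys x. word_degree w = n})"
    (is "pregraded_rng _ ?H")
proof -
  interpret F: rng free_gens by (rule rng_free_rng)
  show ?thesis
  proof (rule pregraded_rng.intro[OF F.rng_axioms], rule pregraded_rng_axioms.intro)
    have zero_H: "0 \<in> ?H n" for n by (simp add: free_rng_def)
    have neg: "- x \<in> ?H n" if "x \<in> ?H n" for x n
      using that by (simp add: free_rng_def)
    show sub: "additive_subgroup (?H n) free_gens" for n
    proof (intro additive_subgroupI subgroup.intro)
      show "inv\<^bsub>add_monoid free_gens\<^esub> x \<in> ?H n" if "x \<in> ?H n" for x
        using neg[OF that] minus_free_rng[of x] that by (simp add: a_inv_def)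
      show "x \<otimes>\<^bsub>add_monoid free_gens\<^esub> y \<in> ?H n" if "x \<in> ?H n" "y \<in> ?H n" for x y
        using that keys_add[of x y] add_in_F by (auto simp: free_rng_ops)
    qed (auto simp: free_rng_def)
    show "x \<otimes>\<^bsub>free_gens\<^esub> y \<in> ?H (n + m)" if "x \<in> ?H n" "y \<in> ?H m" for x y n m
      using that keys_word_mult[of x y] F.m_closed[of x y] by (fastforce simp: free_rng_ops)
    fix x assume "x \<in> carrier free_gens"
    then show "\<exists>f F. finite F \<and> (\<forall>n. f n \<in> ?H n) \<and> (\<forall>n. n \<notin> F \<longrightarrow> f n = \<zero>\<^bsub>free_gens\<^esub>)
      \<and> x = finsum free_gens f F"
    proof (induction x rule: free_rng_word_induct)
      case zero
      show ?case
        by (rule exI[of _ "\<lambda>_. 0"], rule exI[of _ "{}"]) (use zero_H in \<open>simp add: free_rng_ops\<close>)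
    next
      case (word w)
      let ?f = "\<lambda>n. if n = word_degree w then frag_of w else 0"
      have w: "frag_of w \<in> carrier free_gens" using word by (auto simp: word_in_F)
      have "frag_of w = finsum free_gens ?f {word_degree w}"
        using w F.zero_closed by (subst F.finsum_insert) (auto simp: free_rng_ops)
      moreover have "\<forall>n. ?f n \<in> ?H n" using w zero_H by auto
      moreover have "\<forall>n. n \<notin> {word_degree w} \<longrightarrow> ?f n = \<zero>\<^bsub>free_gens\<^esub>" by (simp add: free_rng_ops)
      moreover have "finite {word_degree w}" by simp
      ultimately show ?case by (intro exI[of _ ?f] exI[of _ "{word_degree w}"] conjI)
    next
      case (diff x y)
      have "x - y = x \<ominus>\<^bsub>free_gens\<^esub> y"
        using diff by (simp add: F.minus_eq minus_free_rng free_rng_ops)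
      then show ?case using F.decomposition_minus[OF sub diff(3,4)] by (simp only:)
    qed
  qed
qed

lemma coset_homomorphism: "rng_homomorphism free_gens toep (toeplitz_coset R P Q \<psi>)"
  by (intro rng_homomorphism.intro rng_homomorphism_axioms.intro rng_toeplitz coset_hom rng_free_rng)

lemma coset_zero: "toeplitz_coset R P Q \<psi> 0 = \<zero>\<^bsub>toep\<^esub>"
  using rng_homomorphism.hom_zero[OF coset_homomorphism] by (simp add: free_rng_ops)

lemma coset_minus:
  "x \<in> carrier free_gens \<Longrightarrow> y \<in> carrier free_gens \<Longrightarrow>
    toeplitz_coset R P Q \<psi> (x - y) = toeplitz_coset R P Q \<psi> x \<ominus>\<^bsub>toep\<^esub> toeplitz_coset R P Q \<psi> y"
  by (rule free_rng_hom_diff(1)[OF rng_toeplitz rng_homomorphism.add_hom[OF coset_homomorphism]])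

lemma pregraded_toeplitz: "pregraded_rng toep (toeplitz_grading R P Q \<psi>)"
proof -
  interpret pregraded_rng free_gens "\<lambda>n. {x \<in> carrier free_gens. \<forall>w\<in>Poly_Mapping.keys x. word_degree w = n}"
    by (rule pregraded_free_gens)
  from pregraded_image[OF coset_homomorphism] show ?thesis
    by (simp add: carrier_toeplitz toeplitz_grading_def[abs_def])
qed

end

section \<open>Bimodules inside a ring\<close>

text \<open>\<open>B\<close> is any record with the addition and zero of the ambient group, so that
  restricted rings and \<open>ring_bimodule\<close> are both covered.\<close>

lemma (in abelian_group) subgroup_abelian_group:
  assumes "additive_subgroup X G" "carrier B = X" "add B = add G" "ring.zero B = \<zero>"
  shows "abelian_group B"
proof -
  interpret additive_subgroup X G by fact
  show ?thesis
  proof (rule abelian_groupI)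
    fix x assume "x \<in> carrier B"
    then have "\<ominus> x \<in> X" "\<ominus> x \<oplus> x = \<zero>"
      using subgroup_minus_closed[OF assms(1) zero_closed, of x] assms(2)
      by (simp_all add: minus_eq l_neg)
    then show "\<exists>y\<in>carrier B. y \<oplus>\<^bsub>B\<^esub> x = \<zero>\<^bsub>B\<^esub>" using assms by auto
  qed (use assms in \<open>simp_all add: a_ac\<close>)
qed

lemma (in rng) subrng_rng:
  assumes "subrng S R"
  shows "rng (R\<lparr>carrier := S\<rparr>)"
proof -
  interpret subrng S R by fact
  show ?thesis
    by (intro rng.intro rng_axioms.intro subgroup_abelian_group[OF additive_subgroup_axioms])
      (simp_all add: sub_m_closed m_assoc l_distr r_distr)
qed

lemma ring_bimodule_simps [simp]:
  "carrier (ring_bimodule A X) = X" "add (ring_bimodule A X) = add A"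
  "ring.zero (ring_bimodule A X) = ring.zero A"
  "lact (ring_bimodule A X) = monoid.mult A" "ract (ring_bimodule A X) = monoid.mult A"
  by (simp_all add: ring_bimodule_def)

lemma (in rng) ring_bimodule_bimodule:
  assumes "subrng S R" "additive_subgroup X R"
    and "\<And>s x. \<lbrakk>s \<in> S; x \<in> X\<rbrakk> \<Longrightarrow> s \<otimes> x \<in> X" "\<And>s x. \<lbrakk>s \<in> S; x \<in> X\<rbrakk> \<Longrightarrow> x \<otimes> s \<in> X"
  shows "bimodule (R\<lparr>carrier := S\<rparr>) (ring_bimodule R X)"
proof -
  interpret S: subrng S R by fact
  interpret X: additive_subgroup X R by fact
  show ?thesis
    by (intro bimodule.intro bimodule_axioms.intro subrng_rng subgroup_abelian_group[OF assms(2)])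
      (simp_all add: ring_bimodule_def assms m_assoc l_distr r_distr)
qed

text \<open>The cosets making up the tensor product are unions over representatives, so the lifted map is
  read off from any representative.\<close>

lemma tensor_lift:
  assumes "bimodule R P" "bimodule R Q" "bimodule R M"
    and closed: "\<And>p q. \<lbrakk>p \<in> carrier P; q \<in> carrier Q\<rbrakk> \<Longrightarrow> f p q \<in> carrier M"
    and add_left: "\<And>p p' q. \<lbrakk>p \<in> carrier P; p' \<in> carrier P; q \<in> carrier Q\<rbrakk> \<Longrightarrow>
      f (p \<oplus>\<^bsub>P\<^esub> p') q = f p q \<oplus>\<^bsub>M\<^esub> f p' q"
    and add_right: "\<And>p q q'. \<lbrakk>p \<in> carrier P; q \<in> carrier Q; q' \<in> carrier Q\<rbrakk> \<Longrightarrow>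
      f p (q \<oplus>\<^bsub>Q\<^esub> q') = f p q \<oplus>\<^bsub>M\<^esub> f p q'"
    and balanced: "\<And>p r q. \<lbrakk>p \<in> carrier P; r \<in> carrier R; q \<in> carrier Q\<rbrakk> \<Longrightarrow>
      f (ract P p r) q = f p (lact Q r q)"
    and left: "\<And>p r q. \<lbrakk>p \<in> carrier P; r \<in> carrier R; q \<in> carrier Q\<rbrakk> \<Longrightarrow>
      f (lact P r p) q = lact M r (f p q)"
    and right: "\<And>p r q. \<lbrakk>p \<in> carrier P; r \<in> carrier R; q \<in> carrier Q\<rbrakk> \<Longrightarrow>
      f p (ract Q q r) = ract M (f p q) r"
  obtains \<psi> where "\<psi> \<in> bimodule_hom R (tensor R P Q) M"
    and "\<And>p q. \<lbrakk>p \<in> carrier P; q \<in> carrier Q\<rbrakk> \<Longrightarrow> \<psi> (tens R P Q p q) = f p q"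
proof -
  interpret P: bimodule R P by fact
  interpret Q: bimodule R Q by fact
  interpret M: bimodule R M by fact
  let ?B = "carrier P \<times> carrier Q"
  define F where "F = free_Abelian_group ?B"
  define N where "N = tensor_sub R P Q"
  interpret F: comm_group F unfolding F_def by (rule abelian_free_Abelian_group)
  have F_ops: "x \<otimes>\<^bsub>F\<^esub> y = x + y" "\<one>\<^bsub>F\<^esub> = 0" for x y by (simp_all add: F_def)
  have F_iff: "x \<in> carrier F \<longleftrightarrow> Poly_Mapping.keys x \<subseteq> ?B" for x
    by (simp add: F_def carrier_free_Abelian_group_iff)
  have F_minus: "x - y \<in> carrier F" if "x \<in> carrier F" "y \<in> carrier F" for x y
    using that keys_diff[of x y] by (auto simp: F_iff)
  have F_of: "frag_of (p, q) \<in> carrier F" if "p \<in> carrier P" "q \<in> carrier Q" for p q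
    using that by (simp add: F_iff)
  have img: "case_prod f ` ?B \<subseteq> carrier (add_monoid M)" using closed by auto
  obtain h where h: "h \<in> hom F (add_monoid M)"
    and h_of: "\<And>x. x \<in> ?B \<Longrightarrow> h (frag_of x) = case_prod f x"
    unfolding F_def by (rule comm_group.free_Abelian_group_universal[OF M.M.a_comm_group img]) blast
  interpret h: group_hom F "add_monoid M" h
    by (intro group_hom.intro group_hom_axioms.intro h F.group_axioms M.M.a_group)
  have h_carr: "h x \<in> carrier M" if "x \<in> carrier F" for x using h.hom_closed[OF that] by simp
  have h_add: "h (x + y) = h x \<oplus>\<^bsub>M\<^esub> h y" if "x \<in> carrier F" "y \<in> carrier F" for x y
    using h.hom_mult[OF that] by (simp add: F_ops)
  have h_zero: "h 0 = \<zero>\<^bsub>M\<^esub>" using h.hom_one by (simp add: F_ops)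
  have h_diff: "h (x - y) = h x \<ominus>\<^bsub>M\<^esub> h y" if "x \<in> carrier F" "y \<in> carrier F" for x y
  proof -
    have "h x = h (x - y) \<oplus>\<^bsub>M\<^esub> h y" using h_add[of "x - y" y] that F_minus by simp
    then show ?thesis using that F_minus h_carr
      by (simp add: M.M.minus_eq M.M.a_assoc M.M.r_neg)
  qed
  have rels: "tensor_rels R P Q \<subseteq> kernel F (add_monoid M) h"
  proof -
    have cancel: "x \<oplus>\<^bsub>M\<^esub> y \<ominus>\<^bsub>M\<^esub> x \<ominus>\<^bsub>M\<^esub> y = \<zero>\<^bsub>M\<^esub>" if "x \<in> carrier M" "y \<in> carrier M" for x y
    proof -
      have "x \<oplus>\<^bsub>M\<^esub> y \<ominus>\<^bsub>M\<^esub> x \<ominus>\<^bsub>M\<^esub> y = (x \<oplus>\<^bsub>M\<^esub> y) \<ominus>\<^bsub>M\<^esub> (x \<oplus>\<^bsub>M\<^esub> y)"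
        using that by (simp add: M.M.minus_eq M.M.minus_add M.M.a_assoc)
      then show ?thesis using that by (simp add: M.M.minus_eq M.M.r_neg)
    qed
    show ?thesis
      unfolding tensor_rels_def kernel_def
      by (auto simp: F_of F_minus h_diff h_of add_left add_right balanced closed cancel
          P.ract_closed Q.lact_closed M.M.minus_eq[of "f _ (lact Q _ _)"] M.M.r_neg)
  qed
  have rels_carr: "tensor_rels R P Q \<subseteq> carrier F" using rels by (auto simp: kernel_def)
  have N: "subgroup N F" unfolding N_def tensor_sub_def F_def[symmetric]
    by (rule F.generate_is_subgroup[OF rels_carr])
  have N_ker: "N \<subseteq> kernel F (add_monoid M) h" unfolding N_def tensor_sub_def F_def[symmetric]
    by (rule F.generate_subgroup_incl[OF rels h.subgroup_kernel])
  have normal: "N \<lhd> F" using N F.normal_iff_subgroup by blast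
  have coset: "tensor_coset R P Q x = N #>\<^bsub>F\<^esub> x" for x
    by (simp add: tensor_coset_def N_def F_def)
  have coset_h: "h y = h x" if x: "x \<in> carrier F" and y: "y \<in> N #>\<^bsub>F\<^esub> x" for x y
  proof -
    obtain n where n: "n \<in> N" "y = n + x" using y by (auto simp: r_coset_def F_ops)
    then have "n \<in> carrier F" "h n = \<zero>\<^bsub>M\<^esub>" using N_ker by (auto simp: kernel_def)
    then show ?thesis using n(2) h_add x h_carr by simp
  qed
  have coset_self: "x \<in> N #>\<^bsub>F\<^esub> x" if "x \<in> carrier F" for x by (rule F.rcos_self[OF that N])
  have coset_carr: "y \<in> carrier F" if "x \<in> carrier F" "y \<in> N #>\<^bsub>F\<^esub> x" for x y
    using that F.r_coset_subset_G[OF subgroup.subset[OF N]] by blast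
  define \<psi> where "\<psi> X = the_elem (h ` X)" for X
  have \<psi>_const: "\<psi> X = c" if "X \<noteq> {}" "\<And>y. y \<in> X \<Longrightarrow> h y = c" for X c
  proof -
    have "h ` X = {c}" using that by blast
    then show ?thesis by (simp add: \<psi>_def)
  qed
  have \<psi>: "\<psi> (N #>\<^bsub>F\<^esub> x) = h x" if "x \<in> carrier F" for x
  proof (rule \<psi>_const)
    show "N #>\<^bsub>F\<^esub> x \<noteq> {}" using coset_self[OF that] by blast
  qed (rule coset_h[OF that])
  have carr: "carrier (tensor R P Q) = (\<lambda>x. N #>\<^bsub>F\<^esub> x) ` carrier F"
    by (auto simp: tensor_def Let_def FactGroup_def RCOSETS_def N_def F_def)
  have add: "(N #>\<^bsub>F\<^esub> x) \<oplus>\<^bsub>tensor R P Q\<^esub> (N #>\<^bsub>F\<^esub> y) = N #>\<^bsub>F\<^esub> (x + y)"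
    if "x \<in> carrier F" "y \<in> carrier F" for x y
    using normal.rcos_sum[OF normal that] by (simp add: tensor_def Let_def FactGroup_def flip: N_def F_def) (simp add: F_ops)
  \<comment> \<open>One statement serves both actions on the tensor product: \<open>a\<close> and
    \<open>b\<close> act on the two factors, one of them as the identity, and \<open>k\<close> is
    the corresponding action on \<open>M\<close>.\<close>
  have ext: "frag_extend (\<lambda>(p, q). frag_of (a p, b q)) x \<in> carrier F
      \<and> h (frag_extend (\<lambda>(p, q). frag_of (a p, b q)) x) = k (h x)"
    if x: "x \<in> carrier F" and ab: "\<And>p. p \<in> carrier P \<Longrightarrow> a p \<in> carrier P" "\<And>q. q \<in> carrier Q \<Longrightarrow> b q \<in> carrier Q"
      and k: "k \<in> hom (add_monoid M) (add_monoid M)"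
      and fk: "\<And>p q. \<lbrakk>p \<in> carrier P; q \<in> carrier Q\<rbrakk> \<Longrightarrow> f (a p) (b q) = k (f p q)"
    for x a b k
  proof -
    note K = hom_zero_minus[OF M.M.abelian_group_axioms M.M.abelian_group_axioms k]
    have k_diff: "k (u \<ominus>\<^bsub>M\<^esub> v) = k u \<ominus>\<^bsub>M\<^esub> k v" if "u \<in> carrier M" "v \<in> carrier M" for u v
      using that K by (simp add: M.M.minus_eq)
    have "Poly_Mapping.keys x \<subseteq> ?B" using x by (simp add: F_iff)
    \<comment> \<open>Membership of \<open>x\<close> is carried through the induction because the
      case of differences uses it for \<open>h_diff\<close>.\<close>
    then have "x \<in> carrier F \<and> frag_extend (\<lambda>(p, q). frag_of (a p, b q)) x \<in> carrier F
      \<and> h (frag_extend (\<lambda>(p, q). frag_of (a p, b q)) x) = k (h x)"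
    proof (induction x rule: frag_induction)
      case zero
      then show ?case by (simp add: h_zero K F_iff)
    next
      case (one x)
      then show ?case using ab by (auto simp: F_of h_of fk)
    next
      case (diff x y)
      then show ?case by (simp add: frag_extend_diff F_minus h_diff k_diff h_carr)
    qed
    then show ?thesis by blast
  qed
  show thesis
  proof
    show "\<psi> (tens R P Q p q) = f p q" if "p \<in> carrier P" "q \<in> carrier Q" for p q
      using \<psi>[OF F_of[OF that]] h_of that by (simp add: tens_def coset)
    have "\<psi> \<in> hom (add_monoid (tensor R P Q)) (add_monoid M)"
    proof (rule homI)
      fix X Y assume "X \<in> carrier (add_monoid (tensor R P Q))" "Y \<in> carrier (add_monoid (tensor R P Q))"
      then obtain x y where xy: "x \<in> carrier F" "y \<in> carrier F" "X = N #>\<^bsub>F\<^esub> x" "Y = N #>\<^bsub>F\<^esub> y"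
        unfolding partial_object.simps carr by auto
      have "x + y \<in> carrier F" using F.m_closed[OF xy(1,2)] by (simp add: F_ops)
      with xy show "\<psi> (X \<otimes>\<^bsub>add_monoid (tensor R P Q)\<^esub> Y) = \<psi> X \<otimes>\<^bsub>add_monoid M\<^esub> \<psi> Y"
        by (simp add: add \<psi> h_add)
    qed (auto simp: carr \<psi> h_carr)
    moreover have "\<psi> (lact (tensor R P Q) r X) = lact M r (\<psi> X) \<and> \<psi> (ract (tensor R P Q) X r) = ract M (\<psi> X) r"
      if r: "r \<in> carrier R" and X: "X \<in> carrier (tensor R P Q)" for r X
    proof -
      obtain x where x: "x \<in> carrier F" "X = N #>\<^bsub>F\<^esub> x" using X carr by auto
      have l: "lact M r \<in> hom (add_monoid M) (add_monoid M)"
        using r by (auto simp: hom_def M.lact_closed M.lact_add)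
      have rr: "(\<lambda>y. ract M y r) \<in> hom (add_monoid M) (add_monoid M)"
        using r by (auto simp: hom_def M.ract_closed M.ract_add)
      let ?l = "frag_extend (\<lambda>(p, q). frag_of (lact P r p, q))"
        and ?r = "frag_extend (\<lambda>(p, q). frag_of (p, ract Q q r))"
      have lx: "?l y \<in> carrier F" "h (?l y) = lact M r (h y)" if "y \<in> carrier F" for y
        using ext[OF that, of "lact P r" "\<lambda>q. q", OF _ _ l] r by (simp_all add: P.lact_closed left)
      have rx: "?r y \<in> carrier F" "h (?r y) = ract M (h y) r" if "y \<in> carrier F" for y
        using ext[OF that, of "\<lambda>p. p" "\<lambda>q. ract Q q r", OF _ _ rr] r by (simp_all add: Q.ract_closed right)
      \<comment> \<open>The action is a union of cosets over all representatives; \<open>h\<close>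
        takes one value on the whole union, so it is enough that the union is nonempty.\<close>
      have "\<psi> (\<Union>y\<in>X. N #>\<^bsub>F\<^esub> ?l y) = lact M r (h x)"
      proof (rule \<psi>_const)
        show "(\<Union>y\<in>X. N #>\<^bsub>F\<^esub> ?l y) \<noteq> {}"
          using coset_self[OF lx(1)[OF x(1)]] coset_self[OF x(1)] x(2) by blast
        fix z assume "z \<in> (\<Union>y\<in>X. N #>\<^bsub>F\<^esub> ?l y)"
        then obtain y where y: "y \<in> N #>\<^bsub>F\<^esub> x" "z \<in> N #>\<^bsub>F\<^esub> ?l y" using x(2) by blast
        have "y \<in> carrier F" using coset_carr x(1) y(1) .
        then show "h z = lact M r (h x)" using coset_h[OF lx(1) y(2)] lx(2) coset_h[OF x(1) y(1)] by simp
      qed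
      moreover have "\<psi> (\<Union>y\<in>X. N #>\<^bsub>F\<^esub> ?r y) = ract M (h x) r"
      proof (rule \<psi>_const)
        show "(\<Union>y\<in>X. N #>\<^bsub>F\<^esub> ?r y) \<noteq> {}"
          using coset_self[OF rx(1)[OF x(1)]] coset_self[OF x(1)] x(2) by blast
        fix z assume "z \<in> (\<Union>y\<in>X. N #>\<^bsub>F\<^esub> ?r y)"
        then obtain y where y: "y \<in> N #>\<^bsub>F\<^esub> x" "z \<in> N #>\<^bsub>F\<^esub> ?r y" using x(2) by blast
        have "y \<in> carrier F" using coset_carr x(1) y(1) .
        then show "h z = ract M (h x) r" using coset_h[OF rx(1) y(2)] rx(2) coset_h[OF x(1) y(1)] by simp
      qed
      ultimately show ?thesis
        using \<psi>[OF x(1)] x(2) by (simp add: tensor_def Let_def coset)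
    qed
    ultimately show "\<psi> \<in> bimodule_hom R (tensor R P Q) M" by (simp add: bimodule_hom_def)
  qed
qed

section \<open>The Cuntz-Pimsner ring\<close>

locale graded_system = A: graded_rng A G for A (structure) and G +
  fixes R I J
  assumes R: "subrng R A" and R_degree: "R \<subseteq> G 0"
    and I: "additive_subgroup I A" and I_degree: "I \<subseteq> G 1"
    and J: "additive_subgroup J A" and J_degree: "J \<subseteq> G (- 1)"
    and RI: "\<lbrakk>r \<in> R; i \<in> I\<rbrakk> \<Longrightarrow> r \<otimes> i \<in> I" and IR: "\<lbrakk>i \<in> I; r \<in> R\<rbrakk> \<Longrightarrow> i \<otimes> r \<in> I"
    and RJ: "\<lbrakk>r \<in> R; j \<in> J\<rbrakk> \<Longrightarrow> r \<otimes> j \<in> J" and JR: "\<lbrakk>j \<in> J; r \<in> R\<rbrakk> \<Longrightarrow> j \<otimes> r \<in> J"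
    and JI: "\<lbrakk>j \<in> J; i \<in> I\<rbrakk> \<Longrightarrow> j \<otimes> i \<in> R"
    and I_units: "\<lbrakk>finite X; X \<subseteq> I\<rbrakk> \<Longrightarrow> \<exists>a\<in>subgroup_prod A I J. \<forall>i\<in>X. a \<otimes> i = i"
    and J_units: "\<lbrakk>finite Y; Y \<subseteq> J\<rbrakk> \<Longrightarrow> \<exists>b\<in>subgroup_prod A I J. \<forall>j\<in>Y. j \<otimes> b = j"
    and perp_in_R: "\<lbrakk>r \<in> perp (A\<lparr>carrier := R\<rparr>) (annih A R I); a \<in> subgroup_prod A I J;
           r \<ominus> a \<in> annih A (G 0) I\<rbrakk> \<Longrightarrow> a \<in> R"
    and annih_perp: "annih A R I \<inter> perp (A\<lparr>carrier := R\<rparr>) (annih A R I) = {\<zero>}"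
begin

sublocale R: subrng R A by (rule R)

sublocale base: covariant_image A A "\<lambda>x. x" I J R
proof (intro covariant_image.intro rng_homomorphism.intro rng_homomorphism_axioms.intro
    covariant_image_axioms.intro A.rng_axioms)
  show "(\<lambda>x. x) \<in> rng_hom A A" by (simp add: rng_hom_def hom_def)
qed (simp_all add: I J R.additive_subgroup_axioms R.sub_m_closed RI IR RJ JR JI I_units J_units)

section \<open>The span of \<open>I\<close> times \<open>J\<close> inside \<open>A\<close>\<close>

abbreviation "AR \<equiv> A\<lparr>carrier := R\<rparr>"
abbreviation "JA \<equiv> ring_bimodule A J"
abbreviation "IA \<equiv> ring_bimodule A I"
abbreviation "IJ \<equiv> subgroup_prod A I J"

lemma bimodules: "bimodule AR JA" "bimodule AR IA" "bimodule AR (ring_bimodule A R)"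
  by (intro A.ring_bimodule_bimodule; simp add: R I J R.additive_subgroup_axioms R.sub_m_closed RI IR RJ JR)+

text \<open>Negatives are absorbed into the first factor,
  \<open>\<ominus> (i \<otimes> j) = (\<ominus> i) \<otimes> j\<close>, and zero is
  \<open>\<zero> \<otimes> \<zero>\<close>, so sums of products exhaust \<open>IJ\<close>.\<close>

lemma IJ_induct [consumes 1, case_names prod add]:
  assumes "a \<in> IJ" and prod: "\<And>i j. \<lbrakk>i \<in> I; j \<in> J\<rbrakk> \<Longrightarrow> P (i \<otimes> j)"
    and add: "\<And>a b. \<lbrakk>a \<in> IJ; b \<in> IJ; P a; P b\<rbrakk> \<Longrightarrow> P (a \<oplus> b)"
  shows "P a"
  using assms(1)[unfolded subgroup_prod_def]
proof (induction rule: generate.induct)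
  case one
  have "P (\<zero> \<otimes> \<zero>)" by (intro prod base.zero_mem)
  then show ?case by simp
next
  case (inv s)
  then obtain i j where s: "s = i \<otimes> j" "i \<in> I" "j \<in> J" by blast
  have "\<ominus> i \<in> I" using A.subgroup_minus_closed[OF I base.zero_mem(1) s(2)] s(2) by (simp add: A.minus_eq)
  moreover have "\<ominus> s = (\<ominus> i) \<otimes> j"
    using s A.minus_distr(1)[of \<zero> i j] by (simp add: A.minus_eq)
  ultimately show ?case using prod s(3) by (simp flip: a_inv_def)
next
  case (eng a b)
  then show ?case using add[of a b] by (simp add: subgroup_prod_def)
qed (use prod in blast)

lemma IJ_degree: "IJ \<subseteq> G 0"
proof
  fix a assume "a \<in> IJ"
  then show "a \<in> G 0"
  proof (induction rule: IJ_induct)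
    case (prod i j)
    then have "i \<otimes> j \<in> G (1 + - 1)" using I_degree J_degree by (intro A.homogeneous_mult) auto
    then show ?case by simp
  next
    case (add a b)
    then show ?case using A.homogeneous_subgroup additive_subgroup.a_closed by fastforce
  qed
qed

lemma IJ_IJ: "a \<in> IJ \<Longrightarrow> b \<in> IJ \<Longrightarrow> a \<otimes> b \<in> IJ"
  by (rule base.T_XY) (simp_all add: base.XY_X)

lemma R_IJ: "r \<in> R \<Longrightarrow> a \<in> IJ \<Longrightarrow> r \<otimes> a \<in> IJ"
  by (rule base.T_XY) (simp_all add: RI)

lemma J_IJ: "j \<in> J \<Longrightarrow> a \<in> IJ \<Longrightarrow> j \<otimes> a \<in> J"
  by (rotate_tac, induction a rule: IJ_induct)
    (simp_all add: RJ JI A.r_distr additive_subgroup.a_closed[OF J] flip: A.m_assoc)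

text \<open>For \<open>k\<close> annihilating \<open>I\<close>, the products
  \<open>a \<otimes> k\<close> and \<open>k \<otimes> a\<close> lie in \<open>IJ\<close> and
  annihilate \<open>I\<close>, the second because \<open>a\<close> maps \<open>I\<close> into
  itself. The faithful action of \<open>IJ\<close> on \<open>I\<close> makes them zero.\<close>

lemma in_perp:
  assumes "a \<in> R" "a \<in> IJ"
  shows "a \<in> perp AR (annih A R I)"
proof -
  have "a \<otimes> k = \<zero>" "k \<otimes> a = \<zero>" if k: "k \<in> R" "\<forall>i\<in>I. k \<otimes> i = \<zero>" for k
  proof -
    show "a \<otimes> k = \<zero>"
      by (rule base.XY_annihilator) (use assms k in \<open>simp_all add: A.m_assoc base.XY_Z\<close>)
    show "k \<otimes> a = \<zero>"
      by (rule base.XY_annihilator) (use assms k in \<open>simp_all add: A.m_assoc base.XY_X R_IJ\<close>)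
  qed
  then show ?thesis using assms by (simp add: perp_def annih_def)
qed

lemma mult_psi_exists:
  "\<exists>\<psi>. \<psi> \<in> bimodule_hom AR (tensor AR JA IA) (ring_bimodule A R)
    \<and> (\<forall>j\<in>J. \<forall>i\<in>I. \<psi> (tens AR JA IA j i) = j \<otimes> i)"
proof (rule tensor_lift[OF bimodules, of "\<lambda>j i. j \<otimes> i"])
  fix \<psi> assume "\<psi> \<in> bimodule_hom AR (tensor AR JA IA) (ring_bimodule A R)"
    and "\<And>p q. \<lbrakk>p \<in> carrier JA; q \<in> carrier IA\<rbrakk> \<Longrightarrow> \<psi> (tens AR JA IA p q) = p \<otimes> q"
  then show ?thesis by auto
qed (simp_all add: JI A.l_distr A.r_distr A.m_assoc)

end

locale mult_system = graded_system A G R I J for A (structure) and G and R I J +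
  fixes \<psi>
  assumes psi: "\<psi> \<in> bimodule_hom (A\<lparr>carrier := R\<rparr>) (tensor (A\<lparr>carrier := R\<rparr>) (ring_bimodule A J) (ring_bimodule A I))
      (ring_bimodule A R)"
    and psi_tens: "\<lbrakk>j \<in> J; i \<in> I\<rbrakk> \<Longrightarrow>
      \<psi> (tens (A\<lparr>carrier := R\<rparr>) (ring_bimodule A J) (ring_bimodule A I) j i) = j \<otimes> i"
begin

lemma system: "R_system AR JA IA \<psi>"
  using bimodules psi by (simp add: R_system_def R_system_axioms_def ring_bimodule_def)

sublocale sys: R_system AR JA IA \<psi> by (rule system)

abbreviation "toep \<equiv> toeplitz AR JA IA \<psi>"
abbreviation "iR \<equiv> iota_R AR JA IA \<psi>"
abbreviation "iI \<equiv> iota_Q AR JA IA \<psi>"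
abbreviation "iJ \<equiv> iota_P AR JA IA \<psi>"
abbreviation "FI \<equiv> finite_rank_Q AR JA IA \<psi>"
abbreviation "FJ \<equiv> finite_rank_P AR JA IA \<psi>"

section \<open>Finite rank operators as multiplications by elements of \<open>IJ\<close>\<close>

definition left_mult where "left_mult a = (\<lambda>x\<in>I. a \<otimes> x)"
definition right_mult where "right_mult a = (\<lambda>y\<in>J. y \<otimes> a)"

text \<open>By associativity
  \<open>q \<otimes> (p \<otimes> x) = (q \<otimes> p) \<otimes> x\<close>, so the operator depends
  only on the product \<open>q \<otimes> p\<close>.\<close>

lemma theta_left: "q \<in> I \<Longrightarrow> p \<in> J \<Longrightarrow> theta_Q AR JA IA \<psi> q p = left_mult (q \<otimes> p)"
  unfolding theta_Q_def left_mult_def by (auto intro!: restrict_ext simp: psi_tens A.m_assoc)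

lemma theta_right: "q \<in> I \<Longrightarrow> p \<in> J \<Longrightarrow> theta_P AR JA IA \<psi> p q = right_mult (q \<otimes> p)"
  unfolding theta_P_def right_mult_def by (auto intro!: restrict_ext simp: psi_tens A.m_assoc)

lemma End_ops:
  "monoid.mult (right_End AR IA) f g = compose I f g"
  "f \<oplus>\<^bsub>right_End AR IA\<^esub> g = (\<lambda>x\<in>I. f x \<oplus> g x)" "f' \<oplus>\<^bsub>left_End AR JA\<^esub> g' = (\<lambda>x\<in>J. f' x \<oplus> g' x)"
  "\<zero>\<^bsub>right_End AR IA\<^esub> = (\<lambda>x\<in>I. \<zero>)"
  by (simp_all add: right_End_def left_End_def)

lemma left_mult_zero: "left_mult \<zero> = \<zero>\<^bsub>right_End AR IA\<^esub>"
  unfolding End_ops left_mult_def by (rule restrict_ext) simp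

lemma left_mult_add:
  "a \<in> carrier A \<Longrightarrow> b \<in> carrier A \<Longrightarrow> left_mult (a \<oplus> b) = left_mult a \<oplus>\<^bsub>right_End AR IA\<^esub> left_mult b"
  unfolding End_ops left_mult_def by (rule restrict_ext) (simp add: A.l_distr)

lemma right_mult_add:
  "a \<in> carrier A \<Longrightarrow> b \<in> carrier A \<Longrightarrow> right_mult (a \<oplus> b) = right_mult a \<oplus>\<^bsub>left_End AR JA\<^esub> right_mult b"
  unfolding End_ops right_mult_def by (rule restrict_ext) (simp add: A.r_distr)

text \<open>The second factor is taken in \<open>IJ\<close> so that it maps \<open>I\<close> into
  \<open>I\<close>, outside of which \<open>left_mult a\<close> is undefined.\<close>

lemma left_mult_mult:
  "a \<in> carrier A \<Longrightarrow> b \<in> IJ \<Longrightarrow> left_mult (a \<otimes> b) = left_mult a \<otimes>\<^bsub>right_End AR IA\<^esub> left_mult b"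
  unfolding End_ops left_mult_def compose_def by (rule restrict_ext) (simp add: A.m_assoc base.XY_X)

lemma right_mult_FJ: "a \<in> IJ \<Longrightarrow> right_mult a \<in> FJ"
  unfolding finite_rank_P_def
proof (induction rule: IJ_induct)
  case (prod i j)
  then show ?case by (intro generate.incl) (auto simp flip: theta_right)
next
  case (add a b)
  then show ?case using generate.eng[OF add(3,4)] by (simp add: right_mult_add)
qed

lemma left_mult_generate: "a \<in> IJ \<Longrightarrow> left_mult a \<in> FI"
  unfolding finite_rank_Q_def
proof (induction rule: IJ_induct)
  case (prod i j)
  then show ?case by (intro generate.incl) (auto simp flip: theta_left)
next
  case (add a b)
  then show ?case using generate.eng[OF add(3,4)] by (simp add: left_mult_add)
qed

lemma left_mult_End: "a \<in> IJ \<Longrightarrow> left_mult a \<in> carrier (right_End AR IA)"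
  by (auto simp: right_End_def left_mult_def hom_def base.XY_X A.r_distr A.m_assoc
      additive_subgroup.a_closed[OF I] IR)

lemma IJ_neg: "a \<in> IJ \<Longrightarrow> \<ominus> a \<in> IJ"
  using A.subgroup_minus_closed[OF base.XY_additive base.zero_mem(4), of a] by (simp add: A.minus_eq)

text \<open>\<open>m_inv\<close> is a definite description over all endomorphisms. Any inverse
  \<open>f\<close> satisfies \<open>f x \<oplus> a \<otimes> x = \<zero>\<close> for
  \<open>x\<close> in \<open>I\<close>, which forces its values there, and extensionality fixes it
  elsewhere.\<close>

lemma left_mult_inv:
  assumes a: "a \<in> IJ"
  shows "inv\<^bsub>add_monoid (right_End AR IA)\<^esub> left_mult a = left_mult (\<ominus> a)"
proof -
  have e: "left_mult b \<oplus>\<^bsub>right_End AR IA\<^esub> left_mult c = \<zero>\<^bsub>right_End AR IA\<^esub>"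
    if "b \<in> IJ" "c \<in> IJ" "b \<oplus> c = \<zero>" for b c
    using that by (simp add: left_mult_zero flip: left_mult_add)
  show ?thesis
    unfolding m_inv_def
  proof (rule the_equality, intro conjI)
    show "left_mult (\<ominus> a) \<in> carrier (add_monoid (right_End AR IA))"
      using left_mult_End[OF IJ_neg[OF a]] by simp
    fix f assume f: "f \<in> carrier (add_monoid (right_End AR IA)) \<and>
      left_mult a \<otimes>\<^bsub>add_monoid (right_End AR IA)\<^esub> f = \<one>\<^bsub>add_monoid (right_End AR IA)\<^esub> \<and>
      f \<otimes>\<^bsub>add_monoid (right_End AR IA)\<^esub> left_mult a = \<one>\<^bsub>add_monoid (right_End AR IA)\<^esub>"
    then have fI: "f x \<in> I" if "x \<in> I" for x
      using that by (auto simp: right_End_def hom_def)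
    have f_ext: "f \<in> extensional I" using f by (auto simp: right_End_def)
    have "f x = (\<ominus> a) \<otimes> x" if x: "x \<in> I" for x
    proof -
      have "f \<oplus>\<^bsub>right_End AR IA\<^esub> left_mult a = \<zero>\<^bsub>right_End AR IA\<^esub>" using f by simp
      from fun_cong[OF this, of x] have "f x \<oplus> a \<otimes> x = \<zero>"
        using x by (simp add: End_ops left_mult_def)
      moreover have "(\<ominus> a) \<otimes> x \<oplus> a \<otimes> x = \<zero>"
        using a x by (simp add: A.l_neg flip: A.l_distr)
      ultimately show ?thesis
        using A.add.right_cancel[of "a \<otimes> x" "f x" "(\<ominus> a) \<otimes> x"] fI[OF x] a x by simp
    qed
    then show "f = left_mult (\<ominus> a)"
      using f_ext unfolding left_mult_def by (intro extensionalityI[of f I]) simp_all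
  qed (use e[of a "\<ominus> a"] e[of "\<ominus> a" a] a IJ_neg in \<open>simp_all add: A.l_neg A.r_neg\<close>)
qed

text \<open>The generators have the form \<open>left_mult (q \<otimes> p)\<close>, and
  \<open>left_mult\<close> carries zero, negatives and sums in \<open>IJ\<close> to those of the
  endomorphisms.\<close>

lemma FI_eq: "FI = left_mult ` IJ"
proof
  show "left_mult ` IJ \<subseteq> FI" using left_mult_generate by blast
  show "FI \<subseteq> left_mult ` IJ"
  proof
    fix f assume "f \<in> FI"
    then show "f \<in> left_mult ` IJ"
      unfolding finite_rank_Q_def
    proof (induction rule: generate.induct)
      case one
      have "\<one>\<^bsub>add_monoid (right_End AR IA)\<^esub> = left_mult \<zero>"
        by (simp add: left_mult_zero)
      then show ?case using base.zero_mem(4) by (rule image_eqI)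
    next
      case (incl f)
      then show ?case by (auto simp: theta_left A.subgroup_prod_incl)
    next
      case (inv f)
      then obtain q p where "f = left_mult (q \<otimes> p)" "q \<in> I" "p \<in> J" by (auto simp: theta_left)
      then show ?case using left_mult_inv IJ_neg A.subgroup_prod_incl by simp
    next
      case (eng f g)
      then obtain a b where ab: "f = left_mult a" "g = left_mult b" "a \<in> IJ" "b \<in> IJ" by blast
      then have "f \<otimes>\<^bsub>add_monoid (right_End AR IA)\<^esub> g = left_mult (a \<oplus> b)"
        by (simp add: left_mult_add)
      moreover have "a \<oplus> b \<in> IJ" using ab additive_subgroup.a_closed[OF base.XY_additive] by blast
      ultimately show ?case by (rule image_eqI)
    qed
  qed
qed

lemma FS: "condition_FS AR JA IA \<psi>"
  unfolding condition_FS_def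
proof (intro allI impI)
  fix X Y assume XY: "finite X \<and> X \<subseteq> carrier IA \<and> finite Y \<and> Y \<subseteq> carrier JA"
  obtain a where a: "a \<in> IJ" "\<forall>i\<in>X. a \<otimes> i = i" using I_units[of X] XY by auto
  obtain b where b: "b \<in> IJ" "\<forall>j\<in>Y. j \<otimes> b = j" using J_units[of Y] XY by auto
  have "\<forall>q\<in>X. left_mult a q = q" "\<forall>p\<in>Y. right_mult b p = p"
    using XY a b by (auto simp: left_mult_def right_mult_def)
  then show "\<exists>\<Theta>\<in>FI. \<exists>\<Phi>\<in>FJ. (\<forall>q\<in>X. \<Theta> q = q) \<and> (\<forall>p\<in>Y. \<Phi> p = p)"
    using left_mult_generate[OF a(1)] right_mult_FJ[OF b(1)] by blast
qed

section \<open>The uniquely maximal ideal\<close>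

lemma Delta_eq: "Delta IA r = left_mult r"
  by (simp add: Delta_def left_mult_def)

lemma left_mult_eq_iff: "left_mult a = left_mult b \<longleftrightarrow> (\<forall>i\<in>I. a \<otimes> i = b \<otimes> i)"
  by (auto simp: left_mult_def restrict_def fun_eq_iff)

lemma kernel_Delta: "a_kernel AR (right_End AR IA) (Delta IA) = annih A R I"
  by (auto simp: a_kernel_def' annih_def Delta_eq End_ops left_mult_def restrict_def fun_eq_iff)

text \<open>For \<open>r\<close> in a faithful compatible ideal, compatibility provides
  \<open>a\<close> in \<open>IJ\<close> acting on \<open>I\<close> like \<open>r\<close>. Then
  \<open>perp_in_R\<close> puts \<open>a\<close> into \<open>R\<close>, so
  \<open>r \<ominus> a\<close> lies both in the annihilator of \<open>I\<close> and in its perp, and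
  \<open>annih_perp\<close> gives \<open>r = a\<close>.\<close>

lemma maximal_ideal: "uniquely_maximal AR JA IA \<psi> (R \<inter> IJ)"
proof -
  interpret AR: rng AR by (rule A.subrng_rng[OF R])
  have R_minus: "x \<ominus> y \<in> R" if "x \<in> R" "y \<in> R" for x y
    using that by (rule A.subgroup_minus_closed[OF R.additive_subgroup_axioms])
  have ideal: "rng_ideal (R \<inter> IJ) AR"
  proof (intro rng_ideal.intro rng_ideal_axioms.intro)
    have "subgroup (R \<inter> IJ) (add_monoid A)"
      using additive_subgroup.a_subgroup[OF base.XY_additive] R.a_subgroup
      by (rule A.add.subgroups_Inter_pair[rotated])
    then have "subgroup (R \<inter> IJ) (add_monoid A\<lparr>carrier := R\<rparr>)"
      by (intro A.add.subgroup_incl R.a_subgroup) auto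
    then show "additive_subgroup (R \<inter> IJ) AR" by (simp add: additive_subgroup_def)
  qed (auto simp: R.sub_m_closed R_IJ base.XY_Z)
  have faithful: "faithful_compatible AR JA IA \<psi> (R \<inter> IJ)"
  proof -
    have "R \<inter> IJ \<inter> annih A R I = {\<zero>}"
      using base.XY_annihilator base.zero_mem by (auto simp: annih_def)
    then show ?thesis
      using ideal by (auto simp: faithful_compatible_def psi_compatible_def kernel_Delta Delta_eq FI_eq)
  qed
  moreover have "L \<subseteq> R \<inter> IJ" if "faithful_compatible AR JA IA \<psi> L" for L
  proof
    fix r assume r: "r \<in> L"
    from that have L: "rng_ideal L AR" and FI: "Delta IA ` L \<subseteq> FI" and 0: "L \<inter> annih A R I = {\<zero>}"
      by (simp_all add: faithful_compatible_def psi_compatible_def kernel_Delta)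
    interpret L: rng_ideal L AR by (rule L)
    have rR: "r \<in> R" using L.a_Hcarr[OF r] by simp
    obtain a where a: "a \<in> IJ" "left_mult r = left_mult a"
      using FI r by (auto simp: Delta_eq FI_eq)
    then have ann: "(r \<ominus> a) \<otimes> i = \<zero>" if "i \<in> I" for i
      using rR that by (simp add: left_mult_eq_iff A.minus_distr)
    have r_perp: "r \<in> perp AR (annih A R I)"
    proof -
      \<comment> \<open>Both products stay in the ideal \<open>L\<close> and annihilate
        \<open>I\<close>, while faithfulness says that \<open>L\<close> meets the annihilator only
        in zero.\<close>
      have "r \<otimes> k = \<zero>" "k \<otimes> r = \<zero>" if k: "k \<in> R" "\<forall>i\<in>I. k \<otimes> i = \<zero>" for k
      proof -
        have "r \<otimes> k \<in> L \<inter> annih A R I"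
          using L.r_ideal[OF r, of k] k rR by (simp add: annih_def R.sub_m_closed A.m_assoc)
        then show "r \<otimes> k = \<zero>" using 0 by blast
        have "k \<otimes> r \<in> L \<inter> annih A R I"
          using L.l_ideal[OF r, of k] k rR by (simp add: annih_def R.sub_m_closed A.m_assoc RI)
        then show "k \<otimes> r = \<zero>" using 0 by blast
      qed
      then show ?thesis using rR by (simp add: perp_def annih_def)
    qed
    have "r \<ominus> a \<in> G 0"
      using rR R_degree a(1) IJ_degree A.homogeneous_subgroup by (intro A.subgroup_minus_closed) auto
    with ann have "r \<ominus> a \<in> annih A (G 0) I" by (simp add: annih_def)
    then have aR: "a \<in> R" by (rule perp_in_R[OF r_perp a(1)])
    have "r \<ominus> a \<in> annih A R I" using ann rR aR R_minus by (simp add: annih_def)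
    moreover have "r \<ominus> a \<in> perp AR (annih A R I)"
    proof -
      have "(r \<ominus> a) \<otimes> k = \<zero>" "k \<otimes> (r \<ominus> a) = \<zero>" if "k \<in> annih A R I" for k
      proof -
        have "k \<in> carrier A" using that by (auto simp: annih_def)
        moreover have "r \<otimes> k = \<zero>" "k \<otimes> r = \<zero>" "a \<otimes> k = \<zero>" "k \<otimes> a = \<zero>"
          using that r_perp in_perp[OF aR a(1)] by (simp_all add: perp_def)
        ultimately show "(r \<ominus> a) \<otimes> k = \<zero>" "k \<otimes> (r \<ominus> a) = \<zero>"
          using rR aR by (simp_all add: A.minus_distr)
      qed
      then show ?thesis using rR aR R_minus by (simp add: perp_def)
    qed
    ultimately have "r \<ominus> a = \<zero>" using annih_perp by blast
    then have "r = a" using rR aR by simp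
    then show "r \<in> R \<inter> IJ" using aR a(1) by simp
  qed
  ultimately show ?thesis by (simp add: uniquely_maximal_def)
qed

lemma the_maximal_ideal: "(THE L. uniquely_maximal AR JA IA \<psi> L) = R \<inter> IJ"
  using maximal_ideal by (intro the_equality) (auto simp: uniquely_maximal_def)

end

locale toeplitz_evaluation = mult_system A G R I J \<psi> for A (structure) and G and R I J and \<psi> +
  fixes h
  assumes h_hom: "h \<in> rng_hom (toeplitz (A\<lparr>carrier := R\<rparr>) (ring_bimodule A J) (ring_bimodule A I) \<psi>) A"
    and h_R: "r \<in> R \<Longrightarrow> h (iota_R (A\<lparr>carrier := R\<rparr>) (ring_bimodule A J) (ring_bimodule A I) \<psi> r) = r"
    and h_J: "j \<in> J \<Longrightarrow> h (iota_P (A\<lparr>carrier := R\<rparr>) (ring_bimodule A J) (ring_bimodule A I) \<psi> j) = j"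
    and h_I: "i \<in> I \<Longrightarrow> h (iota_Q (A\<lparr>carrier := R\<rparr>) (ring_bimodule A J) (ring_bimodule A I) \<psi> i) = i"
begin

section \<open>The copy of \<open>IJ\<close> in the Toeplitz ring\<close>

sublocale h: rng_homomorphism toep A h
  by (intro rng_homomorphism.intro rng_homomorphism_axioms.intro A.rng_axioms h_hom sys.rng_toeplitz)

sublocale tc: covariant_rep AR JA IA \<psi> iJ iI iR toep by (rule sys.toeplitz_covariant)

lemma abelian_groups: "abelian_group AR" "abelian_group JA" "abelian_group IA"
  using bimodules by (simp_all add: bimodule_def rng_def)

lemma iR_hom: "iR \<in> hom (add_monoid AR) (add_monoid toep)"
  using tc.sigma_hom by (simp add: rng_hom_def)

lemma iota_closed [simp]: "r \<in> R \<Longrightarrow> iR r \<in> carrier toep" "i \<in> I \<Longrightarrow> iI i \<in> carrier toep"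
  "j \<in> J \<Longrightarrow> iJ j \<in> carrier toep"
  using hom_zero_minus(3)[OF abelian_groups(1) h.abelian_group_axioms iR_hom]
    hom_zero_minus(3)[OF abelian_groups(2) h.abelian_group_axioms tc.S_add]
    hom_zero_minus(3)[OF abelian_groups(3) h.abelian_group_axioms tc.T_add] by simp_all

lemma iota_zero: "iR \<zero> = \<zero>\<^bsub>toep\<^esub>"
  using hom_zero_minus(1)[OF abelian_groups(1) h.abelian_group_axioms iR_hom] by simp

lemma iota_add:
  "i \<in> I \<Longrightarrow> i' \<in> I \<Longrightarrow> iI (i \<oplus> i') = iI i \<oplus>\<^bsub>toep\<^esub> iI i'"
  "j \<in> J \<Longrightarrow> j' \<in> J \<Longrightarrow> iJ (j \<oplus> j') = iJ j \<oplus>\<^bsub>toep\<^esub> iJ j'"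
  using hom_zero_minus(4)[OF abelian_groups(2) h.abelian_group_axioms tc.S_add]
    hom_zero_minus(4)[OF abelian_groups(3) h.abelian_group_axioms tc.T_add] by simp_all

lemma iota_mult:
  "r \<in> R \<Longrightarrow> s \<in> R \<Longrightarrow> iR r \<otimes>\<^bsub>toep\<^esub> iR s = iR (r \<otimes> s)"
  "r \<in> R \<Longrightarrow> i \<in> I \<Longrightarrow> iR r \<otimes>\<^bsub>toep\<^esub> iI i = iI (r \<otimes> i)"
  "r \<in> R \<Longrightarrow> i \<in> I \<Longrightarrow> iI i \<otimes>\<^bsub>toep\<^esub> iR r = iI (i \<otimes> r)"
  "r \<in> R \<Longrightarrow> j \<in> J \<Longrightarrow> iR r \<otimes>\<^bsub>toep\<^esub> iJ j = iJ (r \<otimes> j)"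
  "r \<in> R \<Longrightarrow> j \<in> J \<Longrightarrow> iJ j \<otimes>\<^bsub>toep\<^esub> iR r = iJ (j \<otimes> r)"
  "j \<in> J \<Longrightarrow> i \<in> I \<Longrightarrow> iJ j \<otimes>\<^bsub>toep\<^esub> iI i = iR (j \<otimes> i)"
  using tc.sigma_hom tc.T_lact[of r i] tc.T_ract[of r i] tc.S_lact[of r j] tc.S_ract[of r j]
    tc.sigma_psi[of j i] psi_tens[of j i] by (simp_all add: rng_hom_def)

abbreviation "UV \<equiv> subgroup_prod toep (iI ` I) (iJ ` J)"

text \<open>A sum of products \<open>i \<otimes> j\<close> is lifted to the sum of the products of
  \<open>iI i\<close> and \<open>iJ j\<close>. Independence of the chosen sum is not yet available,
  so only existence is claimed, together with both actions, which is enough to carry local units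
  over to \<open>toep\<close>.\<close>

lemma lift_IJ:
  assumes "a \<in> IJ"
  shows "\<exists>u\<in>UV. (\<forall>i\<in>I. u \<otimes>\<^bsub>toep\<^esub> iI i = iI (a \<otimes> i)) \<and> (\<forall>j\<in>J. iJ j \<otimes>\<^bsub>toep\<^esub> u = iJ (j \<otimes> a))"
  using assms
proof (induction a rule: IJ_induct)
  case (prod i j)
  have "iI i \<otimes>\<^bsub>toep\<^esub> iJ j \<in> UV" using prod by (intro h.subgroup_prod_incl) auto
  moreover have "iI i \<otimes>\<^bsub>toep\<^esub> iJ j \<otimes>\<^bsub>toep\<^esub> iI x = iI (i \<otimes> j \<otimes> x)" if "x \<in> I" for x
    using prod that by (simp add: h.m_assoc A.m_assoc iota_mult JI)
  moreover have "iJ y \<otimes>\<^bsub>toep\<^esub> (iI i \<otimes>\<^bsub>toep\<^esub> iJ j) = iJ (y \<otimes> (i \<otimes> j))" if "y \<in> J" for y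
    using prod that by (simp add: iota_mult JI flip: h.m_assoc A.m_assoc)
  ultimately show ?case by blast
next
  case (add a b)
  obtain u where u: "u \<in> UV" "\<forall>i\<in>I. u \<otimes>\<^bsub>toep\<^esub> iI i = iI (a \<otimes> i)" "\<forall>j\<in>J. iJ j \<otimes>\<^bsub>toep\<^esub> u = iJ (j \<otimes> a)"
    using add by blast
  obtain v where v: "v \<in> UV" "\<forall>i\<in>I. v \<otimes>\<^bsub>toep\<^esub> iI i = iI (b \<otimes> i)" "\<forall>j\<in>J. iJ j \<otimes>\<^bsub>toep\<^esub> v = iJ (j \<otimes> b)"
    using add by blast
  have UV: "additive_subgroup UV toep" by (rule h.subgroup_prod_additive) auto
  have c: "u \<in> carrier toep" "v \<in> carrier toep" using u v additive_subgroup.a_Hcarr[OF UV] by auto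
  have "u \<oplus>\<^bsub>toep\<^esub> v \<in> UV" using u v additive_subgroup.a_closed[OF UV] by blast
  moreover have "(u \<oplus>\<^bsub>toep\<^esub> v) \<otimes>\<^bsub>toep\<^esub> iI i = iI ((a \<oplus> b) \<otimes> i)" if "i \<in> I" for i
    using u v c that add by (simp add: h.l_distr A.l_distr iota_add base.XY_X)
  moreover have "iJ j \<otimes>\<^bsub>toep\<^esub> (u \<oplus>\<^bsub>toep\<^esub> v) = iJ (j \<otimes> (a \<oplus> b))" if "j \<in> J" for j
    using u v c that add by (simp add: h.r_distr A.r_distr iota_add J_IJ)
  ultimately show ?case by blast
qed

text \<open>Local units come from those in \<open>IJ\<close> through \<open>lift_IJ\<close>;
  injectivity on the copy of \<open>R\<close> holds because \<open>h (iR r) = r\<close>.\<close>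

sublocale T: covariant_image toep A h "iI ` I" "iJ ` J" "iR ` R"
proof (intro covariant_image.intro covariant_image_axioms.intro h.rng_homomorphism_axioms)
  show "additive_subgroup (iI ` I) toep" "additive_subgroup (iJ ` J) toep" "additive_subgroup (iR ` R) toep"
    using additive_subgroup_image[OF abelian_groups(1) h.abelian_group_axioms iR_hom]
      additive_subgroup_image[OF abelian_groups(2) h.abelian_group_axioms tc.S_add]
      additive_subgroup_image[OF abelian_groups(3) h.abelian_group_axioms tc.T_add] by simp_all
  fix F
  show "\<exists>a\<in>UV. \<forall>x\<in>F. a \<otimes>\<^bsub>toep\<^esub> x = x" if F: "finite F" "F \<subseteq> iI ` I"
  proof -
    obtain X where X: "finite X" "X \<subseteq> I" "F = iI ` X" using finite_subset_image[OF F] by blast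
    obtain a where a: "a \<in> IJ" "\<forall>i\<in>X. a \<otimes> i = i" using I_units[OF X(1,2)] by blast
    obtain u where "u \<in> UV" "\<forall>i\<in>I. u \<otimes>\<^bsub>toep\<^esub> iI i = iI (a \<otimes> i)" using lift_IJ[OF a(1)] by blast
    with X a show ?thesis by (intro bexI[of _ u]) auto
  qed
  show "\<exists>b\<in>UV. \<forall>y\<in>F. y \<otimes>\<^bsub>toep\<^esub> b = y" if F: "finite F" "F \<subseteq> iJ ` J"
  proof -
    obtain X where X: "finite X" "X \<subseteq> J" "F = iJ ` X" using finite_subset_image[OF F] by blast
    obtain a where a: "a \<in> IJ" "\<forall>j\<in>X. j \<otimes> a = j" using J_units[OF X(1,2)] by blast
    obtain u where "u \<in> UV" "\<forall>j\<in>J. iJ j \<otimes>\<^bsub>toep\<^esub> u = iJ (j \<otimes> a)" using lift_IJ[OF a(1)] by blast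
    with X a show ?thesis by (intro bexI[of _ u]) auto
  qed
qed (auto simp: iota_mult R.sub_m_closed RI IR RJ JR JI h_I h_R iota_zero)

lemma h_UV: "u \<in> UV \<Longrightarrow> h u \<in> IJ"
proof (induction u rule: T.XY_induct)
  case (diff a b)
  then show ?case by (simp add: h.hom_minus A.subgroup_minus_closed[OF base.XY_additive])
qed (auto simp: h.hom_simps base.zero_mem h_I h_J A.subgroup_prod_incl)

text \<open>The left side is some \<open>iI x\<close>, and applying \<open>h\<close> identifies
  \<open>x\<close> as \<open>h u \<otimes> i\<close>.\<close>

lemma UV_h: "u \<in> UV \<Longrightarrow> i \<in> I \<Longrightarrow> u \<otimes>\<^bsub>toep\<^esub> iI i = iI (h u \<otimes> i)"
proof -
  assume u: "u \<in> UV" and i: "i \<in> I"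
  have "u \<otimes>\<^bsub>toep\<^esub> iI i \<in> iI ` I" using u i by (intro T.XY_X) auto
  then obtain x where x: "x \<in> I" "u \<otimes>\<^bsub>toep\<^esub> iI i = iI x" by blast
  have "h (u \<otimes>\<^bsub>toep\<^esub> iI i) = h u \<otimes> i" using u i by (simp add: h.hom_mult h_I)
  then show ?thesis using x h_I by simp
qed

text \<open>\<open>h u\<close> and \<open>a\<close> act alike on \<open>I\<close>, and two
  candidates in \<open>UV\<close> act alike on the copy of \<open>I\<close>; both actions are
  faithful. With \<open>h_UV\<close>, \<open>h\<close> thus maps \<open>UV\<close> bijectively onto
  \<open>IJ\<close>.\<close>

lemma lift_unique:
  assumes "a \<in> IJ"
  shows "\<exists>!u. u \<in> UV \<and> h u = a"
proof -
  obtain u where u: "u \<in> UV" "\<forall>i\<in>I. u \<otimes>\<^bsub>toep\<^esub> iI i = iI (a \<otimes> i)" using lift_IJ[OF assms] by blast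
  have hu: "h u = a"
  proof (rule base.XY_eqI[OF h_UV[OF u(1)] assms])
    fix i assume i: "i \<in> I"
    then have "h (iI (h u \<otimes> i)) = h (iI (a \<otimes> i))" using u UV_h by simp
    then show "h u \<otimes> i = a \<otimes> i" using i h_I base.XY_X h_UV[OF u(1)] assms by simp
  qed
  show ?thesis
  proof (rule ex1I[of _ u])
    fix v assume v: "v \<in> UV \<and> h v = a"
    then have eq: "v \<otimes>\<^bsub>toep\<^esub> iI i = u \<otimes>\<^bsub>toep\<^esub> iI i" if "i \<in> I" for i
      using that u(1) hu by (simp add: UV_h)
    show "v = u"
    proof (rule T.XY_eqI)
      show "v \<in> UV" "u \<in> UV" using v u(1) by blast+
      show "v \<otimes>\<^bsub>toep\<^esub> x = u \<otimes>\<^bsub>toep\<^esub> x" if "x \<in> iI ` I" for x using that eq by blast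
    qed
  qed (use u(1) hu in blast)
qed

definition lift where "lift a = (THE u. u \<in> UV \<and> h u = a)"

lemma lift: "a \<in> IJ \<Longrightarrow> lift a \<in> UV" "a \<in> IJ \<Longrightarrow> h (lift a) = a"
  using theI'[OF lift_unique] by (simp_all add: lift_def)

lemma lift_h: "u \<in> UV \<Longrightarrow> lift (h u) = u"
  unfolding lift_def by (rule the1_equality[OF lift_unique[OF h_UV]]) simp_all

text \<open>The inner description is well defined because \<open>IJ\<close> acts faithfully on
  \<open>I\<close>; the restriction to \<open>FI\<close> matches the extensionality demanded in
  \<open>rep_pi\<close>.\<close>

definition rank_lift where "rank_lift = (\<lambda>f\<in>FI. lift (THE a. a \<in> IJ \<and> f = left_mult a))"

lemma rank_lift: "a \<in> IJ \<Longrightarrow> rank_lift (left_mult a) = lift a"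
proof -
  assume a: "a \<in> IJ"
  have "(THE b. b \<in> IJ \<and> left_mult a = left_mult b) = a"
    by (rule the_equality) (use a base.XY_eqI in \<open>auto simp: left_mult_eq_iff\<close>)
  then show ?thesis using a left_mult_generate by (simp add: rank_lift_def)
qed

text \<open>\<open>rank_lift\<close> qualifies because the product of \<open>iI q\<close> and
  \<open>iJ p\<close> is the lift of \<open>q \<otimes> p\<close>. Any competitor agrees with it on
  the operators \<open>theta_Q\<close>, hence everywhere by additivity.\<close>

lemma rep_pi: "rep_pi AR JA IA \<psi> iJ iI toep = rank_lift"
  unfolding rep_pi_def
proof (rule the_equality, intro conjI ballI)
  have IJ_add: "a \<oplus> b \<in> IJ" if "a \<in> IJ" "b \<in> IJ" for a b
    using that additive_subgroup.a_closed[OF base.XY_additive] by blast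
  \<comment> \<open>\<open>lift\<close> inverts the homomorphism \<open>h\<close> on
    \<open>UV\<close>, which is closed under sums and products, so it preserves both
    operations.\<close>
  have l_add: "lift (a \<oplus> b) = lift a \<oplus>\<^bsub>toep\<^esub> lift b" if "a \<in> IJ" "b \<in> IJ" for a b
  proof -
    have "lift a \<oplus>\<^bsub>toep\<^esub> lift b \<in> UV"
      using lift that additive_subgroup.a_closed[OF T.XY_additive] by blast
    then show ?thesis using lift_h[of "lift a \<oplus>\<^bsub>toep\<^esub> lift b"] lift that by (simp add: h.hom_add)
  qed
  have l_mult: "lift (a \<otimes> b) = lift a \<otimes>\<^bsub>toep\<^esub> lift b" if "a \<in> IJ" "b \<in> IJ" for a b
  proof -
    have "lift a \<otimes>\<^bsub>toep\<^esub> lift b \<in> UV"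
      using lift that by (intro T.T_XY T.XY_X) simp_all
    then show ?thesis using lift_h[of "lift a \<otimes>\<^bsub>toep\<^esub> lift b"] lift that by (simp add: h.hom_mult)
  qed
  let ?E = "right_End AR IA\<lparr>carrier := FI\<rparr>"
  show "rank_lift \<in> rng_hom ?E toep"
    unfolding rng_hom_def
  proof (intro CollectI conjI ballI homI)
    fix f g assume "f \<in> carrier (add_monoid ?E)" "g \<in> carrier (add_monoid ?E)"
    then obtain a b where "f = left_mult a" "g = left_mult b" "a \<in> IJ" "b \<in> IJ" by (auto simp: FI_eq)
    then show "rank_lift (f \<otimes>\<^bsub>add_monoid ?E\<^esub> g) = rank_lift f \<otimes>\<^bsub>add_monoid toep\<^esub> rank_lift g"
      by (simp add: rank_lift l_add IJ_add flip: left_mult_add)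
  next
    fix f g assume "f \<in> carrier ?E" "g \<in> carrier ?E"
    then obtain a b where "f = left_mult a" "g = left_mult b" "a \<in> IJ" "b \<in> IJ" by (auto simp: FI_eq)
    then show "rank_lift (f \<otimes>\<^bsub>?E\<^esub> g) = rank_lift f \<otimes>\<^bsub>toep\<^esub> rank_lift g"
      by (simp add: rank_lift l_mult IJ_IJ flip: left_mult_mult)
  qed (auto simp: FI_eq rank_lift lift)
  show "rank_lift \<in> extensional FI" by (simp add: rank_lift_def)
  have theta: "rank_lift (theta_Q AR JA IA \<psi> q p) = iI q \<otimes>\<^bsub>toep\<^esub> iJ p" if "q \<in> I" "p \<in> J" for q p
  proof -
    have "iI q \<otimes>\<^bsub>toep\<^esub> iJ p \<in> UV" using that by (intro h.subgroup_prod_incl) auto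
    then show ?thesis
      using lift_h[of "iI q \<otimes>\<^bsub>toep\<^esub> iJ p"] that
      by (simp add: theta_left rank_lift A.subgroup_prod_incl h.hom_mult h_I h_J)
  qed
  then show "rank_lift (theta_Q AR JA IA \<psi> q p) = iI q \<otimes>\<^bsub>toep\<^esub> iJ p"
    if "q \<in> carrier IA" "p \<in> carrier JA" for q p using that by simp
  fix \<pi> assume \<pi>: "\<pi> \<in> rng_hom ?E toep \<and> \<pi> \<in> extensional FI
    \<and> (\<forall>q\<in>carrier IA. \<forall>p\<in>carrier JA. \<pi> (theta_Q AR JA IA \<psi> q p) = iI q \<otimes>\<^bsub>toep\<^esub> iJ p)"
  show "\<pi> = rank_lift"
  proof (rule extensionalityI[of _ FI])
    fix f assume "f \<in> FI"
    then obtain a where a: "a \<in> IJ" "f = left_mult a" by (auto simp: FI_eq)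
    have "\<pi> (left_mult a) = rank_lift (left_mult a)"
      using a(1)
    proof (induction a rule: IJ_induct)
      case (prod i j)
      then show ?case using \<pi> theta[of i j] by (simp add: theta_left)
    next
      case (add a b)
      have "\<pi> (left_mult (a \<oplus> b)) = \<pi> (left_mult a) \<oplus>\<^bsub>toep\<^esub> \<pi> (left_mult b)"
        using \<pi> add left_mult_generate by (simp add: left_mult_add rng_hom_def hom_def)
      then show ?case using add by (simp add: rank_lift l_add IJ_add)
    qed
    then show "\<pi> f = rank_lift f" using a by simp
  qed (use \<pi> in \<open>simp_all add: rank_lift_def\<close>)
qed

section \<open>The kernel of the evaluation map\<close>

abbreviation "K \<equiv> toeplitz_ideal AR JA IA \<psi> (R \<inter> IJ)"

lemma K_eq: "K = gen_rng_ideal toep {iR r \<ominus>\<^bsub>toep\<^esub> lift r |r. r \<in> R \<inter> IJ}"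
proof -
  have "{iR r \<ominus>\<^bsub>toep\<^esub> rank_lift (Delta IA r) |r. r \<in> R \<inter> IJ} = {iR r \<ominus>\<^bsub>toep\<^esub> lift r |r. r \<in> R \<inter> IJ}"
    by (rule Collect_cong, rule ex_cong1, rule rev_conj_cong, rule refl) (simp add: Delta_eq rank_lift)
  then show ?thesis by (simp only: toeplitz_ideal_def rep_pi)
qed

lemma K_gens: "{iR r \<ominus>\<^bsub>toep\<^esub> lift r |r. r \<in> R \<inter> IJ} \<subseteq> a_kernel toep A h"
proof -
  have "iR r \<ominus>\<^bsub>toep\<^esub> lift r \<in> a_kernel toep A h" if "r \<in> R" "r \<in> IJ" for r
    using that lift by (simp add: a_kernel_def' h.hom_minus h_R)
  then show ?thesis by blast
qed

lemma K_ideal: "rng_ideal K toep" "r \<in> R \<Longrightarrow> r \<in> IJ \<Longrightarrow> iR r \<ominus>\<^bsub>toep\<^esub> lift r \<in> K"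
proof -
  have "a_kernel toep A h \<subseteq> carrier toep" by (auto simp: a_kernel_def')
  then have "{iR r \<ominus>\<^bsub>toep\<^esub> lift r |r. r \<in> R \<inter> IJ} \<subseteq> carrier toep" using K_gens by blast
  note gen_rng_ideal_ideal[OF h.rng_axioms this, folded K_eq]
  then show "rng_ideal K toep" "r \<in> R \<Longrightarrow> r \<in> IJ \<Longrightarrow> iR r \<ominus>\<^bsub>toep\<^esub> lift r \<in> K" by blast+
qed

abbreviation "tcoset \<equiv> toeplitz_coset AR JA IA \<psi>"

text \<open>A word is built up by adding letters on the left, and \<open>Z_nf\<close>,
  \<open>Y_nf\<close> and \<open>X_nf\<close> allow this in every degree. Words are nonempty, so
  one-letter words start the induction.\<close>

lemma word_nf:
  assumes "set w \<subseteq> toeplitz_gens AR JA IA" "w \<noteq> []"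
  shows "\<exists>N. T.nf N (sys.word_degree w) (tcoset (frag_of w))"
  using assms
proof (induction w)
  case (Cons g w)
  have gens: "g \<in> GR ` R \<union> GP ` J \<union> GQ ` I" using Cons.prems by (simp add: toeplitz_gens_def)
  have g: "T.nf 0 (gen_degree g) (tcoset (frag_of [g]))"
    using gens T.nf.base[of "iR _" 0] T.nf_X_gen[of "iI _" 0] T.nf_Y_gen[of "iJ _" 0]
    by (auto simp: iota_R_def iota_P_def iota_Q_def)
  show ?case
  proof (cases "w = []")
    case True
    then show ?thesis using g by auto
  next
    case False
    then obtain N where N: "T.nf N (sys.word_degree w) (tcoset (frag_of w))" using Cons by auto
    have "tcoset (word_mult (frag_of [g]) (frag_of w)) = tcoset (frag_of [g]) \<otimes>\<^bsub>toep\<^esub> tcoset (frag_of w)"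
      using Cons.prems False by (intro sys.coset_mult) (simp_all add: sys.word_in_F)
    then have eq: "tcoset (frag_of (g # w)) = tcoset (frag_of [g]) \<otimes>\<^bsub>toep\<^esub> tcoset (frag_of w)" by simp
    consider r where "g = GR r" "r \<in> R" | p where "g = GP p" "p \<in> J" | q where "g = GQ q" "q \<in> I"
      using gens by blast
    then show ?thesis
    proof cases
      case (1 r)
      then show ?thesis
        unfolding eq using T.Z_nf[OF N, of "iR r"] by (auto simp: iota_R_def)
    next
      case (2 p)
      then show ?thesis
        unfolding eq using T.Y_nf[OF N, of "iJ p"] by (auto simp: iota_P_def)
    next
      case (3 q)
      then show ?thesis
        unfolding eq using T.X_nf[OF N, of "iI q"] by (auto simp: iota_Q_def add.commute)
    qed
  qed
qed simp

lemma homogeneous_nf: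
  assumes "t \<in> toeplitz_grading AR JA IA \<psi> n"
  shows "\<exists>N. T.nf N n t"
proof -
  let ?F = "free_rng (toeplitz_gens AR JA IA)"
  \<comment> \<open>Restricting to words of degree \<open>n\<close> keeps the induction over
    combinations inside one degree, where normal forms can be subtracted once their bounds are
    raised to a common one.\<close>
  let ?W = "{w. set w \<subseteq> toeplitz_gens AR JA IA \<and> w \<noteq> [] \<and> sys.word_degree w = n}"
  have keys: "Poly_Mapping.keys x \<subseteq> ?W \<longleftrightarrow>
      x \<in> carrier ?F \<and> (\<forall>w\<in>Poly_Mapping.keys x. sys.word_degree w = n)" for x
    by (auto simp: free_rng_def)
  obtain x where x: "t = tcoset x" "Poly_Mapping.keys x \<subseteq> ?W"
    using assms unfolding toeplitz_grading_def keys by blast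
  have "\<exists>N. T.nf N n (tcoset x)"
    using x(2)
  proof (induction x rule: free_Abelian_group_induct[consumes 1, case_names zero diff word])
    case zero
    show ?case using T.nf_zero by (auto simp: sys.coset_zero)
  next
    case (diff x y)
    then have F: "x \<in> carrier ?F" "y \<in> carrier ?F" using keys by blast+
    obtain N M where N: "T.nf N n (tcoset x)" "T.nf M n (tcoset y)" using diff by blast
    have "tcoset (x - y) = tcoset x \<ominus>\<^bsub>toep\<^esub> tcoset y"
      by (rule sys.coset_minus[OF F])
    then show ?case
      using T.nf.diff[OF T.nf_mono[OF _ N(1)] T.nf_mono[OF _ N(2)], of "max N M"] by auto
  next
    case (word w)
    then show ?case using word_nf[of w] by auto
  qed
  then show ?thesis using x by simp
qed

text \<open>A normal form of \<open>t\<close> exhibits factors from the copies of \<open>I\<close>,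
  \<open>J\<close> and \<open>R\<close>, which \<open>h\<close> sends to degrees \<open>1\<close>,
  \<open>- 1\<close> and \<open>0\<close>.\<close>

lemma h_degree:
  assumes "t \<in> toeplitz_grading AR JA IA \<psi> n"
  shows "h t \<in> G n"
proof -
  obtain N where "T.nf N n t" using homogeneous_nf[OF assms] by blast
  then show ?thesis
  proof (induction rule: T.nf.induct)
    case (base z N)
    then show ?case using h_R R_degree by auto
  next
    case (left N d t x)
    then show ?case
      using A.homogeneous_mult[of "h x" 1 "h t" d] I_degree by (auto simp: h.hom_mult h_I add.commute)
  next
    case (right N d t y)
    then show ?case
      using A.homogeneous_mult[of "h t" d "h y" "- 1"] J_degree by (auto simp: h.hom_mult h_J)
  next
    case (both N t x y)
    then have "h x \<in> G 1" "h y \<in> G (- 1)" using I_degree J_degree h_I h_J by auto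
    then have "h x \<otimes> h t \<otimes> h y \<in> G (1 + 0 + - 1)" using both by (intro A.homogeneous_mult)
    then show ?case using both by (simp add: h.hom_mult)
  next
    case (diff N d t t')
    then show ?case by (simp add: h.hom_minus A.subgroup_minus_closed[OF A.homogeneous_subgroup])
  qed
qed

sublocale graded: graded_rng_hom toep "toeplitz_grading AR JA IA \<psi>" A G h
  by (intro graded_rng_hom.intro graded_rng_hom_axioms.intro h.rng_homomorphism_axioms
      sys.pregraded_toeplitz A.graded_rng_axioms h_degree)

lemma kernel_eq: "a_kernel toep A h = K"
proof
  show "K \<subseteq> a_kernel toep A h"
    unfolding K_eq by (rule gen_rng_ideal_least[OF h.kernel_ideal K_gens])
  show "a_kernel toep A h \<subseteq> K"
  proof
    fix t assume "t \<in> a_kernel toep A h"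
    then have t: "t \<in> carrier toep" "h t = \<zero>" by (simp_all add: a_kernel_def')
    show "t \<in> K"
    proof (rule graded.kernel_homogeneous[OF K_ideal(1) _ t])
      fix n s assume "s \<in> toeplitz_grading AR JA IA \<psi> n" and s0: "h s = \<zero>"
      then obtain N where "T.nf N n s" using homogeneous_nf by blast
      \<comment> \<open>Both terms come from one element \<open>r\<close>: \<open>z\<close> is
        \<open>iR r\<close>, and \<open>h u = r\<close> shows that \<open>r\<close> lies in
        \<open>R \<inter> IJ\<close> with lift \<open>u\<close>. Their difference is therefore a
        generator of \<open>K\<close>.\<close>
      moreover have "z \<ominus>\<^bsub>toep\<^esub> u \<in> K" if zu: "z \<in> iR ` R" "u \<in> UV" "h z = h u" for z u
      proof -
        obtain r where r: "r \<in> R" "z = iR r" using zu(1) by blast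
        then have "h u = r" using zu(3) h_R by simp
        then show ?thesis using K_ideal(2)[of r] r h_UV[OF zu(2)] lift_h[OF zu(2)] by simp
      qed
      ultimately show "s \<in> K" using T.nf_kernel[OF K_ideal(1)] s0 by blast
    qed
  qed
qed

section \<open>The image of the evaluation map and the graded isomorphism\<close>

lemma image_h: "h ` carrier toep = gen_subrng A (R \<union> I \<union> J)"
proof
  have "additive_subgroup (h ` carrier toep) A"
    using additive_subgroup_image[OF h.abelian_group_axioms A.abelian_group_axioms h.add_hom] .
  then have "subrng (h ` carrier toep) A"
    by (intro subrng.intro subrng_axioms.intro) (auto simp flip: h.hom_mult)
  moreover have "R \<union> I \<union> J \<subseteq> h ` carrier toep"
  proof -
    have "h ` (iR ` R \<union> iI ` I \<union> iJ ` J) = R \<union> I \<union> J"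
      by (simp add: image_Un image_image h_R h_I h_J cong: image_cong)
    moreover have "iR ` R \<union> iI ` I \<union> iJ ` J \<subseteq> carrier toep" by auto
    ultimately show ?thesis by (metis image_mono)
  qed
  ultimately show "gen_subrng A (R \<union> I \<union> J) \<subseteq> h ` carrier toep" by (auto simp: gen_subrng_def)
  have "h (tcoset x) \<in> S" if S: "subrng S A" "R \<union> I \<union> J \<subseteq> S"
    and x: "x \<in> carrier (free_rng (toeplitz_gens AR JA IA))" for S x
  proof -
    interpret S: subrng S A by (rule S)
    show ?thesis
      using x
    proof (induction x rule: free_rng_induct)
      case zero
      then show ?case by (simp add: sys.coset_zero h.hom_zero)
    next
      case (gen g)
      then have "g \<in> GR ` R \<union> GP ` J \<union> GQ ` I" by (simp add: toeplitz_gens_def)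
      then show ?case
        using h_R h_I h_J S(2) by (auto simp: iota_R_def iota_P_def iota_Q_def)
    next
      case (mult x y)
      then show ?case
        by (simp add: sys.coset_mult sys.coset_closed h.hom_mult S.sub_m_closed)
    next
      case (diff x y)
      then show ?case
        by (simp add: sys.coset_minus sys.coset_closed h.hom_minus A.subgroup_minus_closed[OF S.additive_subgroup_axioms])
    qed
  qed
  then show "h ` carrier toep \<subseteq> gen_subrng A (R \<union> I \<union> J)"
    by (auto simp: gen_subrng_def sys.carrier_toeplitz)
qed

lemma graded_isomorphism:
  fixes S defines "S \<equiv> gen_subrng A (R \<union> I \<union> J)"
  shows "\<exists>\<phi>. graded_rng_iso (cuntz_pimsner AR JA IA \<psi>) (cuntz_pimsner_grading AR JA IA \<psi>)
    (A\<lparr>carrier := S\<rparr>) (\<lambda>n. S \<inter> G n) \<phi>"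
proof -
  let ?S = "A\<lparr>carrier := S\<rparr>" and ?O = "cuntz_pimsner AR JA IA \<psi>" and ?c = "(+>\<^bsub>toep\<^esub>) K"
  let ?H = "toeplitz_grading AR JA IA \<psi>" and ?OH = "cuntz_pimsner_grading AR JA IA \<psi>"
  have hS: "h ` carrier toep = S" by (simp add: S_def image_h)
  have "subrng S A"
    using additive_subgroup_image[OF h.abelian_group_axioms A.abelian_group_axioms h.add_hom]
    by (intro subrng.intro subrng_axioms.intro) (auto simp flip: h.hom_mult simp: hS[symmetric])
  then have rS: "rng ?S" by (rule A.subrng_rng)
  have O: "?O = toep Quot K" by (simp add: cuntz_pimsner_def the_maximal_ideal)
  have OH: "?OH = (\<lambda>n. ?c ` ?H n)"
    by (simp add: cuntz_pimsner_grading_def[abs_def] the_maximal_ideal)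
  \<comment> \<open>Cutting the target of \<open>h\<close> down to its image keeps the kernel and
    makes \<open>h\<close> surjective.\<close>
  have hS_hom: "rng_homomorphism toep ?S h"
    using h.hom hS by (intro rng_homomorphism.intro rng_homomorphism_axioms.intro h.rng_axioms rS)
      (auto simp: rng_hom_def hom_def)
  interpret hS: rng_homomorphism toep ?S h by (rule hS_hom)
  have kerS: "a_kernel toep ?S h = K" using kernel_eq by (simp add: a_kernel_def')
  have surj: "h ` carrier toep = carrier ?S" by (simp add: hS)
  obtain \<phi> where \<phi>: "\<phi> \<in> rng_hom ?O ?S" "bij_betw \<phi> (carrier ?O) (carrier ?S)"
    and \<phi>c: "\<And>x. x \<in> carrier toep \<Longrightarrow> \<phi> (?c x) = h x"
    by (rule hS.quotient_kernel_iso[OF surj, unfolded kerS, folded O]) (rule that)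
  \<comment> \<open>The inclusion into \<open>A\<close> is injective and preserves degrees; it turns
    the components \<open>S \<inter> G n\<close>, which span because they are the images under
    \<open>h\<close>, into a grading.\<close>
  have incl: "rng_homomorphism ?S A (\<lambda>x. x)"
    using \<open>subrng S A\<close> by (intro rng_homomorphism.intro rng_homomorphism_axioms.intro rS A.rng_axioms)
      (auto simp: rng_hom_def hom_def subrng_def additive_subgroup.a_Hcarr)
  have "pregraded_rng ?S (\<lambda>n. h ` ?H n)"
    by (rule graded.T.pregraded_image[OF hS_hom]) (simp add: hS)
  moreover have SG: "(\<lambda>n. h ` ?H n) = (\<lambda>n. S \<inter> G n)"
    using graded.image_homogeneous by (simp add: hS)
  ultimately have pS: "pregraded_rng ?S (\<lambda>n. S \<inter> G n)" by simp
  interpret S: graded_rng_hom ?S "\<lambda>n. S \<inter> G n" A G "\<lambda>x. x"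
    by (intro graded_rng_hom.intro graded_rng_hom_axioms.intro incl pS A.graded_rng_axioms) simp
  have gS: "graded_rng ?S (\<lambda>n. S \<inter> G n)" by (rule S.graded_if_inj) simp
  have rO: "rng ?O" and c_hom: "?c \<in> rng_hom toep ?O"
    unfolding O using rng_quotient[OF h.rng_axioms K_ideal(1)] by simp_all
  have pO: "pregraded_rng ?O ?OH"
    unfolding OH
    by (rule graded.T.pregraded_image, intro rng_homomorphism.intro rng_homomorphism_axioms.intro
        h.rng_axioms rO c_hom) (auto simp: O FactRing_def A_RCOSETS_def')
  have deg: "\<phi> ` ?OH n \<subseteq> S \<inter> G n" for n
  proof -
    have "\<phi> ` ?OH n = h ` ?H n"
      unfolding OH image_image by (rule image_cong[OF refl \<phi>c[OF graded.T.homogeneous_carr]])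
    then show ?thesis using fun_cong[OF SG, of n] by simp
  qed
  \<comment> \<open>The same argument for the Cuntz-Pimsner ring, now through the injective map
    \<open>\<phi>\<close> into the graded ring \<open>?S\<close>.\<close>
  interpret O: graded_rng_hom ?O ?OH ?S "\<lambda>n. S \<inter> G n" \<phi>
    using deg by (intro graded_rng_hom.intro graded_rng_hom_axioms.intro rng_homomorphism.intro
        rng_homomorphism_axioms.intro rO rS \<phi>(1) pO gS) blast
  have "graded_rng ?O ?OH" using \<phi>(2) by (intro O.graded_if_inj) (simp add: bij_betw_def)
  then have "graded_rng_iso ?O ?OH ?S (\<lambda>n. S \<inter> G n) \<phi>"
    by (intro graded_rng_iso.intro graded_rng_iso_axioms.intro gS \<phi> deg)
  then show ?thesis by blast
qed

end

context mult_system
begin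

lemma cuntz_pimsner_iso:
  "\<exists>\<phi>. graded_rng_iso (cuntz_pimsner AR JA IA \<psi>) (cuntz_pimsner_grading AR JA IA \<psi>)
    (A\<lparr>carrier := gen_subrng A (R \<union> I \<union> J)\<rparr>) (\<lambda>n. gen_subrng A (R \<union> I \<union> J) \<inter> G n) \<phi>"
proof -
  \<comment> \<open>The inclusions of \<open>J\<close>, \<open>I\<close> and \<open>R\<close> form a
    covariant representation in \<open>A\<close> because \<open>\<psi>\<close> is given by
    multiplication; universality then yields the evaluation map.\<close>
  have "covariant_rep AR JA IA \<psi> (\<lambda>x. x) (\<lambda>x. x) (\<lambda>x. x) A"
    by (intro covariant_rep.intro system A.rng_axioms covariant_rep_axioms.intro)
      (auto simp: hom_def rng_hom_def psi_tens)
  then obtain h where h: "h \<in> rng_hom toep A" "\<And>r. r \<in> carrier AR \<Longrightarrow> h (iR r) = r"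
    "\<And>p. p \<in> carrier JA \<Longrightarrow> h (iJ p) = p" "\<And>q. q \<in> carrier IA \<Longrightarrow> h (iI q) = q"
    by (rule sys.toeplitz_universal) blast
  interpret toeplitz_evaluation A G R I J \<psi> h
    by (intro toeplitz_evaluation.intro mult_system_axioms toeplitz_evaluation_axioms.intro h) simp_all
  show ?thesis by (rule graded_isomorphism)
qed

end

theorem theorem3p1:
  fixes A :: "('a, 'b) ring_scheme" and G :: "int \<Rightarrow> 'a set" and R I J :: "'a set"
  defines "AR \<equiv> A\<lparr>carrier := R\<rparr>"
    and "P \<equiv> ring_bimodule A J"
    and "Q \<equiv> ring_bimodule A I"
    and "S \<equiv> gen_subrng A (R \<union> I \<union> J)"
  assumes "graded_rng A G"
    and "subrng R (A\<lparr>carrier := G 0\<rparr>)"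
    and "additive_subgroup I A" and "I \<subseteq> G 1"
    and "additive_subgroup J A" and "J \<subseteq> G (- 1)"
    and "subgroup_prod A R I \<subseteq> I" and "subgroup_prod A I R \<subseteq> I"
    and "subgroup_prod A R J \<subseteq> J" and "subgroup_prod A J R \<subseteq> J"
    and "subgroup_prod A J I \<subseteq> R"
    and "\<And>X. \<lbrakk>finite X; X \<subseteq> I\<rbrakk> \<Longrightarrow> \<exists>a\<in>subgroup_prod A I J. \<forall>i\<in>X. a \<otimes>\<^bsub>A\<^esub> i = i"
    and "\<And>Y. \<lbrakk>finite Y; Y \<subseteq> J\<rbrakk> \<Longrightarrow> \<exists>b\<in>subgroup_prod A I J. \<forall>j\<in>Y. j \<otimes>\<^bsub>A\<^esub> b = j"
    and "\<And>r a. \<lbrakk>r \<in> perp AR (annih A R I); a \<in> subgroup_prod A I J; r \<ominus>\<^bsub>A\<^esub> a \<in> annih A (G 0) I\<rbrakk>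
           \<Longrightarrow> a \<in> R"
    and "annih A R I \<inter> perp AR (annih A R I) = {\<zero>\<^bsub>A\<^esub>}"
  shows "\<exists>\<psi>. \<psi> \<in> bimodule_hom AR (tensor AR P Q) (ring_bimodule A R)
     \<and> (\<forall>j\<in>J. \<forall>i\<in>I. \<psi> (tens AR P Q j i) = j \<otimes>\<^bsub>A\<^esub> i)
     \<and> R_system AR P Q \<psi>
     \<and> cuntz_pimsner_defined AR P Q \<psi>
     \<and> (\<exists>\<phi>. graded_rng_iso (cuntz_pimsner AR P Q \<psi>) (cuntz_pimsner_grading AR P Q \<psi>)
               (A\<lparr>carrier := S\<rparr>) (\<lambda>n. S \<inter> G n) \<phi>)"
proof -
  interpret A: graded_rng A G by fact
  interpret R0: subrng R "A\<lparr>carrier := G 0\<rparr>" by fact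
  \<comment> \<open>\<open>R\<close> is given inside the degree \<open>0\<close> part and is first
    moved to the ambient ring \<open>A\<close>.\<close>
  have "subgroup R (add_monoid A)"
    by (rule A.add.incl_subgroup[of "G 0"])
      (use R0.a_subgroup additive_subgroup.a_subgroup[OF A.homogeneous_subgroup, of 0] in simp_all)
  then have R: "subrng R A"
    using R0.sub_m_closed by (intro subrng.intro additive_subgroupI subrng_axioms.intro) simp_all
  have R0: "R \<subseteq> G 0" using R0.a_subset by simp
  have prod: "x \<otimes>\<^bsub>A\<^esub> y \<in> Z" if "subgroup_prod A X Y \<subseteq> Z" "x \<in> X" "y \<in> Y" for X Y Z x y
    using A.subgroup_prod_incl that by blast
  interpret graded_system A G R I J
  proof (intro graded_system.intro graded_system_axioms.intro)
    show "a \<in> R" if "r \<in> perp (A\<lparr>carrier := R\<rparr>) (annih A R I)" "a \<in> subgroup_prod A I J"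
      "r \<ominus>\<^bsub>A\<^esub> a \<in> annih A (G 0) I" for r a
      using that unfolding AR_def[symmetric] by fact
    show "annih A R I \<inter> perp (A\<lparr>carrier := R\<rparr>) (annih A R I) = {\<zero>\<^bsub>A\<^esub>}"
      unfolding AR_def[symmetric] by fact
    show "r \<otimes>\<^bsub>A\<^esub> i \<in> I" "i \<otimes>\<^bsub>A\<^esub> r \<in> I" if "r \<in> R" "i \<in> I" for r i
      using prod \<open>subgroup_prod A R I \<subseteq> I\<close> \<open>subgroup_prod A I R \<subseteq> I\<close> that by blast+
    show "r \<otimes>\<^bsub>A\<^esub> j \<in> J" "j \<otimes>\<^bsub>A\<^esub> r \<in> J" if "r \<in> R" "j \<in> J" for r j
      using prod \<open>subgroup_prod A R J \<subseteq> J\<close> \<open>subgroup_prod A J R \<subseteq> J\<close> that by blast+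
    show "j \<otimes>\<^bsub>A\<^esub> i \<in> R" if "j \<in> J" "i \<in> I" for i j
      using prod \<open>subgroup_prod A J I \<subseteq> R\<close> that by blast
  qed (fact assms R R0)+
  obtain \<psi> where \<psi>: "\<psi> \<in> bimodule_hom AR (tensor AR P Q) (ring_bimodule A R)"
    "\<forall>j\<in>J. \<forall>i\<in>I. \<psi> (tens AR P Q j i) = j \<otimes>\<^bsub>A\<^esub> i"
    using mult_psi_exists unfolding AR_def P_def Q_def by blast
  interpret mult_system A G R I J \<psi>
    using \<psi> graded_system_axioms unfolding AR_def P_def Q_def
    by (intro mult_system.intro mult_system_axioms.intro) blast+
  show ?thesis
    using \<psi> system cuntz_pimsner_iso FS maximal_ideal
    unfolding AR_def P_def Q_def S_def cuntz_pimsner_defined_def by blast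
qed

end
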